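(* Let $\Omega\subset\mathbb{R}^d$ ($d\ge1$) be a bounded open domain. Let $a\in L^\infty(\Omega)$ satisfy $a\ge\underline{a}$ almost everywhere in $\Omega$ for some constant $\underline{a}>0$, and assume that there exist $q\in[1,+\infty]$, $\alpha\in(0,1]$ with $\alpha q>d$, and $g\in L^q(\Omega)$ such that $|a(x)-a(y)|\le g(x)|x-y|^\alpha$ for a.e. $(x,y)\in\Omega^2$. Let $u\in H^1(\Omega)$ be a weak solution of $-\operatorname{div}(a\nabla u)=\operatorname{div}F$ in $\Omega$, and let $\Omega'\Subset\Omega$ be a $\theta$-smooth subdomain (for some $\theta>0$). Then $$\forall r\in(2,+\infty),\qquad F\in L^r(\Omega)\quad\Longrightarrow\quad\nabla u\in L^r(\Omega').$$
   Context: $\Omega'\Subset\Omega$ means that $\Omega'\subset\Omega$ is an open subdomain with $\operatorname{dist}(\Omega',\partial\Omega)>0$. A bounded open set $D\subset\mathbb{R}^d$ is $\theta$-smooth if $|B(x,r)\cap D|\ge\theta v_d r^d$ for all $x\in D$ and all $r\in(0,\operatorname{diam}D)$, where $v_d$ is the volume of the unit ball of $\mathbb{R}^d$. Weak solution: $F$ is a square-integrable vector field on $\Omega$ and $\int_\Omega a\nabla u\cdot\nabla\varphi=-\int_\Omega F\cdot\nabla\varphi$ for all $\varphi\in C_c^\infty(\Omega)$. *)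

theory Defs
  imports "HOL-Analysis.Analysis"
begin

definition memLp :: "ennreal \<Rightarrow> 'a::euclidean_space set \<Rightarrow> ('a \<Rightarrow> 'b::euclidean_space) \<Rightarrow> bool" where
  "memLp p \<Omega> f \<longleftrightarrow>
     f \<in> borel_measurable (lebesgue_on \<Omega>) \<and>
     (if p = \<infinity> then \<exists>C. AE x in lebesgue_on \<Omega>. norm (f x) \<le> C
      else integrable (lebesgue_on \<Omega>) (\<lambda>x. norm (f x) powr enn2real p))"

primrec Ck :: "nat \<Rightarrow> ('a::euclidean_space \<Rightarrow> real) \<Rightarrow> bool" where
  "Ck 0 f \<longleftrightarrow> continuous_on UNIV f"
| "Ck (Suc k) f \<longleftrightarrow>
     (\<forall>x. f differentiable (at x)) \<and>
     (\<forall>i\<in>Basis. Ck k (\<lambda>x. frechet_derivative f (at x) i))"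

definition test_functions :: "'a::euclidean_space set \<Rightarrow> ('a \<Rightarrow> real) set" where
  "test_functions \<Omega> =
     {\<phi>. (\<forall>k. Ck k \<phi>) \<and> compact (closure {x. \<phi> x \<noteq> 0}) \<and> closure {x. \<phi> x \<noteq> 0} \<subseteq> \<Omega>}"

definition grad :: "('a::euclidean_space \<Rightarrow> real) \<Rightarrow> 'a \<Rightarrow> 'a" where
  "grad f x = (\<Sum>i\<in>Basis. frechet_derivative f (at x) i *\<^sub>R i)"

(* u belongs to H^1(\<Omega>) and Du is a representative of its distributional gradient; Du is
   determined by u up to a null subset of \<Omega>. *)
definition H1_with_gradient ::
  "'a::euclidean_space set \<Rightarrow> ('a \<Rightarrow> real) \<Rightarrow> ('a \<Rightarrow> 'a) \<Rightarrow> bool" where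
  "H1_with_gradient \<Omega> u Du \<longleftrightarrow>
     memLp 2 \<Omega> u \<and> memLp 2 \<Omega> Du \<and>
     (\<forall>\<phi>\<in>test_functions \<Omega>. \<forall>i\<in>Basis.
        (LINT x|lebesgue_on \<Omega>. u x * (grad \<phi> x \<bullet> i)) =
        - (LINT x|lebesgue_on \<Omega>. (Du x \<bullet> i) * \<phi> x))"

(* u is a weak solution of -div (a grad u) = div F in \<Omega>, with grad u represented by Du *)
definition weak_solution ::
  "'a::euclidean_space set \<Rightarrow> ('a \<Rightarrow> real) \<Rightarrow> ('a \<Rightarrow> 'a) \<Rightarrow> ('a \<Rightarrow> real) \<Rightarrow> ('a \<Rightarrow> 'a) \<Rightarrow> bool" where
  "weak_solution \<Omega> a F u Du \<longleftrightarrow>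
     H1_with_gradient \<Omega> u Du \<and> memLp 2 \<Omega> F \<and>
     (\<forall>\<phi>\<in>test_functions \<Omega>.
        (LINT x|lebesgue_on \<Omega>. a x * (Du x \<bullet> grad \<phi> x)) =
        - (LINT x|lebesgue_on \<Omega>. F x \<bullet> grad \<phi> x))"

(* setdist is 0 when one of the sets is empty. For bounded nonempty \<Omega> the frontier is nonempty,
   so the convention only excludes an empty \<Omega>'. *)
definition compactly_inside :: "'a::euclidean_space set \<Rightarrow> 'a set \<Rightarrow> bool" where
  "compactly_inside \<Omega>' \<Omega> \<longleftrightarrow> open \<Omega>' \<and> \<Omega>' \<subseteq> \<Omega> \<and> setdist \<Omega>' (frontier \<Omega>) > 0"

definition theta_smooth :: "real \<Rightarrow> 'a::euclidean_space set \<Rightarrow> bool" where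
  "theta_smooth \<theta> D \<longleftrightarrow>
     bounded D \<and> open D \<and>
     (\<forall>x\<in>D. \<forall>r\<in>{0<..<diameter D}.
        measure lebesgue (ball x r \<inter> D) \<ge> \<theta> * measure lebesgue (ball (0::'a) 1) * r ^ DIM('a))"

end

theory Submission
  imports Defs
begin

text \<open>
  The solution is differentiated only weakly, and every regularity estimate below comes from one
  mechanism: on a small ball \<open>B\<close> the coefficient is nearly a constant, and then \<open>\<nabla>u\<close> is nearly a
  field whose components are harmonic.

  \<^bold>\<open>Comparison on a ball.\<close> Project \<open>\<nabla>u\<close>, restricted to \<open>B\<close>, in mean square onto the closure of the
  gradients of test functions on \<open>B\<close>, and write \<open>\<nabla>u = w + h\<close>. The part \<open>h\<close> is orthogonal to
  gradients of test functions, that is divergence free, and it is curl free because both \<open>\<nabla>u\<close> and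
  \<open>w\<close> are. Hence its components are weakly harmonic, and mollification at all small scales gives
  the same value, so that \<open>\<bar>h\<bar>\<^sup>2\<close> is bounded on the half ball by the mean of \<open>\<bar>\<nabla>u\<bar>\<^sup>2\<close>
  (\<open>weakly_harmonic_bound\<close>). The part \<open>w\<close> is an admissible test field in the equation, and testing with
  it bounds the mean of \<open>\<bar>w\<bar>\<^sup>2\<close> by that of \<open>\<bar>F\<bar>\<^sup>2\<close> plus \<open>\<omega>\<^sup>2\<close> times that of \<open>\<bar>\<nabla>u\<bar>\<^sup>2\<close>, where \<open>\<omega>\<close> is the
  oscillation of the coefficient on \<open>B\<close> (\<open>local_comparison\<close>).

  \<^bold>\<open>The oscillation is small.\<close> The bound on \<open>\<bar>a x - a y\<bar>\<close> contains \<open>g\<close> at one point only, so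
  the value of \<open>a\<close> at a point of \<open>B\<close> where \<open>g\<close> is not larger than usual approximates \<open>a\<close> on \<open>B\<close>.
  The error is of order \<open>R\<close> to the power \<open>\<alpha> - d/q > 0\<close> (\<open>coefficient_oscillation\<close>).

  \<^bold>\<open>From comparison to integrability.\<close> Put \<open>P = \<bar>\<nabla>u\<bar>\<^sup>2\<close> and \<open>Q = \<bar>F\<bar>\<^sup>2\<close>, and let \<open>N\<close> be a large constant. Around a point where \<open>P\<close>
  is large take the largest ball on which the mean of \<open>P + N Q\<close> exceeds a high level; on its
  multiples the mean is below the level, so \<open>\<bar>h\<bar>\<^sup>2\<close> cannot reach a large multiple of the level and the
  part of \<open>P\<close> above that multiple is controlled by \<open>\<bar>w\<bar>\<^sup>2\<close>, which is small. A Vitali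
  covering adds these estimates up: the mass of \<open>P\<close> above level \<open>\<Lambda>l\<close> is at most a small multiple
  of its mass above level \<open>l\<close>, plus a term in \<open>Q\<close> (\<open>good_lambda_inequality\<close>). Summation over
  geometric levels turns the decay into a higher power of \<open>P\<close>
  (\<open>self_improving_integrability\<close>). Levels are measured relative to a power of the distance
  to the boundary, so the argument runs in all of \<open>\<Omega>\<close> at once, and that distance is bounded below on
  the subdomain.\<close>

section \<open>Partial derivatives and test functions\<close>

definition pd :: "'a::euclidean_space \<Rightarrow> ('a \<Rightarrow> real) \<Rightarrow> 'a \<Rightarrow> real" where
  "pd i f = (\<lambda>x. frechet_derivative f (at x) i)"

definition smooth :: "('a::euclidean_space \<Rightarrow> real) \<Rightarrow> bool" where
  "smooth f \<longleftrightarrow> (\<forall>k. Ck k f)"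

lemma Ck_Suc_iff: "Ck (Suc k) f \<longleftrightarrow> (\<forall>x. f differentiable (at x)) \<and> (\<forall>i\<in>Basis. Ck k (pd i f))"
  by (simp add: pd_def)

lemma Ck_Suc_imp: "Ck (Suc k) f \<Longrightarrow> Ck k f"
proof (induction k arbitrary: f)
  case 0
  then show ?case
    by (auto intro!: differentiable_imp_continuous_on simp: differentiable_on_def)
next
  case (Suc k)
  then show ?case by (metis Ck_Suc_iff)
qed

lemma smooth_differentiable: "smooth f \<Longrightarrow> f differentiable (at x)"
  unfolding smooth_def by (metis Ck.simps(2))

lemma smooth_continuous: "smooth f \<Longrightarrow> continuous_on S f"
  unfolding smooth_def by (metis Ck.simps(1) continuous_on_subset subset_UNIV)

lemma smooth_borel: "smooth f \<Longrightarrow> f \<in> borel_measurable borel"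
  by (intro borel_measurable_continuous_onI smooth_continuous)

lemma smooth_pd: "smooth f \<Longrightarrow> i \<in> Basis \<Longrightarrow> smooth (pd i f)"
  unfolding smooth_def by (metis Ck_Suc_iff)

lemma pd_eqI:
  assumes "(f has_derivative f') (at x)"
  shows "pd i f x = f' i"
  using frechet_derivative_at[OF assms] by (simp add: pd_def)

lemma pd_line:
  assumes "f differentiable (at (x + t *\<^sub>R i))"
  shows "((\<lambda>t. f (x + t *\<^sub>R i)) has_real_derivative pd i f (x + t *\<^sub>R i)) (at t)"
proof -
  let ?y = "x + t *\<^sub>R i"
  have d: "(f has_derivative frechet_derivative f (at ?y)) (at ?y)"
    using assms frechet_derivative_works by blast
  have "((\<lambda>t. x + t *\<^sub>R i) has_derivative (\<lambda>s. s *\<^sub>R i)) (at t)"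
    by (auto intro!: derivative_eq_intros)
  from has_derivative_compose[OF this d]
  have "((\<lambda>t. f (x + t *\<^sub>R i)) has_derivative (\<lambda>s. frechet_derivative f (at ?y) (s *\<^sub>R i))) (at t)" .
  moreover have "(\<lambda>s. frechet_derivative f (at ?y) (s *\<^sub>R i)) = (*) (pd i f ?y)"
    using linear_frechet_derivative[OF assms] by (auto simp: linear_scale pd_def fun_eq_iff)
  ultimately show ?thesis by (simp add: has_field_derivative_def)
qed

lemma pd_const: "pd i (\<lambda>x. c) = (\<lambda>x. 0)"
  by (simp add: pd_def)

lemma pd_add:
  assumes "\<And>x. f differentiable (at x)" "\<And>x. g differentiable (at x)"
  shows "pd i (\<lambda>x. f x + g x) = (\<lambda>x. pd i f x + pd i g x)"
  unfolding pd_def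
  by (rule ext) (simp add: frechet_derivative_at[symmetric, OF has_derivative_add[OF
        assms(1)[unfolded frechet_derivative_works] assms(2)[unfolded frechet_derivative_works]]])

lemma pd_mult:
  assumes "\<And>x. f differentiable (at x)" "\<And>x. g differentiable (at x)"
  shows "pd i (\<lambda>x. f x * g x) = (\<lambda>x. f x * pd i g x + pd i f x * g x)"
  unfolding pd_def
  by (rule ext) (simp add: frechet_derivative_at[symmetric, OF has_derivative_mult[OF
        assms(1)[unfolded frechet_derivative_works] assms(2)[unfolded frechet_derivative_works]]])

lemma Ck_const: "Ck k (\<lambda>x. c)"
  by (induction k arbitrary: c) auto

lemma Ck_add: "Ck k f \<Longrightarrow> Ck k g \<Longrightarrow> Ck k (\<lambda>x. f x + g x)"
proof (induction k arbitrary: f g)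
  case 0 then show ?case by (auto intro: continuous_on_add)
next
  case (Suc k)
  then have df: "\<And>x. f differentiable (at x)" "\<And>x. g differentiable (at x)" by auto
  show ?case unfolding Ck_Suc_iff pd_add[OF df]
    using Suc by (auto simp: Ck_Suc_iff simp del: Ck.simps)
qed

lemma Ck_mult: "Ck k f \<Longrightarrow> Ck k g \<Longrightarrow> Ck k (\<lambda>x. f x * g x)"
proof (induction k arbitrary: f g)
  case 0 then show ?case by (auto intro: continuous_on_mult)
next
  case (Suc k)
  then have df: "\<And>x. f differentiable (at x)" "\<And>x. g differentiable (at x)" by auto
  have k: "Ck k f" "Ck k g" using Suc.prems Ck_Suc_imp by blast+
  show ?case unfolding Ck_Suc_iff pd_mult[OF df]
    using Suc k by (auto simp: Ck_Suc_iff simp del: Ck.simps intro!: Ck_add)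
qed

lemma smooth_const: "smooth (\<lambda>x. c)"
  by (simp add: smooth_def Ck_const)

lemma smooth_add: "smooth f \<Longrightarrow> smooth g \<Longrightarrow> smooth (\<lambda>x. f x + g x)"
  by (simp add: smooth_def Ck_add)

lemma smooth_mult: "smooth f \<Longrightarrow> smooth g \<Longrightarrow> smooth (\<lambda>x. f x * g x)"
  by (simp add: smooth_def Ck_mult)

lemma smooth_cmult: "smooth f \<Longrightarrow> smooth (\<lambda>x. c * f x)"
  by (simp add: smooth_mult smooth_const)

lemma smooth_sum: "finite I \<Longrightarrow> (\<And>i. i \<in> I \<Longrightarrow> smooth (f i)) \<Longrightarrow> smooth (\<lambda>x. \<Sum>i\<in>I. f i x)"
  by (induction I rule: finite_induct) (auto intro: smooth_add smooth_const)

lemma smooth_inner_shift: "smooth (\<lambda>y. (y - x) \<bullet> i)"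
proof -
  have d: "((\<lambda>y. (y - x) \<bullet> i) has_derivative (\<lambda>v. v \<bullet> i)) (at y)" for y
    by (auto intro!: derivative_eq_intros)
  have p: "pd j (\<lambda>y. (y - x) \<bullet> i) = (\<lambda>y. j \<bullet> i)" for j
    using pd_eqI[OF d] by auto
  have "Ck (Suc k) (\<lambda>y. (y - x) \<bullet> i)" for k
    unfolding Ck_Suc_iff p using d by (auto simp: Ck_const differentiable_def simp del: Ck.simps)
  then show ?thesis unfolding smooth_def using Ck_Suc_imp by blast
qed

text \<open>Symmetry of second derivatives, from the mean value theorem applied twice to the second
  difference of \<open>f\<close> along the two directions.\<close>

lemma second_difference:
  fixes f :: "'a::euclidean_space \<Rightarrow> real"
  assumes f: "smooth f" and i: "i \<in> Basis" and s: "s > 0"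
  shows "\<exists>\<xi> \<zeta>. 0 < \<xi> \<and> \<xi> < s \<and> 0 < \<zeta> \<and> \<zeta> < s \<and>
    f (x + s *\<^sub>R i + s *\<^sub>R j) - f (x + s *\<^sub>R i) - f (x + s *\<^sub>R j) + f x
    = s * (s * pd j (pd i f) (x + \<xi> *\<^sub>R i + \<zeta> *\<^sub>R j))"
proof -
  let ?g = "\<lambda>t. f ((x + s *\<^sub>R j) + t *\<^sub>R i) - f (x + t *\<^sub>R i)"
  have "\<exists>\<xi>. 0 < \<xi> \<and> \<xi> < s \<and> ?g s - ?g 0 = (s - 0) * (pd i f ((x + s *\<^sub>R j) + \<xi> *\<^sub>R i) - pd i f (x + \<xi> *\<^sub>R i))"
    by (rule MVT2[OF s]) (intro derivative_intros pd_line smooth_differentiable f)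
  then obtain \<xi> where xi: "0 < \<xi>" "\<xi> < s"
    and e1: "?g s - ?g 0 = s * (pd i f ((x + s *\<^sub>R j) + \<xi> *\<^sub>R i) - pd i f (x + \<xi> *\<^sub>R i))" by auto
  let ?k = "\<lambda>t. pd i f ((x + \<xi> *\<^sub>R i) + t *\<^sub>R j)"
  have "\<exists>\<zeta>. 0 < \<zeta> \<and> \<zeta> < s \<and> ?k s - ?k 0 = (s - 0) * pd j (pd i f) ((x + \<xi> *\<^sub>R i) + \<zeta> *\<^sub>R j)"
    by (rule MVT2[OF s]) (intro derivative_intros pd_line smooth_differentiable smooth_pd f i)
  then obtain \<zeta> where ze: "0 < \<zeta>" "\<zeta> < s"
    and e2: "?k s - ?k 0 = s * pd j (pd i f) ((x + \<xi> *\<^sub>R i) + \<zeta> *\<^sub>R j)" by auto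
  have "?g s - ?g 0 = s * (?k s - ?k 0)" using e1 by (simp add: algebra_simps)
  with e2 have "?g s - ?g 0 = s * (s * pd j (pd i f) (x + \<xi> *\<^sub>R i + \<zeta> *\<^sub>R j))" by simp
  then show ?thesis using xi ze by (intro exI[of _ \<xi>] exI[of _ \<zeta>]) (simp add: algebra_simps)
qed

lemma pd_commute:
  fixes f :: "'a::euclidean_space \<Rightarrow> real"
  assumes f: "smooth f" and i: "i \<in> Basis" and j: "j \<in> Basis"
  shows "pd i (pd j f) = pd j (pd i f)"
proof
  fix x
  define s where "s n = inverse (real (Suc n))" for n
  have s0: "s n > 0" for n by (simp add: s_def)
  have sl: "s \<longlonglongrightarrow> 0" unfolding s_def by (rule LIMSEQ_inverse_real_of_nat)
  obtain \<xi> \<zeta> where 1: "\<And>n. 0 < \<xi> n \<and> \<xi> n < s n \<and> 0 < \<zeta> n \<and> \<zeta> n < s n \<and>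
    f (x + s n *\<^sub>R i + s n *\<^sub>R j) - f (x + s n *\<^sub>R i) - f (x + s n *\<^sub>R j) + f x
    = s n * (s n * pd j (pd i f) (x + \<xi> n *\<^sub>R i + \<zeta> n *\<^sub>R j))"
    using second_difference[OF f i s0, of _ x j] by metis
  obtain \<xi>' \<zeta>' where 2: "\<And>n. 0 < \<xi>' n \<and> \<xi>' n < s n \<and> 0 < \<zeta>' n \<and> \<zeta>' n < s n \<and>
    f (x + s n *\<^sub>R j + s n *\<^sub>R i) - f (x + s n *\<^sub>R j) - f (x + s n *\<^sub>R i) + f x
    = s n * (s n * pd i (pd j f) (x + \<xi>' n *\<^sub>R j + \<zeta>' n *\<^sub>R i))"
    using second_difference[OF f j s0, of _ x i] by metis
  have eq: "pd j (pd i f) (x + \<xi> n *\<^sub>R i + \<zeta> n *\<^sub>R j) = pd i (pd j f) (x + \<xi>' n *\<^sub>R j + \<zeta>' n *\<^sub>R i)" for n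
  proof -
    have "s n * (s n * pd j (pd i f) (x + \<xi> n *\<^sub>R i + \<zeta> n *\<^sub>R j))
        = s n * (s n * pd i (pd j f) (x + \<xi>' n *\<^sub>R j + \<zeta>' n *\<^sub>R i))"
      using 1[of n] 2[of n] by (simp add: algebra_simps)
    then show ?thesis using s0[of n] by simp
  qed
  have sq: "u \<longlonglongrightarrow> 0" if "\<And>n. 0 < u n \<and> u n < s n" for u :: "nat \<Rightarrow> real"
    by (rule tendsto_sandwich[OF _ _ tendsto_const sl]) (use that in \<open>auto intro!: always_eventually less_imp_le\<close>)
  have z: "\<xi> \<longlonglongrightarrow> 0" "\<zeta> \<longlonglongrightarrow> 0" "\<xi>' \<longlonglongrightarrow> 0" "\<zeta>' \<longlonglongrightarrow> 0"
    using 1 2 by (auto intro!: sq)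
  have c: "isCont (pd j (pd i f)) x" "isCont (pd i (pd j f)) x"
    using smooth_continuous[OF smooth_pd[OF smooth_pd[OF f i] j], of UNIV]
      smooth_continuous[OF smooth_pd[OF smooth_pd[OF f j] i], of UNIV]
    by (auto simp: continuous_on_eq_continuous_at)
  have "(\<lambda>n. x + \<xi> n *\<^sub>R i + \<zeta> n *\<^sub>R j) \<longlonglongrightarrow> x + 0 *\<^sub>R i + 0 *\<^sub>R j"
    by (intro tendsto_intros z)
  then have a: "(\<lambda>n. pd j (pd i f) (x + \<xi> n *\<^sub>R i + \<zeta> n *\<^sub>R j)) \<longlonglongrightarrow> pd j (pd i f) x"
    using isCont_tendsto_compose[OF c(1)] by simp
  have "(\<lambda>n. x + \<xi>' n *\<^sub>R j + \<zeta>' n *\<^sub>R i) \<longlonglongrightarrow> x + 0 *\<^sub>R j + 0 *\<^sub>R i"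
    by (intro tendsto_intros z)
  then have b: "(\<lambda>n. pd i (pd j f) (x + \<xi>' n *\<^sub>R j + \<zeta>' n *\<^sub>R i)) \<longlonglongrightarrow> pd i (pd j f) x"
    using isCont_tendsto_compose[OF c(2)] by simp
  show "pd i (pd j f) x = pd j (pd i f) x"
    using LIMSEQ_unique[OF a] b by (simp add: eq)
qed

lemma grad_inner: "i \<in> Basis \<Longrightarrow> grad f x \<bullet> i = pd i f x"
  by (simp add: grad_def pd_def inner_sum_left inner_Basis if_distrib cong: if_cong)

lemma grad_eq: "grad f x = (\<Sum>i\<in>Basis. pd i f x *\<^sub>R i)"
  by (simp add: grad_def pd_def)

lemma test_functionsD:
  assumes "\<phi> \<in> test_functions U"
  shows "smooth \<phi>" "compact (closure {x. \<phi> x \<noteq> 0})" "closure {x. \<phi> x \<noteq> 0} \<subseteq> U"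
  using assms unfolding test_functions_def smooth_def by blast+

text \<open>Any compact set off which the function vanishes can play the role of the closed support, both when
  a test function is built and when one is used.\<close>

lemma test_functionsI:
  assumes "smooth \<phi>" "compact K" "K \<subseteq> U" "\<And>x. x \<notin> K \<Longrightarrow> \<phi> x = 0"
  shows "\<phi> \<in> test_functions U"
proof -
  have "closure {x. \<phi> x \<noteq> 0} \<subseteq> K"
    using assms by (intro closure_minimal) (auto simp: compact_imp_closed)
  moreover have "compact (closure {x. \<phi> x \<noteq> 0})"
    using compact_Int_closed[OF assms(2) closed_closure] calculation by (metis Int_absorb1)
  ultimately show ?thesis
    using assms(1,3) unfolding test_functions_def smooth_def by (simp only: mem_Collect_eq) blast
qed

lemma test_functionsE:
  assumes "\<phi> \<in> test_functions U"
  obtains K where "smooth \<phi>" "compact K" "K \<subseteq> U" "\<And>x. x \<notin> K \<Longrightarrow> \<phi> x = 0"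
    "\<And>x i. x \<notin> K \<Longrightarrow> pd i \<phi> x = 0"
proof
  let ?K = "closure {x. \<phi> x \<noteq> 0}"
  show "smooth \<phi>" "compact ?K" "?K \<subseteq> U" by (rule test_functionsD[OF assms])+
  show z: "\<phi> x = 0" if "x \<notin> ?K" for x using that closure_subset[of "{x. \<phi> x \<noteq> 0}"] by auto
  show "pd i \<phi> x = 0" if "x \<notin> ?K" for x i
  proof -
    have "(\<phi> has_derivative (\<lambda>v. 0)) (at x)"
    proof (rule has_derivative_transform_within_open[where f="\<lambda>x. 0" and s="- ?K"])
      show "x \<in> - ?K" using that by simp
      show "0 = \<phi> y" if "y \<in> - ?K" for y using z[of y] that by simp
    qed auto
    from pd_eqI[OF this] show ?thesis .
  qed
qed

lemma test_functions_outside: "\<phi> \<in> test_functions U \<Longrightarrow> y \<notin> U \<Longrightarrow> \<phi> y = 0"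
  by (erule test_functionsE) blast

lemma test_functions_mono: "\<phi> \<in> test_functions U \<Longrightarrow> U \<subseteq> V \<Longrightarrow> \<phi> \<in> test_functions V"
  by (auto simp: test_functions_def)

lemma test_functions_pd: "\<phi> \<in> test_functions U \<Longrightarrow> i \<in> Basis \<Longrightarrow> pd i \<phi> \<in> test_functions U"
  by (erule test_functionsE, rule test_functionsI) (blast intro: smooth_pd)+

lemma test_functions_add:
  assumes "\<phi> \<in> test_functions U" "\<psi> \<in> test_functions U"
  shows "(\<lambda>x. \<phi> x + \<psi> x) \<in> test_functions U"
proof -
  obtain K where K: "compact K" "K \<subseteq> U" "\<And>x. x \<notin> K \<Longrightarrow> \<phi> x = 0" "smooth \<phi>" by (rule test_functionsE[OF assms(1)]) blast
  obtain L where L: "compact L" "L \<subseteq> U" "\<And>x. x \<notin> L \<Longrightarrow> \<psi> x = 0" "smooth \<psi>" by (rule test_functionsE[OF assms(2)]) blast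
  show ?thesis by (rule test_functionsI[of _ "K \<union> L"]) (use K L in \<open>auto intro: smooth_add\<close>)
qed

lemma test_functions_mult:
  assumes "\<phi> \<in> test_functions U" "smooth \<psi>"
  shows "(\<lambda>x. \<psi> x * \<phi> x) \<in> test_functions U"
proof (rule test_functionsE[OF assms(1)])
  fix K assume "smooth \<phi>" "compact K" "K \<subseteq> U" "\<And>x. x \<notin> K \<Longrightarrow> \<phi> x = 0"
  then show ?thesis by (intro test_functionsI[of _ K] smooth_mult assms) auto
qed

lemma test_functions_zero: "(\<lambda>x. 0) \<in> test_functions U"
  by (rule test_functionsI[of _ "{}"]) (auto intro: smooth_const)

lemma test_functions_sum:
  "finite I \<Longrightarrow> (\<And>i. i \<in> I \<Longrightarrow> f i \<in> test_functions U) \<Longrightarrow> (\<lambda>x. \<Sum>i\<in>I. f i x) \<in> test_functions U"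
  by (induction I rule: finite_induct) (auto intro: test_functions_add test_functions_zero)

lemma test_functions_bounded:
  assumes "\<phi> \<in> test_functions U"
  obtains B where "\<And>x. \<bar>\<phi> x\<bar> \<le> B" "B \<ge> 0"
proof (rule test_functionsE[OF assms])
  fix K assume K: "smooth \<phi>" "compact K" "\<And>x. x \<notin> K \<Longrightarrow> \<phi> x = 0"
  have "bounded (\<phi> ` K)"
    using K by (intro compact_imp_bounded compact_continuous_image smooth_continuous) auto
  then obtain B where B: "\<And>x. x \<in> K \<Longrightarrow> \<bar>\<phi> x\<bar> \<le> B" by (auto simp: bounded_iff)
  show ?thesis
  proof (rule that)
    show "\<bar>\<phi> x\<bar> \<le> max B 0" for x
      using B[of x] K(3)[of x] by (cases "x \<in> K") auto
  qed auto
qed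

lemma test_functions_integrable:
  assumes "\<phi> \<in> test_functions U"
  shows "integrable lborel \<phi>"
proof (rule test_functionsE[OF assms])
  fix K assume K: "smooth \<phi>" "compact K" "\<And>x. x \<notin> K \<Longrightarrow> \<phi> x = 0"
  have "set_integrable lborel K \<phi>"
    using K unfolding set_integrable_def by (intro borel_integrable_compact smooth_continuous)
  moreover have "(\<lambda>x. indicator K x *\<^sub>R \<phi> x) = \<phi>"
    using K(3) by (intro ext) (auto simp: indicator_def)
  ultimately show ?thesis by (simp add: set_integrable_def)
qed

lemma pd_test_bound_quotient:
  assumes "\<phi> \<in> test_functions U" "i \<in> Basis" "t > 0" and B: "\<And>x. \<bar>pd i \<phi> x\<bar> \<le> B"
  shows "\<bar>(\<phi> (x + t *\<^sub>R i) - \<phi> x) / t\<bar> \<le> B"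
proof -
  have "\<exists>z. 0 < z \<and> z < t \<and> \<phi> (x + t *\<^sub>R i) - \<phi> (x + 0 *\<^sub>R i) = (t - 0) * pd i \<phi> (x + z *\<^sub>R i)"
    by (rule MVT2[OF assms(3)]) (intro pd_line smooth_differentiable test_functionsD(1)[OF assms(1)])
  then obtain z where "\<phi> (x + t *\<^sub>R i) - \<phi> x = t * pd i \<phi> (x + z *\<^sub>R i)" by auto
  then show ?thesis using assms(3) B by simp
qed

text \<open>By translation invariance the difference quotients of \<open>\<phi>\<close> have integral zero, and they converge
  boundedly to the derivative inside a fixed compact set.\<close>

lemma integral_pd_test_function:
  fixes \<phi> :: "'a::euclidean_space \<Rightarrow> real"
  assumes "\<phi> \<in> test_functions U" "i \<in> Basis"
  shows "(LINT x|lborel. pd i \<phi> x) = 0"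
proof -
  obtain K where K: "smooth \<phi>" "compact K" "\<And>x. x \<notin> K \<Longrightarrow> \<phi> x = 0" by (rule test_functionsE[OF assms(1)]) blast
  obtain B where B: "\<And>x. \<bar>pd i \<phi> x\<bar> \<le> B" "B \<ge> 0"
    using test_functions_bounded[OF test_functions_pd[OF assms]] by blast
  define t where "t n = inverse (real (Suc n))" for n
  have t0: "t n > 0" "t n \<le> 1" for n by (auto simp: t_def field_simps)
  have tl: "t \<longlonglongrightarrow> 0" unfolding t_def by (rule LIMSEQ_inverse_real_of_nat)
  obtain e where e: "\<And>x. x \<in> K \<Longrightarrow> norm x \<le> e"
    using compact_imp_bounded[OF K(2)] by (auto simp: bounded_iff)
  let ?q = "\<lambda>n x. (\<phi> (x + t n *\<^sub>R i) - \<phi> x) / t n"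
  have m[measurable]: "\<phi> \<in> borel_measurable borel" using K(1) smooth_borel by blast
  have mp[measurable]: "pd i \<phi> \<in> borel_measurable borel" using K(1) smooth_borel smooth_pd assms(2) by blast
  have "(\<lambda>n. LINT x|lborel. ?q n x) \<longlonglongrightarrow> (LINT x|lborel. pd i \<phi> x)"
  proof (rule integral_dominated_convergence[where w="\<lambda>x. B * indicator (cball 0 (e+1)) x"])
    show "integrable lborel (\<lambda>x::'a. B * indicator (cball 0 (e + 1)) x :: real)"
      using emeasure_lborel_cball_finite[of "0::'a" "e + 1"]
      by (intro integrable_mult_right integrable_real_indicator) auto
    show "AE x in lborel. (\<lambda>n. ?q n x) \<longlonglongrightarrow> pd i \<phi> x"
    proof (rule AE_I2)
      fix x :: 'a
      have "((\<lambda>s. \<phi> (x + s *\<^sub>R i)) has_real_derivative pd i \<phi> (x + 0 *\<^sub>R i)) (at 0)"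
        by (intro pd_line smooth_differentiable K)
      then have "((\<lambda>h. (\<phi> (x + (0 + h) *\<^sub>R i) - \<phi> (x + 0 *\<^sub>R i)) / h) \<longlongrightarrow> pd i \<phi> (x + 0 *\<^sub>R i)) (at 0)"
        unfolding DERIV_def .
      then have *: "((\<lambda>h. (\<phi> (x + h *\<^sub>R i) - \<phi> x) / h) \<longlongrightarrow> pd i \<phi> x) (at 0)" by simp
      have "filterlim t (at 0) sequentially"
        using tl t0(1) by (auto simp: filterlim_at less_imp_neq[THEN not_sym] intro!: always_eventually)
      from filterlim_compose[OF * this] show "(\<lambda>n. ?q n x) \<longlonglongrightarrow> pd i \<phi> x" .
    qed
    show "AE x in lborel. norm (?q n x) \<le> B * indicator (cball 0 (e + 1)) x" for n
    proof (rule AE_I2)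
      fix x :: 'a
      show "norm (?q n x) \<le> B * indicator (cball 0 (e + 1)) x"
      proof (cases "x \<in> cball 0 (e+1)")
        case True
        then show ?thesis using pd_test_bound_quotient[OF assms t0(1)[of n] B(1), of x] by simp
      next
        case False
        have "norm x \<le> norm (x + t n *\<^sub>R i) + norm (t n *\<^sub>R i)" by (metis add_diff_cancel_right' norm_triangle_ineq4)
        moreover have "norm (t n *\<^sub>R i) \<le> 1" using t0[of n] assms(2) by simp
        ultimately have "x \<notin> K" "x + t n *\<^sub>R i \<notin> K" using False e[of x] e[of "x + t n *\<^sub>R i"] by auto
        then show ?thesis using K(3) B(2) by simp
      qed
    qed
  qed auto
  moreover have "(\<lambda>n. LINT x|lborel. ?q n x) = (\<lambda>n. 0)"
  proof
    fix n
    have i1: "integrable lborel \<phi>" by (rule test_functions_integrable[OF assms(1)])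
    have D: "lborel = distr lborel borel (\<lambda>x. t n *\<^sub>R i + x)"
      by (rule lborel_distr_plus[symmetric])
    have i2: "integrable lborel (\<lambda>x. \<phi> (x + t n *\<^sub>R i))"
    proof -
      have "integrable (distr lborel borel (\<lambda>x. t n *\<^sub>R i + x)) \<phi>" using i1 D by simp
      then show ?thesis by (subst (asm) integrable_distr_eq) (auto simp: add.commute)
    qed
    have "(LINT x|lborel. \<phi> x) = (LINT x|distr lborel borel (\<lambda>x. t n *\<^sub>R i + x). \<phi> x)" using D by simp
    also have "\<dots> = (LINT x|lborel. \<phi> (x + t n *\<^sub>R i))"
      by (subst integral_distr) (auto simp: add.commute)
    finally have "(LINT x|lborel. \<phi> x) = (LINT x|lborel. \<phi> (x + t n *\<^sub>R i))" .
    then show "(LINT x|lborel. ?q n x) = 0" using i1 i2 by simp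
  qed
  ultimately show ?thesis by (simp add: LIMSEQ_const_iff)
qed

lemma integration_by_parts:
  assumes "\<psi> \<in> test_functions U" "smooth \<phi>" "i \<in> Basis"
  shows "(LINT x|lborel. \<phi> x * pd i \<psi> x) = - (LINT x|lborel. pd i \<phi> x * \<psi> x)"
proof -
  have s: "smooth \<psi>" using test_functionsD(1)[OF assms(1)] .
  have t: "(\<lambda>x. \<phi> x * \<psi> x) \<in> test_functions U" by (rule test_functions_mult[OF assms(1,2)])
  have p: "pd i (\<lambda>x. \<phi> x * \<psi> x) = (\<lambda>x. \<phi> x * pd i \<psi> x + pd i \<phi> x * \<psi> x)"
    by (rule pd_mult) (intro smooth_differentiable s assms)+
  have "(LINT x|lborel. \<phi> x * pd i \<psi> x + pd i \<phi> x * \<psi> x) = 0"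
    using integral_pd_test_function[OF t assms(3)] unfolding p .
  moreover have "integrable lborel (\<lambda>x. \<phi> x * pd i \<psi> x)"
    by (rule test_functions_integrable[OF test_functions_mult[OF test_functions_pd[OF assms(1,3)] assms(2)]])
  moreover have "integrable lborel (\<lambda>x. pd i \<phi> x * \<psi> x)"
    by (rule test_functions_integrable[OF test_functions_mult[OF assms(1) smooth_pd[OF assms(2,3)]]])
  ultimately show ?thesis by simp
qed

section \<open>Lebesgue points\<close>

text \<open>As a measure, the set function \<open>A \<mapsto> \<integral>\<^sub>A P\<close> is countably additive over families of balls.\<close>

definition wmeas :: "('a::euclidean_space \<Rightarrow> real) \<Rightarrow> 'a measure" where
  "wmeas P = density lborel (\<lambda>x. ennreal (P x))"

lemma sets_wmeas [simp, measurable_cong]: "sets (wmeas P) = sets borel"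
  by (simp add: wmeas_def)

lemma space_wmeas [simp]: "space (wmeas P) = UNIV"
  by (simp add: wmeas_def)

lemma emeasure_wmeas:
  assumes [measurable]: "P \<in> borel_measurable borel" "A \<in> sets borel"
  shows "emeasure (wmeas P) A = (\<integral>\<^sup>+x. ennreal (P x) * indicator A x \<partial>lborel)"
  unfolding wmeas_def by (subst emeasure_density) auto

lemma emeasure_wmeas_integral:
  assumes [measurable]: "P \<in> borel_measurable borel" "A \<in> sets borel"
    and "\<And>x. 0 \<le> P x" "set_integrable lborel A P"
  shows "emeasure (wmeas P) A = ennreal (LINT x:A|lborel. P x)"
proof -
  have "emeasure (wmeas P) A = (\<integral>\<^sup>+x. ennreal (indicator A x *\<^sub>R P x) \<partial>lborel)"
    unfolding emeasure_wmeas[OF assms(1,2)] by (intro nn_integral_cong) (simp add: indicator_def)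
  also have "\<dots> = ennreal (LINT x:A|lborel. P x)"
    unfolding set_lebesgue_integral_def
    by (rule nn_integral_eq_integral) (use assms in \<open>auto simp: set_integrable_def indicator_def\<close>)
  finally show ?thesis .
qed

lemma finite_measure_wmeas:
  assumes "integrable lborel P" "\<And>x. 0 \<le> P x"
  shows "finite_measure (wmeas P)"
proof
  have [measurable]: "P \<in> borel_measurable borel" using assms(1) by auto
  have "emeasure (wmeas P) UNIV = ennreal (LINT x:UNIV|lborel. P x)"
    by (rule emeasure_wmeas_integral) (use assms in \<open>auto simp: set_integrable_def\<close>)
  then show "emeasure (wmeas P) (space (wmeas P)) \<noteq> \<infinity>" by simp
qed

text \<open>Comparing two measures ball by ball: the balls that carry the larger measure must be disjoint, the
  sets that carry the smaller one may overlap.\<close>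

lemma emeasure_UN_mono_disjoint:
  assumes I: "countable I" and A[measurable]: "\<And>i. i \<in> I \<Longrightarrow> A i \<in> sets M"
    and B[measurable]: "\<And>i. i \<in> I \<Longrightarrow> B i \<in> sets N"
    and d: "disjoint_family_on B I"
    and le: "\<And>i. i \<in> I \<Longrightarrow> emeasure M (A i) \<le> emeasure N (B i)"
  shows "emeasure M (\<Union>i\<in>I. A i) \<le> emeasure N (\<Union>i\<in>I. B i)"
proof -
  have U[measurable]: "(\<Union>i\<in>I. A i) \<in> sets M" by (rule sets.countable_UN'[OF I]) (auto simp: A)
  have "emeasure M (\<Union>i\<in>I. A i) = (\<integral>\<^sup>+x. indicator (\<Union>i\<in>I. A i) x \<partial>M)" by simp
  also have "\<dots> \<le> (\<integral>\<^sup>+x. \<integral>\<^sup>+i. indicator (A i) x \<partial>count_space I \<partial>M)"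
  proof (rule nn_integral_mono)
    fix x
    show "indicator (\<Union>i\<in>I. A i) x \<le> (\<integral>\<^sup>+i. indicator (A i) x \<partial>count_space I)"
    proof (cases "x \<in> (\<Union>i\<in>I. A i)")
      case True
      then obtain j where j: "j \<in> I" "x \<in> A j" by auto
      then have "(\<integral>\<^sup>+i. indicator (A i) x \<partial>count_space I) \<ge> (\<integral>\<^sup>+i. indicator {j} i \<partial>count_space I)"
        by (intro nn_integral_mono) (auto simp: indicator_def)
      then show ?thesis using j True by (simp add: one_ennreal_def[symmetric])
    qed simp
  qed
  also have "\<dots> = (\<integral>\<^sup>+i. \<integral>\<^sup>+x. indicator (A i) x \<partial>M \<partial>count_space I)"
    by (rule nn_integral_count_space_nn_integral[OF I]) (auto simp: A)
  also have "\<dots> = (\<integral>\<^sup>+i. emeasure M (A i) \<partial>count_space I)"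
    by (intro nn_integral_cong) simp
  also have "\<dots> \<le> (\<integral>\<^sup>+i. emeasure N (B i) \<partial>count_space I)"
    by (intro nn_integral_mono) (simp add: le)
  also have "\<dots> = emeasure N (\<Union>i\<in>I. B i)"
    by (rule emeasure_UN_countable[symmetric, OF B I d])
  finally show ?thesis .
qed

lemma measurable_emeasure_wmeas_cball [measurable]:
  assumes [measurable]: "P \<in> borel_measurable borel"
  shows "(\<lambda>x. emeasure (wmeas P) (cball x r)) \<in> borel_measurable borel"
proof -
  have "(\<lambda>x. emeasure (wmeas P) (cball x r)) = (\<lambda>x. \<integral>\<^sup>+y. ennreal (P y) * (if dist x y \<le> r then 1 else 0) \<partial>lborel)"
    by (auto simp: emeasure_wmeas fun_eq_iff indicator_def intro!: nn_integral_cong)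
  moreover have "\<dots> \<in> borel_measurable borel"
    by (intro lborel.borel_measurable_nn_integral) measurable
  ultimately show ?thesis by simp
qed

lemma wmeas_outer_regular:
  assumes P: "integrable lborel P" "\<And>x. 0 \<le> P x" and E: "E \<in> sets borel" and e: "e > 0"
  obtains U where "open U" "E \<subseteq> U" "emeasure (wmeas P) U \<le> emeasure (wmeas P) E + ennreal e"
proof -
  interpret finite_measure "wmeas P" by (rule finite_measure_wmeas[OF P])
  have r: "emeasure (wmeas P) E = (INF U \<in> {U. E \<subseteq> U \<and> open U}. emeasure (wmeas P) U)"
    by (rule outer_regular) (use E emeasure_finite[of UNIV] in auto)
  obtain t where t: "emeasure (wmeas P) E = ennreal t" "t \<ge> 0"
    using emeasure_finite[of E] by (cases "emeasure (wmeas P) E") auto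
  have "emeasure (wmeas P) E < emeasure (wmeas P) E + ennreal e"
    using e t by (simp add: ennreal_plus[symmetric] ennreal_less_iff del: ennreal_plus)
  then have "\<exists>U\<in>{U. E \<subseteq> U \<and> open U}. emeasure (wmeas P) U < emeasure (wmeas P) E + ennreal e"
    by (subst (asm) r) (simp only: Inf_less_iff image_iff, blast)
  then show ?thesis using that less_imp_le by blast
qed

text \<open>If many small balls around the points of \<open>E\<close> have average above \<open>c\<close>, a Vitali subfamily inside an
  open neighbourhood of \<open>E\<close> fills \<open>E\<close> up to a null set, so the mean of \<open>P\<close> over \<open>E\<close> is at
  least \<open>c\<close>.\<close>

lemma vitali_mean_lower_bound:
  fixes P :: "'a::euclidean_space \<Rightarrow> real" and r :: "nat \<Rightarrow> real"
  assumes P: "integrable lborel P" "\<And>x. 0 \<le> P x" and E[measurable]: "E \<in> sets borel"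
    and r: "\<And>k. r k > 0" "r \<longlonglongrightarrow> 0"
    and fr: "\<And>x. x \<in> E \<Longrightarrow> \<exists>\<^sub>F k in sequentially. emeasure (wmeas P) (cball x (r k)) \<ge> ennreal c * emeasure lborel (cball x (r k))"
  shows "ennreal c * emeasure lborel E \<le> emeasure (wmeas P) E"
proof (rule ennreal_le_epsilon)
  fix e :: real assume e: "0 < e"
  obtain U where U: "open U" "E \<subseteq> U" "emeasure (wmeas P) U \<le> emeasure (wmeas P) E + ennreal e"
    by (rule wmeas_outer_regular[OF P E e])
  let ?K = "{(x, k). x \<in> E \<and> cball x (r k) \<subseteq> U \<and> emeasure (wmeas P) (cball x (r k)) \<ge> ennreal c * emeasure lborel (cball x (r k))}"
  obtain C where C: "countable C" "C \<subseteq> ?K"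
    "pairwise (\<lambda>i j. disjnt (cball (fst i) (r (snd i))) (cball (fst j) (r (snd j)))) C"
    "negligible (E - (\<Union>i\<in>C. cball (fst i) (r (snd i))))"
  proof (rule Vitali_covering_theorem_cballs[of ?K "\<lambda>i. r (snd i)" E fst])
    show "0 < r (snd i)" for i :: "'a \<times> nat" using r by simp
    fix x and d :: real assume x: "x \<in> E" and d: "0 < d"
    obtain t where t: "t > 0" "cball x t \<subseteq> U" using U x open_contains_cball by blast
    have "\<forall>\<^sub>F k in sequentially. r k < min d t" using r(2) d t by (intro order_tendstoD) auto
    then have "\<exists>\<^sub>F k in sequentially. emeasure (wmeas P) (cball x (r k)) \<ge> ennreal c * emeasure lborel (cball x (r k)) \<and> r k < min d t"
      by (intro frequently_eventually_frequently fr x)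
    then obtain k where k: "emeasure (wmeas P) (cball x (r k)) \<ge> ennreal c * emeasure lborel (cball x (r k))" "r k < min d t"
      using frequently_ex by blast
    then have "cball x (r k) \<subseteq> U" using t by (meson less_imp_le min.strict_boundedE order_trans subset_cball)
    then show "\<exists>i. i \<in> ?K \<and> x \<in> cball (fst i) (r (snd i)) \<and> r (snd i) < d"
      using k x r(1)[of k] by (intro exI[of _ "(x, k)"]) (auto intro: less_imp_le)
  qed (rule that)
  let ?B = "\<lambda>i. cball (fst i) (r (snd i))"
  have Um[measurable]: "(\<Union>i\<in>C. ?B i) \<in> sets borel" using C(1) by (intro sets.countable_UN') auto
  have "E - (\<Union>i\<in>C. ?B i) \<in> null_sets lborel"
    using C(4) by (simp add: negligible_iff_null_sets null_sets_completion_iff)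
  then have z: "emeasure lborel (E - (\<Union>i\<in>C. ?B i)) = 0" by auto
  have "emeasure lborel E \<le> emeasure lborel ((\<Union>i\<in>C. ?B i) \<union> (E - (\<Union>i\<in>C. ?B i)))"
    by (intro emeasure_mono) auto
  also have "\<dots> \<le> emeasure lborel (\<Union>i\<in>C. ?B i) + emeasure lborel (E - (\<Union>i\<in>C. ?B i))"
    by (intro emeasure_subadditive) auto
  finally have "emeasure lborel E \<le> emeasure lborel (\<Union>i\<in>C. ?B i)" using z by simp
  then have "ennreal c * emeasure lborel E \<le> ennreal c * emeasure lborel (\<Union>i\<in>C. ?B i)"
    by (rule mult_left_mono) simp
  also have "\<dots> = emeasure (density lborel (\<lambda>x. ennreal c)) (\<Union>i\<in>C. ?B i)"
    by (subst emeasure_density_const) auto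
  also have "\<dots> \<le> emeasure (wmeas P) (\<Union>i\<in>C. ?B i)"
  proof (rule emeasure_UN_mono_disjoint[OF C(1)])
    show "disjoint_family_on ?B C"
      using C(3) by (auto simp: disjoint_family_on_def pairwise_def disjnt_def)
    fix i assume "i \<in> C"
    then have "i \<in> ?K" using C(2) by blast
    then show "emeasure (density lborel (\<lambda>x. ennreal c)) (?B i) \<le> emeasure (wmeas P) (?B i)"
      by (subst emeasure_density_const) (auto simp: split_beta)
  qed auto
  also have "\<dots> \<le> emeasure (wmeas P) U"
  proof (rule emeasure_mono[OF UN_least])
    fix i assume "i \<in> C"
    then have "i \<in> ?K" using C(2) by blast
    then show "?B i \<subseteq> U" by (auto simp only: split_beta mem_Collect_eq)
  qed (use U(1) in auto)
  also note U(3)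
  finally show "ennreal c * emeasure lborel E \<le> emeasure (wmeas P) E + ennreal e" .
qed

text \<open>On the set where \<open>P < b\<close> while averages above \<open>c\<close> recur at arbitrarily small scales, the mean
  of \<open>P\<close> would be at most \<open>b\<close> and at least \<open>c\<close>. Bounded pieces of that set have finite measure, so
  the two bounds force the measure to vanish.\<close>

lemma AE_average_le:
  fixes P :: "'a::euclidean_space \<Rightarrow> real" and r :: "nat \<Rightarrow> real"
  assumes P: "integrable lborel P" "\<And>x. 0 \<le> P x" and r: "\<And>k. r k > 0" "r \<longlonglongrightarrow> 0"
    and bc: "b < c"
  shows "AE x in lborel. P x < b \<longrightarrow>
    (\<forall>\<^sub>F k in sequentially. emeasure (wmeas P) (cball x (r k)) < ennreal c * emeasure lborel (cball x (r k)))"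
proof (cases "b > 0")
  case False
  then show ?thesis using P(2) by (intro AE_I2) (metis order_less_le_trans not_less)
next
  case b: True
  have [measurable]: "P \<in> borel_measurable borel" using P(1) by auto
  define E where "E n = {x. P x < b \<and> norm x \<le> real n \<and>
    (\<forall>m. \<exists>k\<ge>m. ennreal c * ennreal (measure lborel (cball (0::'a) (r k))) \<le> emeasure (wmeas P) (cball x (r k)))}" for n :: nat
  have vol: "emeasure lborel (cball x (r k)) = ennreal (measure lborel (cball (0::'a) (r k)))" for x :: 'a and k
    using r(1)[of k] emeasure_lborel_cball_finite[of x "r k"]
    by (simp add: emeasure_eq_ennreal_measure content_cball)
  have mm[measurable]: "(\<lambda>x. emeasure (wmeas P) (cball x (r k))) \<in> borel_measurable borel" for k
    by (rule measurable_emeasure_wmeas_cball) simp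
  have Em[measurable]: "E n \<in> sets borel" for n unfolding E_def by measurable
  have n0: "E n \<in> null_sets lborel" for n
  proof -
    have fin: "emeasure lborel (E n) < \<infinity>"
    proof -
      have "emeasure lborel (E n) \<le> emeasure lborel (cball (0::'a) (real n))"
        by (intro emeasure_mono) (auto simp: E_def)
      then show ?thesis using emeasure_lborel_cball_finite[of "0::'a" "real n"] by (metis infinity_ennreal_def order_le_less_trans)
    qed
    have "ennreal c * emeasure lborel (E n) \<le> emeasure (wmeas P) (E n)"
      by (rule vitali_mean_lower_bound[OF P Em r]) (auto simp: E_def frequently_sequentially vol)
    also have "\<dots> = (\<integral>\<^sup>+x. ennreal (P x) * indicator (E n) x \<partial>lborel)" by (rule emeasure_wmeas) auto
    also have "\<dots> \<le> (\<integral>\<^sup>+x. ennreal b * indicator (E n) x \<partial>lborel)"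
      by (intro nn_integral_mono) (auto simp: E_def indicator_def intro!: ennreal_leI)
    also have "\<dots> = ennreal b * emeasure lborel (E n)"
      by (simp add: nn_integral_cmult)
    finally have le: "ennreal c * emeasure lborel (E n) \<le> ennreal b * emeasure lborel (E n)" .
    obtain t where t: "emeasure lborel (E n) = ennreal t" "t \<ge> 0" using fin by (cases "emeasure lborel (E n)") auto
    have "c * t \<le> b * t" using le t b bc by (simp add: ennreal_mult'[symmetric])
    then have "t = 0" using bc t(2) by (metis mult_le_cancel_right not_less order_antisym)
    then show ?thesis using t by (auto simp: null_sets_def)
  qed
  then have "(\<Union>n. E n) \<in> null_sets lborel" by (intro null_sets_UN) auto
  then show ?thesis
  proof (rule AE_I')
    show "{x \<in> space lborel. \<not> (P x < b \<longrightarrow> (\<forall>\<^sub>F k in sequentially. emeasure (wmeas P) (cball x (r k)) < ennreal c * emeasure lborel (cball x (r k))))} \<subseteq> (\<Union>n. E n)"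
    proof
      fix x assume "x \<in> {x \<in> space lborel. \<not> (P x < b \<longrightarrow> (\<forall>\<^sub>F k in sequentially. emeasure (wmeas P) (cball x (r k)) < ennreal c * emeasure lborel (cball x (r k))))}"
      then have x: "P x < b" "\<forall>m. \<exists>k\<ge>m. ennreal c * emeasure lborel (cball x (r k)) \<le> emeasure (wmeas P) (cball x (r k))"
        by (auto simp: not_eventually frequently_sequentially not_less)
      obtain n where "norm x \<le> real n" using real_arch_simple by blast
      then show "x \<in> (\<Union>n. E n)" using x by (auto simp: E_def vol intro!: exI[of _ n])
    qed
  qed
qed

text \<open>For a rational \<open>q\<close> close to \<open>f x\<close> the averages of \<open>\<bar>f - f x\<bar>\<close> and \<open>\<bar>f - q\<bar>\<close> differ by little, and the
  one-sided statement, applied to \<open>\<bar>f - q\<bar>\<close> for all rational \<open>q\<close> at once, bounds the latter. Cutting off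
  to large balls makes \<open>\<bar>f - q\<bar>\<close> integrable.\<close>

theorem AE_lebesgue_point:
  fixes f :: "'a::euclidean_space \<Rightarrow> real" and r :: "nat \<Rightarrow> real"
  assumes f: "integrable lborel f" and r: "\<And>k. r k > 0" "r \<longlonglongrightarrow> 0"
  shows "AE x in lborel. \<forall>e>0. \<forall>\<^sub>F k in sequentially.
    (LINT y:cball x (r k)|lborel. \<bar>f y - f x\<bar>) \<le> e * measure lborel (cball x (r k))"
proof -
  have [measurable]: "f \<in> borel_measurable borel" using f by auto
  define P where "P q n y = indicator (cball 0 (real n)) y * \<bar>f y - q\<bar>" for q :: real and n :: nat and y :: 'a
  have ic: "integrable lborel (\<lambda>y. indicator (cball x s) y * (g y :: real))"
    if "integrable lborel g" for g and x :: 'a and s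
    using integrable_mult_indicator[of "cball x s" lborel g] that by simp
  have cst: "integrable lborel (\<lambda>y::'a. indicator (cball x s) y * (q :: real))" for q s and x :: 'a
    using emeasure_lborel_cball_finite[of x s] by (intro integrable_mult_left integrable_real_indicator) auto
  have int_diff: "integrable lborel (\<lambda>y. indicator (cball x s) y * \<bar>f y - q\<bar>)" for x :: 'a and s q
  proof -
    have "integrable lborel (\<lambda>y. \<bar>indicator (cball x s) y * f y - indicator (cball x s) y * q\<bar>)"
      by (intro integrable_abs Bochner_Integration.integrable_diff ic f cst)
    moreover have "\<bar>indicator (cball x s) y * f y - indicator (cball x s) y * q\<bar> = indicator (cball x s) y * \<bar>f y - q\<bar>" for y
      by (simp add: indicator_def)
    ultimately show ?thesis by simp
  qed
  have Pi: "integrable lborel (P q n)" for q n unfolding P_def by (rule int_diff)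
  have P0: "0 \<le> P q n y" for q n y by (simp add: P_def)
  have "AE x in lborel. \<forall>b\<in>\<rat>. \<forall>c\<in>\<rat>. \<forall>q\<in>\<rat>. \<forall>n. b < c \<longrightarrow> P q n x < b \<longrightarrow>
    (\<forall>\<^sub>F k in sequentially. emeasure (wmeas (P q n)) (cball x (r k)) < ennreal c * emeasure lborel (cball x (r k)))"
    using AE_average_le[OF Pi P0 r]
    by (auto simp: AE_ball_countable countable_rat AE_all_countable)
  then show ?thesis
  proof (eventually_elim, intro allI impI)
    fix x and e :: real
    assume H: "\<forall>b\<in>\<rat>. \<forall>c\<in>\<rat>. \<forall>q\<in>\<rat>. \<forall>n. b < c \<longrightarrow> P q n x < b \<longrightarrow>
      (\<forall>\<^sub>F k in sequentially. emeasure (wmeas (P q n)) (cball x (r k)) < ennreal c * emeasure lborel (cball x (r k)))"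
      and e: "e > 0"
    obtain b where b: "b \<in> \<rat>" "0 < b" "b < e / 3" using Rats_dense_in_real[of 0 "e/3"] e by auto
    obtain c where c: "c \<in> \<rat>" "b < c" "c < e / 3" using Rats_dense_in_real[of b "e/3"] b by auto
    obtain q where q: "q \<in> \<rat>" "f x < q" "q < f x + b" using Rats_dense_in_real[of "f x" "f x + b"] b by auto
    obtain n where n: "norm x + 1 \<le> real n" using real_arch_simple by blast
    have "P q n x < b" using q b by (auto simp: P_def indicator_def abs_if)
    then have ev1: "\<forall>\<^sub>F k in sequentially. emeasure (wmeas (P q n)) (cball x (r k)) < ennreal c * emeasure lborel (cball x (r k))"
      using H b c q by blast
    have ev2: "\<forall>\<^sub>F k in sequentially. r k < 1" using r(2) by (rule order_tendstoD) simp
    from ev1 ev2 show "\<forall>\<^sub>F k in sequentially. (LINT y:cball x (r k)|lborel. \<bar>f y - f x\<bar>) \<le> e * measure lborel (cball x (r k))"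
    proof eventually_elim
      case (elim k)
      let ?B = "cball x (r k)"
      have sub: "y \<in> cball 0 (real n)" if "y \<in> ?B" for y
      proof -
        have "norm y \<le> norm x + dist x y" by (metis dist_norm norm_triangle_sub norm_minus_commute)
        then show ?thesis using that elim n by simp
      qed
      have vol: "emeasure lborel ?B = ennreal (measure lborel ?B)"
        using emeasure_lborel_cball_finite[of x "r k"] by (simp add: emeasure_eq_ennreal_measure)
      have eqi: "indicator ?B y *\<^sub>R P q n y = indicator ?B y * \<bar>f y - q\<bar>" for y
        using sub[of y] by (simp add: P_def indicator_def)
      then have eqi': "indicator ?B y * P q n y = indicator ?B y * \<bar>f y - q\<bar>" for y by simp
      have "emeasure (wmeas (P q n)) ?B = ennreal (LINT y:?B|lborel. P q n y)"
      proof (rule emeasure_wmeas_integral)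
        show "set_integrable lborel ?B (P q n)"
          unfolding set_integrable_def eqi by (rule int_diff)
      qed (use Pi[of q n] P0 in auto)
      then have "(LINT y:?B|lborel. P q n y) < c * measure lborel ?B"
        using elim(1) b c by (simp add: vol ennreal_mult'[symmetric] ennreal_less_iff set_lebesgue_integral_def P0)
      then have A: "(LINT y|lborel. indicator ?B y * \<bar>f y - q\<bar>) \<le> c * measure lborel ?B"
        by (simp add: set_lebesgue_integral_def eqi')
      have "(LINT y:?B|lborel. \<bar>f y - f x\<bar>) = (LINT y|lborel. indicator ?B y * \<bar>f y - f x\<bar>)"
        by (simp add: set_lebesgue_integral_def)
      also have "\<dots> \<le> (LINT y|lborel. indicator ?B y * \<bar>f y - q\<bar> + indicator ?B y * b)"
        by (intro integral_mono int_diff Bochner_Integration.integrable_add cst)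
          (use q in \<open>auto simp: indicator_def\<close>)
      also have "\<dots> = (LINT y|lborel. indicator ?B y * \<bar>f y - q\<bar>) + (LINT y|lborel. indicator ?B y * b)"
        by (intro Bochner_Integration.integral_add int_diff cst)
      also have "(LINT y|lborel. indicator ?B y * b) = b * measure lborel ?B" by simp
      finally have "(LINT y:?B|lborel. \<bar>f y - f x\<bar>) \<le> c * measure lborel ?B + b * measure lborel ?B" using A by linarith
      also have "\<dots> = (c + b) * measure lborel ?B" by (simp add: algebra_simps)
      also have "\<dots> \<le> e * measure lborel ?B" using b c e by (intro mult_right_mono) auto
      finally show ?case .
    qed
  qed
qed

lemma AE_average_ge:
  fixes P :: "'a::euclidean_space \<Rightarrow> real" and r :: "nat \<Rightarrow> real"
  assumes P: "integrable lborel P" "\<And>x. 0 \<le> P x" and r: "\<And>k. r k > 0" "r \<longlonglongrightarrow> 0"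
  shows "AE x in lborel. \<forall>t. t < P x \<longrightarrow>
    (\<forall>\<^sub>F k in sequentially. t * measure lborel (cball x (r k)) < (LINT y:cball x (r k)|lborel. P y))"
  using AE_lebesgue_point[OF P(1) r]
proof (eventually_elim, intro allI impI)
  fix x t
  assume H: "\<forall>e>0. \<forall>\<^sub>F k in sequentially. (LINT y:cball x (r k)|lborel. \<bar>P y - P x\<bar>) \<le> e * measure lborel (cball x (r k))"
    and t: "t < P x"
  let ?e = "(P x - t) / 2"
  have "\<forall>\<^sub>F k in sequentially. (LINT y:cball x (r k)|lborel. \<bar>P y - P x\<bar>) \<le> ?e * measure lborel (cball x (r k))"
    using H[rule_format, of ?e] t by simp
  then show "\<forall>\<^sub>F k in sequentially. t * measure lborel (cball x (r k)) < (LINT y:cball x (r k)|lborel. P y)"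
  proof eventually_elim
    case (elim k)
    let ?B = "cball x (r k)"
    have i1: "set_integrable lborel ?B P"
      using integrable_mult_indicator[OF _ P(1), of ?B] by (simp add: set_integrable_def)
    have i2: "set_integrable lborel ?B (\<lambda>y. P x)"
      using emeasure_lborel_cball_finite[of x "r k"] by (simp add: set_integrable_def)
    have i3: "set_integrable lborel ?B (\<lambda>y. \<bar>P y - P x\<bar>)"
      by (intro set_integrable_abs set_integral_diff i1 i2)
    have "(LINT y:?B|lborel. P x) - (LINT y:?B|lborel. \<bar>P y - P x\<bar>) = (LINT y:?B|lborel. P x - \<bar>P y - P x\<bar>)"
      by (rule set_integral_diff(2)[symmetric, OF i2 i3])
    also have "\<dots> \<le> (LINT y:?B|lborel. P y)"
      by (rule set_integral_mono[OF set_integral_diff(1)[OF i2 i3] i1]) auto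
    finally have le: "(LINT y:?B|lborel. P x) - (LINT y:?B|lborel. \<bar>P y - P x\<bar>) \<le> (LINT y:?B|lborel. P y)" .
    have "(LINT y:?B|lborel. P x) = P x * measure lborel ?B" by (simp add: set_lebesgue_integral_def)
    with le elim have lower: "P x * measure lborel ?B - ?e * measure lborel ?B \<le> (LINT y:?B|lborel. P y)"
      by linarith
    moreover have "measure lborel ?B > 0" using r(1) by simp
    ultimately have "t * measure lborel ?B < (LINT y:?B|lborel. P y)"
    proof -
      have "t * measure lborel ?B < (P x - ?e) * measure lborel ?B" using \<open>measure lborel ?B > 0\<close> t by (intro mult_strict_right_mono) (auto simp: field_simps)
      then show ?thesis using lower by (simp add: algebra_simps)
    qed
    then show ?case .
  qed
qed

section \<open>Square integrable vector fields\<close>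

definition sqi :: "'x measure \<Rightarrow> ('x \<Rightarrow> 'b::euclidean_space) \<Rightarrow> bool" where
  "sqi M f \<longleftrightarrow> f \<in> borel_measurable M \<and> integrable M (\<lambda>x. (norm (f x))\<^sup>2)"

lemma sqi_integrable: "sqi M f \<Longrightarrow> integrable M (\<lambda>x. (norm (f x))\<^sup>2)"
  by (simp add: sqi_def)

lemma norm_add_square_le:
  fixes a b :: "'b::real_inner"
  shows "(norm (a + b))\<^sup>2 \<le> 2 * (norm a)\<^sup>2 + 2 * (norm b)\<^sup>2"
proof -
  have "(norm (a + b))\<^sup>2 + (norm (a - b))\<^sup>2 = 2 * (norm a)\<^sup>2 + 2 * (norm b)\<^sup>2"
    by (simp add: power2_norm_eq_inner algebra_simps inner_commute)
  moreover have "0 \<le> (norm (a - b))\<^sup>2" by simp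
  ultimately show ?thesis by linarith
qed

lemma sqi_add:
  assumes "sqi M f" "sqi M g"
  shows "sqi M (\<lambda>x. f x + g x)"
  unfolding sqi_def
proof
  have [measurable]: "f \<in> borel_measurable M" "g \<in> borel_measurable M"
    using assms by (auto simp: sqi_def)
  show "(\<lambda>x. f x + g x) \<in> borel_measurable M" by measurable
  show "integrable M (\<lambda>x. (norm (f x + g x))\<^sup>2)"
  proof (rule Bochner_Integration.integrable_bound)
    show "integrable M (\<lambda>x. 2 * (norm (f x))\<^sup>2 + 2 * (norm (g x))\<^sup>2)"
      using assms by (auto simp: sqi_def)
  qed (auto intro!: AE_I2 norm_add_square_le)
qed

lemma sqi_scaleR:
  assumes "sqi M f"
  shows "sqi M (\<lambda>x. c *\<^sub>R f x)"
  using assms by (auto simp: sqi_def power_mult_distrib)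

lemma sqi_diff: "sqi M f \<Longrightarrow> sqi M g \<Longrightarrow> sqi M (\<lambda>x. f x - g x)"
  using sqi_add[of M f "\<lambda>x. (-1) *\<^sub>R g x"] sqi_scaleR[of M g "-1"] by simp

lemma sqi_bound:
  assumes "sqi M f" "g \<in> borel_measurable M" "AE x in M. norm (g x) \<le> C * norm (f x)"
  shows "sqi M g"
  unfolding sqi_def
proof
  show "integrable M (\<lambda>x. (norm (g x))\<^sup>2)"
  proof (rule Bochner_Integration.integrable_bound)
    show "integrable M (\<lambda>x. C\<^sup>2 * (norm (f x))\<^sup>2)" using assms by (auto simp: sqi_def)
    show "AE x in M. norm ((norm (g x))\<^sup>2) \<le> norm (C\<^sup>2 * (norm (f x))\<^sup>2)"
      using assms(3)
    proof eventually_elim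
      case (elim x)
      then have "(norm (g x))\<^sup>2 \<le> (C * norm (f x))\<^sup>2" by (intro power_mono) auto
      then show ?case by (simp add: power_mult_distrib)
    qed
  qed (use assms(2) in measurable)
qed (rule assms)

lemma sqi_inner_integrable:
  assumes "sqi M f" "sqi M g"
  shows "integrable M (\<lambda>x. f x \<bullet> g x)"
proof (rule Bochner_Integration.integrable_bound)
  have [measurable]: "f \<in> borel_measurable M" "g \<in> borel_measurable M"
    using assms by (auto simp: sqi_def)
  show "integrable M (\<lambda>x. (norm (f x))\<^sup>2 + (norm (g x))\<^sup>2)" using assms by (auto simp: sqi_def)
  show "(\<lambda>x. f x \<bullet> g x) \<in> borel_measurable M" by measurable
  show "AE x in M. norm (f x \<bullet> g x) \<le> norm ((norm (f x))\<^sup>2 + (norm (g x))\<^sup>2)"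
  proof (rule AE_I2)
    fix x
    have "\<bar>f x \<bullet> g x\<bar> \<le> norm (f x) * norm (g x)" by (rule Cauchy_Schwarz_ineq2)
    also have "\<dots> \<le> (norm (f x))\<^sup>2 + (norm (g x))\<^sup>2"
    proof -
      have "2 * norm (f x) * norm (g x) \<le> (norm (f x))\<^sup>2 + (norm (g x))\<^sup>2" by (rule sum_squares_bound)
      moreover have "0 \<le> norm (f x) * norm (g x)" by simp
      ultimately show ?thesis by linarith
    qed
    finally show "norm (f x \<bullet> g x) \<le> norm ((norm (f x))\<^sup>2 + (norm (g x))\<^sup>2)" by simp
  qed
qed

lemma quadratic_nonneg_discriminant:
  fixes A B C :: real
  assumes "\<And>t. 0 \<le> A + 2 * t * B + t\<^sup>2 * C" "0 \<le> C"
  shows "B\<^sup>2 \<le> A * C"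
proof (cases "C = 0")
  case True
  have "B = 0"
  proof (rule ccontr)
    assume "B \<noteq> 0"
    then have "A + 2 * (- (A + 1) / (2 * B)) * B = -1" by (simp add: field_simps)
    then show False using assms(1)[of "- (A + 1) / (2 * B)"] True by simp
  qed
  then show ?thesis using True by simp
next
  case False
  then have "C > 0" using assms(2) by simp
  have "0 \<le> A + 2 * (- B / C) * B + (- B / C)\<^sup>2 * C" by (rule assms)
  also have "\<dots> = A - B\<^sup>2 / C" using \<open>C > 0\<close> by (simp add: field_simps power2_eq_square)
  finally show ?thesis using \<open>C > 0\<close> by (simp add: field_simps)
qed

lemma integral_norm_add_scaled:
  assumes f: "sqi M f" and g: "sqi M g"
  shows "(LINT x|M. (norm (f x + t *\<^sub>R g x))\<^sup>2)
    = (LINT x|M. (norm (f x))\<^sup>2) + 2 * t * (LINT x|M. f x \<bullet> g x) + t\<^sup>2 * (LINT x|M. (norm (g x))\<^sup>2)"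
proof -
  have "(norm (f x + t *\<^sub>R g x))\<^sup>2 = (norm (f x))\<^sup>2 + (2 * t) * (f x \<bullet> g x) + t\<^sup>2 * (norm (g x))\<^sup>2" for x
    unfolding power2_norm_eq_inner by (simp add: algebra_simps inner_commute power2_eq_square)
  then show ?thesis
    using sqi_inner_integrable[OF f g] sqi_integrable[OF f] sqi_integrable[OF g] by simp
qed

lemma L2_Cauchy_Schwarz:
  assumes f: "sqi M f" and g: "sqi M g"
  shows "(LINT x|M. f x \<bullet> g x)\<^sup>2 \<le> (LINT x|M. (norm (f x))\<^sup>2) * (LINT x|M. (norm (g x))\<^sup>2)"
proof (rule quadratic_nonneg_discriminant)
  fix t
  have "0 \<le> (LINT x|M. (norm (f x + t *\<^sub>R g x))\<^sup>2)" by simp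
  then show "0 \<le> (LINT x|M. (norm (f x))\<^sup>2) + 2 * t * (LINT x|M. f x \<bullet> g x) + t\<^sup>2 * (LINT x|M. (norm (g x))\<^sup>2)"
    by (simp add: integral_norm_add_scaled[OF f g])
qed simp

lemma L2_tendsto_inner:
  assumes v: "sqi M v" and w: "sqi M w" and g: "\<And>n::nat. sqi M (g n)"
    and lim: "(\<lambda>n. LINT x|M. (norm (w x - g n x))\<^sup>2) \<longlonglongrightarrow> 0"
  shows "(\<lambda>n. LINT x|M. v x \<bullet> g n x) \<longlonglongrightarrow> (LINT x|M. v x \<bullet> w x)"
proof -
  let ?A = "LINT x|M. (norm (v x))\<^sup>2"
  have d: "sqi M (\<lambda>x. w x - g n x)" for n by (intro sqi_diff w g)
  have "(\<lambda>n. (LINT x|M. v x \<bullet> (w x - g n x))\<^sup>2) \<longlonglongrightarrow> 0"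
  proof (rule tendsto_sandwich[OF _ _ tendsto_const])
    show "\<forall>\<^sub>F n in sequentially. (LINT x|M. v x \<bullet> (w x - g n x))\<^sup>2 \<le> ?A * (LINT x|M. (norm (w x - g n x))\<^sup>2)"
      by (intro always_eventually allI L2_Cauchy_Schwarz v d)
    show "(\<lambda>n. ?A * (LINT x|M. (norm (w x - g n x))\<^sup>2)) \<longlonglongrightarrow> 0"
      using tendsto_mult_left[OF lim, of ?A] by simp
  qed (auto intro: always_eventually)
  from tendsto_real_sqrt[OF this]
  have "(\<lambda>n. \<bar>LINT x|M. v x \<bullet> (w x - g n x)\<bar>) \<longlonglongrightarrow> 0"
    unfolding real_sqrt_abs real_sqrt_zero .
  then have "(\<lambda>n. LINT x|M. v x \<bullet> (w x - g n x)) \<longlonglongrightarrow> 0" by (rule tendsto_rabs_zero_cancel)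
  moreover have "(LINT x|M. v x \<bullet> (w x - g n x)) = (LINT x|M. v x \<bullet> w x) - (LINT x|M. v x \<bullet> g n x)" for n
    using sqi_inner_integrable[OF v w] sqi_inner_integrable[OF v g[of n]] by (simp add: inner_diff_right)
  ultimately have "(\<lambda>n. (LINT x|M. v x \<bullet> w x) - (LINT x|M. v x \<bullet> g n x)) \<longlonglongrightarrow> 0" by simp
  from tendsto_diff[OF tendsto_const[of "LINT x|M. v x \<bullet> w x"] this] show ?thesis by simp
qed

lemma ennreal_term_le_suminf:
  fixes f :: "nat \<Rightarrow> ennreal"
  shows "f n \<le> suminf f"
  using sum_le_suminf[of f "{n}"] by simp

lemma geometric_increments_convergent:
  fixes u :: "nat \<Rightarrow> 'b::banach"
  assumes "\<And>n. 4 ^ n * (norm (u (Suc n) - u n))\<^sup>2 \<le> B"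
  shows "convergent u"
proof -
  have le: "norm (u (Suc n) - u n) \<le> sqrt B * (1/2) ^ n" for n
  proof -
    have "(2 ^ n * norm (u (Suc n) - u n))\<^sup>2 \<le> B"
      using assms[of n] by (simp add: power_mult_distrib power_mult[symmetric] mult.commute[of n 2]) (simp add: power_mult)
    then have "2 ^ n * norm (u (Suc n) - u n) \<le> sqrt B" by (rule real_le_rsqrt)
    then show ?thesis by (simp add: field_simps)
  qed
  have "summable (\<lambda>n. u (Suc n) - u n)"
  proof (rule summable_comparison_test'[where N=0])
    show "summable (\<lambda>n. sqrt B * (1/2) ^ n)" by (intro summable_mult summable_geometric) simp
  qed (rule le)
  then obtain l where "(\<lambda>n. u (Suc n) - u n) sums l" by (auto simp: summable_def)
  then have "(\<lambda>n. u n - u 0) \<longlonglongrightarrow> l" by (simp add: sums_def sum_lessThan_telescope)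
  from tendsto_add[OF this tendsto_const[of "u 0"]] show ?thesis by (auto simp: convergent_def)
qed

text \<open>The assumed rate \<open>8\<^sup>-\<^sup>n\<close> outweighs the factor \<open>4\<^sup>n\<close>, so that \<open>\<Sum>\<^sub>n 4\<^sup>n \<bar>g\<^sub>n\<^sub>+\<^sub>1 - g\<^sub>n\<bar>\<^sup>2\<close> has a finite integral and is
  finite almost everywhere. There the sequence converges, and Fatou's lemma turns the
  pointwise limit into a limit in mean square.\<close>

lemma L2_complete:
  fixes g :: "nat \<Rightarrow> 'x \<Rightarrow> 'b::euclidean_space"
  assumes g: "\<And>n. sqi M (g n)"
    and c: "\<And>n m. n \<le> m \<Longrightarrow> (LINT x|M. (norm (g m x - g n x))\<^sup>2) \<le> C * (1/8) ^ n"
  obtains w where "sqi M w" "\<And>n. (LINT x|M. (norm (w x - g n x))\<^sup>2) \<le> C * (1/8) ^ n"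
proof -
  have gm[measurable]: "g n \<in> borel_measurable M" for n using g by (simp add: sqi_def)
  have gd: "integrable M (\<lambda>x. (norm (g m x - g n x))\<^sup>2)" for m n
    by (intro sqi_integrable sqi_diff g)
  have nn: "(\<integral>\<^sup>+x. ennreal ((norm (g m x - g n x))\<^sup>2) \<partial>M) = ennreal (LINT x|M. (norm (g m x - g n x))\<^sup>2)" for m n
    by (intro nn_integral_eq_integral gd) auto
  have C0: "C \<ge> 0" using c[of 0 0] by simp
  have "(\<integral>\<^sup>+x. (\<Sum>n. ennreal (4 ^ n * (norm (g (Suc n) x - g n x))\<^sup>2)) \<partial>M)
      = (\<Sum>n. \<integral>\<^sup>+x. ennreal (4 ^ n * (norm (g (Suc n) x - g n x))\<^sup>2) \<partial>M)"
    by (rule nn_integral_suminf) measurable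
  also have "\<dots> = (\<Sum>n. ennreal (4 ^ n * (LINT x|M. (norm (g (Suc n) x - g n x))\<^sup>2)))"
    by (intro arg_cong[where f=suminf] ext) (simp add: ennreal_mult nn_integral_cmult nn)
  also have "\<dots> \<le> (\<Sum>n. ennreal (C * (1/2) ^ n))"
  proof (intro suminf_le ennreal_leI)
    fix n
    have "4 ^ n * (LINT x|M. (norm (g (Suc n) x - g n x))\<^sup>2) \<le> 4 ^ n * (C * (1/8) ^ n)"
      by (intro mult_left_mono c) auto
    also have "\<dots> = C * (4 * (1/8)) ^ n" by (simp only: power_mult_distrib mult_ac)
    finally show "4 ^ n * (LINT x|M. (norm (g (Suc n) x - g n x))\<^sup>2) \<le> C * (1/2) ^ n" by simp
  qed auto
  also have "\<dots> = ennreal (\<Sum>n. C * (1/2) ^ n)"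
    using C0 by (intro suminf_ennreal2 summable_mult summable_geometric) auto
  also have "\<dots> < \<infinity>" by simp
  finally have fin: "(\<integral>\<^sup>+x. (\<Sum>n. ennreal (4 ^ n * (norm (g (Suc n) x - g n x))\<^sup>2)) \<partial>M) < \<infinity>" .
  have "AE x in M. (\<Sum>n. ennreal (4 ^ n * (norm (g (Suc n) x - g n x))\<^sup>2)) \<noteq> \<infinity>"
    by (rule nn_integral_noteq_infinite[OF _ less_imp_neq[OF fin]]) measurable
  then have conv: "AE x in M. convergent (\<lambda>n. g n x)"
  proof eventually_elim
    case (elim x)
    let ?S = "\<Sum>n. ennreal (4 ^ n * (norm (g (Suc n) x - g n x))\<^sup>2)"
    show ?case
    proof (rule geometric_increments_convergent)
      fix n
      have "ennreal (4 ^ n * (norm (g (Suc n) x - g n x))\<^sup>2) \<le> ?S"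
        by (rule ennreal_term_le_suminf[of "\<lambda>n. ennreal (4 ^ n * (norm (g (Suc n) x - g n x))\<^sup>2)"])
      moreover have "?S < top" using elim unfolding infinity_ennreal_def less_top[symmetric] .
      ultimately have "enn2real (ennreal (4 ^ n * (norm (g (Suc n) x - g n x))\<^sup>2)) \<le> enn2real ?S"
        by (rule enn2real_mono)
      then show "4 ^ n * (norm (g (Suc n) x - g n x))\<^sup>2 \<le> enn2real ?S" by simp
    qed
  qed
  define w where "w x = lim (\<lambda>n. g n x)" for x
  have wm[measurable]: "w \<in> borel_measurable M" unfolding w_def by measurable
  have bound: "(\<integral>\<^sup>+x. ennreal ((norm (w x - g n x))\<^sup>2) \<partial>M) \<le> ennreal (C * (1/8) ^ n)" for n
  proof -
    have "(\<integral>\<^sup>+x. ennreal ((norm (w x - g n x))\<^sup>2) \<partial>M) = (\<integral>\<^sup>+x. liminf (\<lambda>m. ennreal ((norm (g m x - g n x))\<^sup>2)) \<partial>M)"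
      using conv
    proof (intro nn_integral_cong_AE, eventually_elim)
      case (elim x)
      then have "(\<lambda>m. g m x) \<longlonglongrightarrow> w x" by (simp add: w_def convergent_LIMSEQ_iff)
      then have "(\<lambda>m. ennreal ((norm (g m x - g n x))\<^sup>2)) \<longlonglongrightarrow> ennreal ((norm (w x - g n x))\<^sup>2)"
        by (intro tendsto_ennrealI tendsto_intros)
      then show ?case by (rule lim_imp_Liminf[OF sequentially_bot, symmetric])
    qed
    also have "\<dots> \<le> liminf (\<lambda>m. \<integral>\<^sup>+x. ennreal ((norm (g m x - g n x))\<^sup>2) \<partial>M)"
      by (rule nn_integral_liminf) measurable
    also have "\<dots> \<le> ennreal (C * (1/8) ^ n)"
    proof -
      have "\<forall>\<^sub>F m in sequentially. (\<integral>\<^sup>+x. ennreal ((norm (g m x - g n x))\<^sup>2) \<partial>M) \<le> ennreal (C * (1/8) ^ n)"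
        using eventually_ge_at_top[of n] by eventually_elim (simp add: nn c ennreal_leI)
      then have "liminf (\<lambda>m. \<integral>\<^sup>+x. ennreal ((norm (g m x - g n x))\<^sup>2) \<partial>M) \<le> liminf (\<lambda>m::nat. ennreal (C * (1/8) ^ n))"
        by (rule Liminf_mono)
      then show ?thesis by (simp add: Liminf_const)
    qed
    finally show ?thesis .
  qed
  have wi: "integrable M (\<lambda>x. (norm (w x - g n x))\<^sup>2)" for n
    using bound[of n] by (intro integrableI_bounded) (auto simp: order_le_less_trans)
  have "sqi M (\<lambda>x. w x - g 0 x)" using wi[of 0] by (simp add: sqi_def)
  from sqi_add[OF this g[of 0]] have "sqi M w" by simp
  moreover have "(LINT x|M. (norm (w x - g n x))\<^sup>2) \<le> C * (1/8) ^ n" for n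
    using bound[of n] C0 by (subst (asm) nn_integral_eq_integral[OF wi]) auto
  ultimately show ?thesis by (rule that)
qed

text \<open>Projection onto the closure of a subspace \<open>G\<close>, described by an approximating sequence from \<open>G\<close>. By the
  parallelogram law a sequence minimising the distance to \<open>V\<close> is Cauchy, and at the minimum the first
  variation vanishes.\<close>

lemma L2_projection:
  fixes V :: "'x \<Rightarrow> 'b::euclidean_space"
  assumes V: "sqi M V" and G: "\<And>\<psi>. \<psi> \<in> G \<Longrightarrow> sqi M \<psi>" and ne: "G \<noteq> {}"
    and add: "\<And>\<phi> \<psi>. \<phi> \<in> G \<Longrightarrow> \<psi> \<in> G \<Longrightarrow> (\<lambda>x. \<phi> x + \<psi> x) \<in> G"
    and scale: "\<And>c \<psi>. \<psi> \<in> G \<Longrightarrow> (\<lambda>x. c *\<^sub>R \<psi> x) \<in> G"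
  shows "\<exists>w g. sqi M w \<and> (\<forall>n::nat. g n \<in> G) \<and> (\<lambda>n. LINT x|M. (norm (w x - g n x))\<^sup>2) \<longlonglongrightarrow> 0 \<and>
    (\<forall>\<psi>\<in>G. (LINT x|M. (V x - w x) \<bullet> \<psi> x) = 0)"
proof -
  define J where "J \<psi> = (LINT x|M. (norm (V x - \<psi> x))\<^sup>2)" for \<psi>
  define I where "I = Inf (J ` G)"
  have bdd: "bdd_below (J ` G)" by (rule bdd_belowI[of _ 0]) (auto simp: J_def)
  have I_le: "I \<le> J \<psi>" if "\<psi> \<in> G" for \<psi> unfolding I_def using bdd that by (intro cInf_lower) auto
  have "\<exists>\<psi>\<in>G. J \<psi> < I + (1/8) ^ n" for n :: nat
  proof -
    have "Inf (J ` G) < I + (1/8) ^ n" by (simp add: I_def)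
    then show ?thesis using ne bdd by (subst (asm) cInf_less_iff) auto
  qed
  then obtain g where gG: "\<And>n. g n \<in> G" and gJ: "\<And>n. J (g n) < I + (1/8) ^ n" by metis
  have gs: "sqi M (g n)" for n by (intro G gG)
  have vg: "sqi M (\<lambda>x. V x - g n x)" for n by (intro sqi_diff V gs)
  have cau: "(LINT x|M. (norm (g m x - g n x))\<^sup>2) \<le> 4 * (1/8) ^ n" if "n \<le> m" for n m
  proof -
    define h where "h x = (1/2) *\<^sub>R (g n x + g m x)" for x
    have hG: "h \<in> G" unfolding h_def by (intro scale add gG)
    have vh: "sqi M (\<lambda>x. V x - h x)" by (intro sqi_diff V G hG)
    have "(norm (g m x - g n x))\<^sup>2 = 2 * (norm (V x - g n x))\<^sup>2 + 2 * (norm (V x - g m x))\<^sup>2 - 4 * (norm (V x - h x))\<^sup>2" for x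
    proof -
      define p where "p = V x - g n x"
      define q where "q = V x - g m x"
      have e1: "g m x - g n x = p - q" by (simp add: p_def q_def)
      have e2: "V x - h x = (1/2) *\<^sub>R (p + q)"
      proof -
        have "V x = (1/2) *\<^sub>R (V x + V x)" by (simp add: scaleR_2[symmetric])
        then show ?thesis by (simp add: p_def q_def h_def algebra_simps)
      qed
      have "(norm ((1/2) *\<^sub>R (p + q)))\<^sup>2 = (norm (p + q))\<^sup>2 / 4"
        by (simp add: power_divide)
      then have "4 * (norm (V x - h x))\<^sup>2 = (norm (p + q))\<^sup>2" unfolding e2 by simp
      moreover have "(norm (p + q))\<^sup>2 + (norm (p - q))\<^sup>2 = 2 * (norm p)\<^sup>2 + 2 * (norm q)\<^sup>2"
        by (simp add: power2_norm_eq_inner algebra_simps inner_commute)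
      ultimately show ?thesis unfolding e1 p_def[symmetric] q_def[symmetric] by linarith
    qed
    then have "(LINT x|M. (norm (g m x - g n x))\<^sup>2) = 2 * J (g n) + 2 * J (g m) - 4 * J h"
      unfolding J_def using sqi_integrable[OF vg[of n]] sqi_integrable[OF vg[of m]] sqi_integrable[OF vh] by simp
    also have "\<dots> \<le> 2 * (I + (1/8) ^ n) + 2 * (I + (1/8) ^ m) - 4 * I"
      by (intro add_mono diff_mono mult_left_mono less_imp_le[OF gJ] I_le[OF hG]) auto
    also have "\<dots> \<le> 4 * (1/8) ^ n"
    proof -
      have "(1/8::real) ^ m \<le> (1/8) ^ n" using that by (intro power_decreasing) auto
      then show ?thesis by (simp add: algebra_simps)
    qed
    finally show ?thesis .
  qed
  obtain w where w: "sqi M w" "\<And>n. (LINT x|M. (norm (w x - g n x))\<^sup>2) \<le> 4 * (1/8) ^ n"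
    using L2_complete[OF gs cau] by blast
  have e0: "(\<lambda>n. (1/8::real) ^ n) \<longlonglongrightarrow> 0" by (intro LIMSEQ_power_zero) simp
  have lim: "(\<lambda>n. LINT x|M. (norm (w x - g n x))\<^sup>2) \<longlonglongrightarrow> 0"
  proof (rule tendsto_sandwich[OF _ _ tendsto_const])
    show "(\<lambda>n. 4 * (1/8::real) ^ n) \<longlonglongrightarrow> 0" using tendsto_mult_left[OF e0, of 4] by simp
  qed (use w(2) in \<open>auto intro: always_eventually\<close>)
  have orth: "(LINT x|M. (V x - w x) \<bullet> \<psi> x) = 0" if \<psi>: "\<psi> \<in> G" for \<psi>
  proof -
    let ?c = "LINT x|M. (V x - w x) \<bullet> \<psi> x" and ?N = "LINT x|M. (norm (\<psi> x))\<^sup>2"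
    have ps: "sqi M \<psi>" by (rule G[OF \<psi>])
    have cn: "(\<lambda>n. LINT x|M. (V x - g n x) \<bullet> \<psi> x) \<longlonglongrightarrow> ?c"
    proof -
      have "(LINT x|M. (V x - g n x) \<bullet> \<psi> x) = (LINT x|M. V x \<bullet> \<psi> x) - (LINT x|M. \<psi> x \<bullet> g n x)" for n
        using sqi_inner_integrable[OF V ps] sqi_inner_integrable[OF ps gs[of n]]
        by (simp add: inner_diff_left inner_commute[of "\<psi> _"])
      moreover have "?c = (LINT x|M. V x \<bullet> \<psi> x) - (LINT x|M. \<psi> x \<bullet> w x)"
        using sqi_inner_integrable[OF V ps] sqi_inner_integrable[OF ps w(1)]
        by (simp add: inner_diff_left inner_commute[of "\<psi> _"])
      ultimately show ?thesis
        using tendsto_diff[OF tendsto_const L2_tendsto_inner[OF ps w(1) gs lim]] by simp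
    qed
    have "0 \<le> 0 + 2 * t * ?c + t\<^sup>2 * ?N" for t
    proof -
      have "0 \<le> (1/8) ^ n + (2 * t * (LINT x|M. (V x - g n x) \<bullet> \<psi> x) + t\<^sup>2 * ?N)" for n
      proof -
        have "(\<lambda>x. g n x + (- t) *\<^sub>R \<psi> x) \<in> G" by (intro add scale gG \<psi>)
        from I_le[OF this] have "I \<le> (LINT x|M. (norm ((V x - g n x) + t *\<^sub>R \<psi> x))\<^sup>2)"
          by (simp add: J_def algebra_simps)
        also have "\<dots> = J (g n) + 2 * t * (LINT x|M. (V x - g n x) \<bullet> \<psi> x) + t\<^sup>2 * ?N"
          unfolding J_def by (rule integral_norm_add_scaled[OF vg ps])
        finally show ?thesis using gJ[of n] by linarith
      qed
      moreover have "(\<lambda>n. (1/8) ^ n + (2 * t * (LINT x|M. (V x - g n x) \<bullet> \<psi> x) + t\<^sup>2 * ?N)) \<longlonglongrightarrow> 0 + (2 * t * ?c + t\<^sup>2 * ?N)"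
        by (intro tendsto_add e0 tendsto_mult_left cn tendsto_const)
      ultimately have "0 \<le> 0 + (2 * t * ?c + t\<^sup>2 * ?N)" by (intro LIMSEQ_le_const) auto
      then show ?thesis by simp
    qed
    then have "?c\<^sup>2 \<le> 0 * ?N" by (rule quadratic_nonneg_discriminant) simp
    then show ?thesis by simp
  qed
  show ?thesis by (intro exI[of _ w] exI[of _ g] conjI allI ballI w(1) gG lim orth)
qed

section \<open>Mean values of weakly harmonic functions\<close>

text \<open>The functions \<open>t\<^sup>-\<^sup>m exp(-1/t)\<close>, extended by zero, are closed under differentiation up to linear
  combinations. This makes the smoothness of the bump function an induction.\<close>

definition expm :: "nat \<Rightarrow> real \<Rightarrow> real" where
  "expm m t = (if t \<le> 0 then 0 else exp (- inverse t) * inverse t ^ m)"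

lemma expm_nonneg: "0 \<le> expm m t"
  by (simp add: expm_def)

lemma expm_nonpos: "t \<le> 0 \<Longrightarrow> expm m t = 0"
  by (simp add: expm_def)

lemma power_le_fact_exp:
  fixes x :: real
  assumes "x \<ge> 0"
  shows "x ^ n \<le> fact n * exp x"
proof -
  have "x ^ n /\<^sub>R fact n \<le> exp x"
    unfolding exp_def
    using sum_le_suminf[of "\<lambda>n. x ^ n /\<^sub>R fact n" "{n}"] summable_exp_generic[of x] assms by simp
  then show ?thesis by (simp add: field_simps)
qed

text \<open>Quadratic decay at zero gives the derivative zero there.\<close>

lemma expm_le:
  assumes "t \<ge> 0"
  shows "expm m t \<le> fact (m + 2) * t\<^sup>2"
proof (cases "t = 0")
  case True
  then show ?thesis by (simp add: expm_def)
next
  case False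
  then have t: "t > 0" using assms by simp
  have "inverse t ^ (m + 2) \<le> fact (m + 2) * exp (inverse t)" using t by (intro power_le_fact_exp) auto
  then have "exp (- inverse t) * inverse t ^ (m + 2) \<le> exp (- inverse t) * (fact (m + 2) * exp (inverse t))"
    by (intro mult_left_mono) auto
  also have "\<dots> = fact (m + 2)" by (simp add: exp_minus)
  finally have "exp (- inverse t) * inverse t ^ (m + 2) * t\<^sup>2 \<le> fact (m + 2) * t\<^sup>2"
    by (intro mult_right_mono) auto
  moreover have "inverse t ^ (m + 2) * t\<^sup>2 = inverse t ^ m"
    using t by (simp add: power_add field_simps power2_eq_square)
  ultimately have "exp (- inverse t) * inverse t ^ m \<le> fact (m + 2) * t\<^sup>2"
    by (simp only: mult.assoc)
  then show ?thesis using t by (simp only: expm_def not_le[THEN iffD2] if_False)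
qed

lemma expm_le_fact: "t \<le> 1 \<Longrightarrow> expm m t \<le> fact (m + 2)"
proof (cases "t \<ge> 0")
  case True
  assume "t \<le> 1"
  then have "t\<^sup>2 \<le> 1" using True by (simp add: power_le_one)
  then have "fact (m + 2) * t\<^sup>2 \<le> fact (m + 2) * (1::real)" by (intro mult_left_mono) auto
  then show ?thesis using expm_le[OF True, of m] by linarith
next
  case False
  then show ?thesis by (simp add: expm_def)
qed

lemma expm_has_derivative:
  "(expm m has_real_derivative expm (m + 2) t - real m * expm (m + 1) t) (at t)"
proof (rule linorder_cases[of t 0])
  assume t: "t < 0"
  have "(expm m has_real_derivative 0) (at t)"
    by (rule has_field_derivative_transform_within_open[where f="\<lambda>t. 0" and S="{..<0}"])
      (use t in \<open>auto simp: expm_def\<close>)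
  then show ?thesis using t by (simp add: expm_def)
next
  assume t: "t > 0"
  have "((\<lambda>t. exp (- inverse t) * inverse t ^ m) has_real_derivative
      (exp (- inverse t) * inverse t ^ (m + 2) - real m * (exp (- inverse t) * inverse t ^ (m + 1)))) (at t)"
  proof -
    have 1: "((\<lambda>t. inverse t ^ m) has_real_derivative - (real m * inverse t ^ (m + 1))) (at t)"
    proof -
      have "((\<lambda>t. inverse t ^ m) has_real_derivative
          real m * (- (inverse t ^ Suc (Suc 0)) * inverse t ^ (m - Suc 0))) (at t)"
        by (rule DERIV_power[OF DERIV_inverse]) (use t in simp)
      moreover have "real m * (- (inverse t ^ Suc (Suc 0)) * inverse t ^ (m - Suc 0)) = - (real m * inverse t ^ (m + 1))"
        by (cases m) auto
      ultimately show ?thesis by (rule DERIV_cong)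
    qed
    have 2: "((\<lambda>t. exp (- inverse t)) has_real_derivative exp (- inverse t) * inverse t ^ 2) (at t)"
      using t by (auto intro!: derivative_eq_intros simp: power2_eq_square)
    show ?thesis using DERIV_mult[OF 2 1] by (simp add: power_add power2_eq_square algebra_simps)
  qed
  then have "(expm m has_real_derivative
      (exp (- inverse t) * inverse t ^ (m + 2) - real m * (exp (- inverse t) * inverse t ^ (m + 1)))) (at t)"
    by (rule has_field_derivative_transform_within_open[where S="{0<..}"]) (use t in \<open>auto simp: expm_def\<close>)
  then show ?thesis using t by (simp add: expm_def)
next
  assume t: "t = 0"
  have "((\<lambda>h. (expm m (0 + h) - expm m 0) / h) \<longlongrightarrow> 0) (at 0)"
  proof (rule Lim_null_comparison)
    show "\<forall>\<^sub>F h in at 0. norm ((expm m (0 + h) - expm m 0) / h) \<le> fact (m + 2) * \<bar>h\<bar>"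
    proof (rule always_eventually, rule allI)
      fix h :: real
      show "norm ((expm m (0 + h) - expm m 0) / h) \<le> fact (m + 2) * \<bar>h\<bar>"
      proof (cases "h > 0")
        case True
        then have "expm m h / h \<le> fact (m + 2) * h\<^sup>2 / h" by (intro divide_right_mono expm_le) auto
        then show ?thesis using True expm_nonneg[of m h] by (simp add: expm_nonpos power2_eq_square)
      next
        case False
        then have e: "expm m (0 + h) = 0" "expm m 0 = 0" by (simp_all add: expm_nonpos)
        have "0 \<le> fact (m + 2) * \<bar>h\<bar>" by (intro mult_nonneg_nonneg) auto
        then show ?thesis by (simp only: e diff_self div_0 norm_zero)
      qed
    qed
    show "((\<lambda>h. fact (m + 2) * \<bar>h\<bar>) \<longlongrightarrow> 0) (at (0::real))"
      by (auto intro!: tendsto_eq_intros)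
  qed
  then show ?thesis using t by (simp add: DERIV_def expm_nonpos)
qed

lemma expm_measurable [measurable]: "expm m \<in> borel_measurable borel"
  by (intro borel_measurable_continuous_onI continuous_at_imp_continuous_on)
    (auto intro!: DERIV_isCont expm_has_derivative)

lemma expm_compose_has_derivative:
  assumes "q differentiable (at y)"
  shows "((\<lambda>y. expm m (q y)) has_derivative
    (\<lambda>v. (expm (m + 2) (q y) - real m * expm (m + 1) (q y)) * frechet_derivative q (at y) v)) (at y)"
proof -
  have q: "(q has_derivative frechet_derivative q (at y)) (at y)" using assms frechet_derivative_works by blast
  have "(expm m has_derivative (*) (expm (m + 2) (q y) - real m * expm (m + 1) (q y))) (at (q y))"
    using expm_has_derivative[of m "q y"] by (simp add: has_field_derivative_def)
  from has_derivative_compose[OF q this] show ?thesis .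
qed

lemma pd_mult_expm:
  assumes "smooth p" "smooth q"
  shows "pd i (\<lambda>y. p y * expm m (q y)) = (\<lambda>y. p y * ((expm (m + 2) (q y) - real m * expm (m + 1) (q y)) * pd i q y)
    + pd i p y * expm m (q y))"
proof -
  have de: "(\<lambda>y. expm m (q y)) differentiable (at y)" for y
    using expm_compose_has_derivative[OF smooth_differentiable[OF assms(2)]] by (auto simp: differentiable_def)
  have "pd i (\<lambda>y. expm m (q y)) y = (expm (m + 2) (q y) - real m * expm (m + 1) (q y)) * pd i q y" for y
    using pd_eqI[OF expm_compose_has_derivative[OF smooth_differentiable[OF assms(2)]]] by (simp add: pd_def)
  then show ?thesis by (subst pd_mult[OF smooth_differentiable[OF assms(1)] de]) simp
qed

text \<open>The induction on the order needs the smooth factor \<open>p\<close> and the index \<open>m\<close> to vary, since each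
  derivative produces terms of the same form with other \<open>p\<close> and \<open>m\<close>.\<close>

lemma smooth_mult_expm:
  assumes "smooth p" "smooth q"
  shows "smooth (\<lambda>y. p y * expm m (q y))"
proof -
  have "Ck k (\<lambda>y. p y * expm m (q y))" for k
    using assms(1)
  proof (induction k arbitrary: p m)
    case 0
    have "continuous_on UNIV (expm m)"
      by (intro continuous_at_imp_continuous_on) (auto intro!: DERIV_isCont expm_has_derivative)
    then have "continuous_on UNIV (\<lambda>y. expm m (q y))"
      by (rule continuous_on_compose2) (auto intro: smooth_continuous assms)
    then show ?case using smooth_continuous[OF 0, of UNIV] by (simp add: continuous_on_mult)
  next
    case (Suc k)
    have de: "(\<lambda>y. p y * expm m (q y)) differentiable (at y)" for y
      using expm_compose_has_derivative[OF smooth_differentiable[OF assms(2)]] smooth_differentiable[OF Suc.prems]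
      by (intro differentiable_mult) (auto simp: differentiable_def)
    have "Ck k (pd i (\<lambda>y. p y * expm m (q y)))" if i: "i \<in> Basis" for i
    proof -
      have eq: "pd i (\<lambda>y. p y * expm m (q y)) = (\<lambda>y. ((p y * pd i q y) * expm (m + 2) (q y)
          + (- real m * (p y * pd i q y)) * expm (m + 1) (q y)) + pd i p y * expm m (q y))"
        by (simp add: pd_mult_expm[OF Suc.prems assms(2)] algebra_simps)
      show ?thesis unfolding eq
        by (intro Ck_add Suc.IH smooth_mult smooth_cmult smooth_pd Suc.prems assms i)
    qed
    then show ?case unfolding Ck_Suc_iff using de by blast
  qed
  then show ?thesis by (simp add: smooth_def)
qed

definition bump_arg :: "'a::euclidean_space \<Rightarrow> real \<Rightarrow> 'a \<Rightarrow> real" where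
  "bump_arg x \<rho> y = 1 - (norm (y - x))\<^sup>2 / \<rho>\<^sup>2"

definition bump :: "'a::euclidean_space \<Rightarrow> real \<Rightarrow> 'a \<Rightarrow> real" where
  "bump x \<rho> y = expm 0 (bump_arg x \<rho> y)"

definition lapl :: "('a::euclidean_space \<Rightarrow> real) \<Rightarrow> 'a \<Rightarrow> real" where
  "lapl f y = (\<Sum>i\<in>Basis. pd i (pd i f) y)"

text \<open>The mollifier at scale \<open>\<rho>\<close>. Its profile \<open>expm 2\<close> is the derivative of the profile \<open>expm 0\<close> of the
  bump function, so that \<open>(y - x)\<close> times the mollifier is a multiple of the gradient of the bump.\<close>

definition kern :: "'a::euclidean_space \<Rightarrow> real \<Rightarrow> 'a \<Rightarrow> real" where
  "kern x \<rho> y = expm 2 (bump_arg x \<rho> y) / \<rho> ^ DIM('a)"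

lemma bump_arg_le: "bump_arg x \<rho> y \<le> 1"
  by (simp add: bump_arg_def)

lemma bump_arg_outside: "\<rho> > 0 \<Longrightarrow> y \<notin> cball x \<rho> \<Longrightarrow> bump_arg x \<rho> y \<le> 0"
  by (simp add: bump_arg_def dist_norm norm_minus_commute power_mono)

lemma bump_arg_measurable [measurable]: "bump_arg x \<rho> \<in> borel_measurable borel"
  unfolding bump_arg_def by measurable

lemma kern_measurable [measurable]: "kern x \<rho> \<in> borel_measurable borel"
  unfolding kern_def by measurable

lemma smooth_bump_arg: "smooth (bump_arg x \<rho>)"
proof -
  have "bump_arg x \<rho> = (\<lambda>y. 1 + (- 1 / \<rho>\<^sup>2) * (\<Sum>i\<in>Basis. ((y - x) \<bullet> i) * ((y - x) \<bullet> i)))"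
    by (simp add: bump_arg_def fun_eq_iff power2_norm_eq_inner euclidean_inner[symmetric])
  then show ?thesis
    by (simp only:) (intro smooth_add smooth_const smooth_cmult smooth_sum smooth_mult smooth_inner_shift finite_Basis)
qed

lemma pd_bump_arg: "pd i (bump_arg x \<rho>) = (\<lambda>y. (- 2 / \<rho>\<^sup>2) * ((y - x) \<bullet> i))"
proof
  fix y
  have "((\<lambda>y. 1 - c * ((y - x) \<bullet> (y - x))) has_derivative (\<lambda>v. - 2 * c * ((y - x) \<bullet> v))) (at y)" for c :: real
    by (auto intro!: derivative_eq_intros simp: inner_commute)
  from this[of "1 / \<rho>\<^sup>2"] show "pd i (bump_arg x \<rho>) y = (- 2 / \<rho>\<^sup>2) * ((y - x) \<bullet> i)"
    using pd_eqI[of "bump_arg x \<rho>" _ y i] by (simp add: bump_arg_def[abs_def] power2_norm_eq_inner)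
qed

lemma bump_test_function:
  assumes "\<rho> > 0" "cball x \<rho> \<subseteq> U"
  shows "bump x \<rho> \<in> test_functions U"
proof (rule test_functionsI[OF _ compact_cball assms(2)])
  show "smooth (bump x \<rho>)"
    using smooth_mult_expm[OF smooth_const[of 1] smooth_bump_arg, of 0 x \<rho>] by (simp add: bump_def[abs_def])
  show "bump x \<rho> y = 0" if "y \<notin> cball x \<rho>" for y
    using bump_arg_outside[OF assms(1) that] by (simp add: bump_def expm_nonpos)
qed

lemma lapl_bump:
  "lapl (bump x \<rho>) y = (expm 4 (bump_arg x \<rho> y) - 2 * expm 3 (bump_arg x \<rho> y)) * (4 * (norm (y - x))\<^sup>2 / \<rho>^4)
    - (2 * DIM('a) / \<rho>\<^sup>2) * expm 2 (bump_arg x \<rho> (y::'a::euclidean_space))"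
proof -
  let ?q = "bump_arg x \<rho>" let ?c = "- 2 / \<rho>\<^sup>2"
  have p1: "pd i (bump x \<rho>) = (\<lambda>y. (?c * ((y - x) \<bullet> i)) * expm 2 (?q y))" for i
    using pd_mult_expm[OF smooth_const[of 1] smooth_bump_arg, of i 0 x \<rho>]
    by (simp add: bump_def[abs_def] pd_const pd_bump_arg mult.commute del: add_2_eq_Suc add_2_eq_Suc')
  have sl: "smooth (\<lambda>y. ?c * ((y - x) \<bullet> i))" for i by (intro smooth_cmult smooth_inner_shift)
  have pl: "pd i (\<lambda>y. ?c * ((y - x) \<bullet> i)) y = ?c" if "i \<in> Basis" for i y
  proof -
    have "((\<lambda>y. c * ((y - x) \<bullet> i)) has_derivative (\<lambda>v. c * (v \<bullet> i))) (at y)" for c :: real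
      by (auto intro!: derivative_eq_intros)
    from pd_eqI[OF this[of ?c], of i] show ?thesis using that by simp
  qed
  have p2: "pd i (pd i (bump x \<rho>)) y = (?c * ((y - x) \<bullet> i)) * ((expm 4 (?q y) - 2 * expm 3 (?q y)) * (?c * ((y - x) \<bullet> i)))
      + ?c * expm 2 (?q y)" if "i \<in> Basis" for i
    unfolding p1 by (subst pd_mult_expm[OF sl smooth_bump_arg]) (simp only: pl[OF that] pd_bump_arg, simp)
  have "lapl (bump x \<rho>) y = (\<Sum>i\<in>Basis. (?c * ?c * (expm 4 (?q y) - 2 * expm 3 (?q y))) * (((y - x) \<bullet> i) * ((y - x) \<bullet> i))
      + ?c * expm 2 (?q y))"
    unfolding lapl_def by (intro sum.cong refl) (simp add: p2 mult_ac)
  also have "\<dots> = (?c * ?c * (expm 4 (?q y) - 2 * expm 3 (?q y))) * (\<Sum>i\<in>Basis. ((y - x) \<bullet> i) * ((y - x) \<bullet> i))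
      + DIM('a) * (?c * expm 2 (?q y))"
    by (simp only: sum.distrib sum_distrib_left sum_constant)
  also have "(\<Sum>i\<in>Basis. ((y - x) \<bullet> i) * ((y - x) \<bullet> i)) = (norm (y - x))\<^sup>2"
    by (simp add: power2_norm_eq_inner euclidean_inner[symmetric])
  finally have "lapl (bump x \<rho>) y = (?c * ?c * (expm 4 (?q y) - 2 * expm 3 (?q y))) * (norm (y - x))\<^sup>2
      + DIM('a) * (?c * expm 2 (?q y))" .
  moreover have "?c * ?c = 4 / \<rho>^4" by (simp add: power2_eq_square power4_eq_xxxx)
  ultimately show ?thesis by (simp add: algebra_simps)
qed

text \<open>The derivative of a mollifier \<open>\<rho>\<^sup>-\<^sup>d \<eta>(z/\<rho>)\<close> in its scale is, up to a factor, the divergence of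
  \<open>z \<eta>(z)\<close> rescaled, and here that field is a gradient. So a Laplacian appears, which is what makes the
  mollified values of a weakly harmonic function independent of the scale.\<close>

lemma kern_has_derivative:
  fixes x y :: "'a::euclidean_space"
  assumes \<rho>: "\<rho> > 0"
  shows "((\<lambda>\<rho>. kern x \<rho> y) has_real_derivative \<rho> / (2 * \<rho> ^ DIM('a)) * lapl (bump x \<rho>) y) (at \<rho>)"
proof -
  let ?q = "\<lambda>\<rho>. bump_arg x \<rho> y" let ?n = "(norm (y - x))\<^sup>2" let ?D = "DIM('a)"
  have dq: "(?q has_real_derivative 2 * ?n / \<rho>^3) (at \<rho>)"
    unfolding bump_arg_def using \<rho>
    by (auto intro!: derivative_eq_intros simp: field_simps power2_eq_square power3_eq_cube)
  have de: "((\<lambda>\<rho>. expm 2 (?q \<rho>)) has_real_derivative (expm 4 (?q \<rho>) - 2 * expm 3 (?q \<rho>)) * (2 * ?n / \<rho>^3)) (at \<rho>)"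
    using DERIV_chain2[OF expm_has_derivative[of 2] dq] by simp
  have dp: "((\<lambda>\<rho>. \<rho> ^ ?D) has_real_derivative real ?D * \<rho> ^ ?D / \<rho>) (at \<rho>)"
  proof -
    obtain n where n: "?D = Suc n" using DIM_positive[where 'a='a] gr0_conv_Suc by blast
    have "((\<lambda>\<rho>. \<rho> ^ ?D) has_real_derivative real ?D * (1 * \<rho> ^ (?D - Suc 0))) (at \<rho>)"
      by (rule DERIV_power[OF DERIV_ident])
    moreover have "real ?D * (1 * \<rho> ^ (?D - Suc 0)) = real ?D * \<rho> ^ ?D / \<rho>"
      unfolding n using \<rho> by simp
    ultimately show ?thesis by (rule DERIV_cong)
  qed
  have "((\<lambda>\<rho>. kern x \<rho> y) has_real_derivative
      ((expm 4 (?q \<rho>) - 2 * expm 3 (?q \<rho>)) * (2 * ?n / \<rho>^3) * \<rho> ^ ?D - expm 2 (?q \<rho>) * (real ?D * \<rho> ^ ?D / \<rho>))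
        / (\<rho> ^ ?D * \<rho> ^ ?D)) (at \<rho>)"
    unfolding kern_def by (rule DERIV_divide[OF de dp]) (use \<rho> in simp)
  moreover have "((expm 4 (?q \<rho>) - 2 * expm 3 (?q \<rho>)) * (2 * ?n / \<rho>^3) * \<rho> ^ ?D - expm 2 (?q \<rho>) * (real ?D * \<rho> ^ ?D / \<rho>))
        / (\<rho> ^ ?D * \<rho> ^ ?D) = \<rho> / (2 * \<rho> ^ ?D) * lapl (bump x \<rho>) y"
  proof -
    define w where "w = \<rho> ^ ?D"
    have w: "w \<noteq> 0" using \<rho> by (simp add: w_def)
    define a where "a = expm 4 (?q \<rho>) - 2 * expm 3 (?q \<rho>)"
    define b where "b = expm 2 (?q \<rho>)"
    have "(a * (2 * ?n / \<rho>^3) * w - b * (real ?D * w / \<rho>)) / (w * w)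
        = \<rho> / (2 * w) * (a * (4 * ?n / \<rho>^4) - (2 * ?D / \<rho>\<^sup>2) * b)"
      using \<rho> w by (simp add: field_simps eval_nat_numeral)
    then show ?thesis unfolding lapl_bump w_def a_def b_def .
  qed
  ultimately show ?thesis by simp
qed

lemma kern_nonneg: "\<rho> > 0 \<Longrightarrow> 0 \<le> kern x \<rho> y"
  by (simp add: kern_def expm_nonneg)

lemma kern_outside: "\<rho> > 0 \<Longrightarrow> y \<notin> cball x \<rho> \<Longrightarrow> kern x \<rho> y = 0"
  using bump_arg_outside[of \<rho> y x] by (simp add: kern_def expm_nonpos)

lemma kern_le: "\<rho> > 0 \<Longrightarrow> kern (x::'a::euclidean_space) \<rho> y \<le> 24 / \<rho> ^ DIM('a)"
  using expm_le_fact[OF bump_arg_le, of 2 x \<rho> y] by (simp add: kern_def divide_right_mono fact_numeral)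

lemma lapl_bump_bound:
  assumes \<rho>: "\<rho> > 0"
  shows "\<bar>lapl (bump x \<rho>) (y::'a::euclidean_space)\<bar> \<le> (3840 + 48 * DIM('a)) / \<rho>\<^sup>2"
proof (cases "y \<in> cball x \<rho>")
  case False
  then have "bump_arg x \<rho> y \<le> 0" by (rule bump_arg_outside[OF \<rho>])
  then show ?thesis by (simp add: lapl_bump expm_nonpos)
next
  case True
  let ?q = "bump_arg x \<rho> y"
  have e: "0 \<le> expm 2 ?q" "expm 2 ?q \<le> 24" "0 \<le> expm 3 ?q" "expm 3 ?q \<le> 120" "0 \<le> expm 4 ?q" "expm 4 ?q \<le> 720"
    using expm_le_fact[OF bump_arg_le, of 2 x \<rho> y] expm_le_fact[OF bump_arg_le, of 3 x \<rho> y]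
      expm_le_fact[OF bump_arg_le, of 4 x \<rho> y]
    by (auto simp: expm_nonneg fact_numeral)
  have "(norm (y - x))\<^sup>2 \<le> \<rho>\<^sup>2" using True by (intro power_mono) (auto simp: dist_norm norm_minus_commute)
  then have "4 * (norm (y - x))\<^sup>2 / \<rho>^4 \<le> 4 * \<rho>\<^sup>2 / \<rho>^4" using \<rho> by (intro divide_right_mono) auto
  also have "\<dots> = 4 / \<rho>\<^sup>2" using \<rho> by (simp add: field_simps eval_nat_numeral)
  finally have n: "4 * (norm (y - x))\<^sup>2 / \<rho>^4 \<le> 4 / \<rho>\<^sup>2" .
  have "\<bar>expm 4 ?q - 2 * expm 3 ?q\<bar> \<le> 960" using e by linarith
  then have "\<bar>expm 4 ?q - 2 * expm 3 ?q\<bar> * (4 * (norm (y - x))\<^sup>2 / \<rho>^4) \<le> 960 * (4 / \<rho>\<^sup>2)"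
    using n \<rho> by (intro mult_mono) auto
  then have 1: "\<bar>(expm 4 ?q - 2 * expm 3 ?q) * (4 * (norm (y - x))\<^sup>2 / \<rho>^4)\<bar> \<le> 3840 / \<rho>\<^sup>2"
    by (simp add: abs_mult)
  have "(2 * DIM('a) / \<rho>\<^sup>2) * expm 2 ?q \<le> (2 * DIM('a) / \<rho>\<^sup>2) * 24" using e \<rho> by (intro mult_left_mono) auto
  moreover have "0 \<le> (2 * DIM('a) / \<rho>\<^sup>2) * expm 2 ?q" using e \<rho> by auto
  ultimately have 2: "\<bar>(2 * DIM('a) / \<rho>\<^sup>2) * expm 2 ?q\<bar> \<le> 48 * DIM('a) / \<rho>\<^sup>2" by (simp add: mult_ac)
  have "\<bar>lapl (bump x \<rho>) y\<bar> \<le> 3840 / \<rho>\<^sup>2 + 48 * DIM('a) / \<rho>\<^sup>2"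
    unfolding lapl_bump using 1 2 by linarith
  then show ?thesis by (simp add: add_divide_distrib)
qed

lemma lapl_bump_measurable [measurable]: "lapl (bump x \<rho>) \<in> borel_measurable borel"
  unfolding lapl_bump[abs_def] by measurable

text \<open>This bound is uniform in \<open>y\<close> and dominates the difference quotients in the scale when the mollified
  values are differentiated under the integral.\<close>

lemma kern_Lipschitz_scale:
  fixes x y :: "'a::euclidean_space"
  assumes s: "s > 0" and \<rho>: "s \<le> \<rho>" and \<tau>: "s \<le> \<tau>"
  shows "\<bar>kern x \<tau> y - kern x \<rho> y\<bar> \<le> (1920 + 24 * DIM('a)) / (s * s ^ DIM('a)) * \<bar>\<tau> - \<rho>\<bar>"
proof -
  let ?B = "(1920 + 24 * DIM('a)) / (s * s ^ DIM('a))"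
  have bound: "\<bar>z / (2 * z ^ DIM('a)) * lapl (bump x z) y\<bar> \<le> ?B" if z: "s \<le> z" for z
  proof -
    have z0: "z > 0" using s z by simp
    have "\<bar>z / (2 * z ^ DIM('a)) * lapl (bump x z) y\<bar> \<le> z / (2 * z ^ DIM('a)) * ((3840 + 48 * DIM('a)) / z\<^sup>2)"
      unfolding abs_mult using z0
      by (intro mult_mono order_eq_refl[OF abs_of_nonneg] order_trans[OF lapl_bump_bound[OF z0, of x y]]) auto
    also have "\<dots> = (1920 + 24 * DIM('a)) / (z * z ^ DIM('a))"
      using z0 by (simp add: field_simps power2_eq_square)
    also have "\<dots> \<le> ?B" using z s by (intro divide_left_mono mult_mono power_mono mult_pos_pos) auto
    finally show ?thesis .
  qed
  have main: "\<bar>kern x b y - kern x a y\<bar> \<le> ?B * \<bar>b - a\<bar>" if ab: "a < b" "s \<le> a" for a b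
  proof -
    have "\<exists>z. a < z \<and> z < b \<and> kern x b y - kern x a y = (b - a) * (z / (2 * z ^ DIM('a)) * lapl (bump x z) y)"
      by (rule MVT2[OF ab(1)], rule kern_has_derivative) (use ab s in linarith)
    then obtain z where z: "a < z" "kern x b y - kern x a y = (b - a) * (z / (2 * z ^ DIM('a)) * lapl (bump x z) y)" by blast
    have "\<bar>kern x b y - kern x a y\<bar> = \<bar>b - a\<bar> * \<bar>z / (2 * z ^ DIM('a)) * lapl (bump x z) y\<bar>"
      unfolding z(2) by (rule abs_mult)
    also have "\<dots> \<le> \<bar>b - a\<bar> * ?B" using z ab by (intro mult_left_mono bound) auto
    finally show ?thesis by (simp add: mult.commute)
  qed
  show ?thesis
  proof (rule linorder_cases[of \<rho> \<tau>])
    assume "\<rho> < \<tau>" then show ?thesis using main \<rho> by simp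
  next
    assume "\<tau> < \<rho>" then show ?thesis using main[of \<tau> \<rho>] \<tau> by (simp add: abs_minus_commute)
  qed simp
qed

lemma kern_integrable:
  assumes k: "integrable lborel k" and \<rho>: "\<rho> > 0"
  shows "integrable lborel (\<lambda>y. k y * kern (x::'a::euclidean_space) \<rho> y)"
proof (rule Bochner_Integration.integrable_bound)
  show "integrable lborel (\<lambda>y. 24 / \<rho> ^ DIM('a) * k y)" using k by simp
  have [measurable]: "k \<in> borel_measurable borel" using k by auto
  show "(\<lambda>y. k y * kern x \<rho> y) \<in> borel_measurable lborel" by measurable
  show "AE y in lborel. norm (k y * kern x \<rho> y) \<le> norm (24 / \<rho> ^ DIM('a) * k y)"
  proof (rule AE_I2)
    fix y
    have "\<bar>k y\<bar> * kern x \<rho> y \<le> \<bar>k y\<bar> * (24 / \<rho> ^ DIM('a))" using kern_le[OF \<rho>] by (intro mult_left_mono) auto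
    then show "norm (k y * kern x \<rho> y) \<le> norm (24 / \<rho> ^ DIM('a) * k y)"
      using kern_nonneg[OF \<rho>, of x y] \<rho> by (simp add: abs_mult mult_ac)
  qed
qed

lemma mollified_value_constant:
  fixes x :: "'a::euclidean_space" and k :: "'a \<Rightarrow> real"
  assumes k: "integrable lborel k"
    and harm: "\<And>\<rho>. 0 < \<rho> \<Longrightarrow> \<rho> < R \<Longrightarrow> (LINT y|lborel. k y * lapl (bump x \<rho>) y) = 0"
    and a: "0 < a" "a < b" "b < R"
  shows "(LINT y|lborel. k y * kern x a y) = (LINT y|lborel. k y * kern x b y)"
proof -
  define m where "m \<rho> = (LINT y|lborel. k y * kern x \<rho> y)" for \<rho>
  have [measurable]: "k \<in> borel_measurable borel" using k by auto
  have der: "(m has_real_derivative 0) (at \<rho>)" if \<rho>: "0 < \<rho>" "\<rho> < R" for \<rho>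
  proof -
    let ?c = "\<rho> / (2 * \<rho> ^ DIM('a))"
    let ?s = "\<rho> / 2"
    let ?B = "(1920 + 24 * DIM('a)) / (?s * ?s ^ DIM('a))"
    have "((\<lambda>h. (m (\<rho> + h) - m \<rho>) / h) \<longlongrightarrow> 0) (at 0)"
      unfolding tendsto_at_iff_sequentially comp_def
    proof (intro allI impI)
      fix h :: "nat \<Rightarrow> real"
      assume h: "\<forall>i. h i \<in> UNIV - {0}" and h0: "h \<longlonglongrightarrow> 0"
      have ev: "\<forall>\<^sub>F n in sequentially. \<bar>h n\<bar> < \<rho> / 2"
        using tendstoD[OF h0, of "\<rho>/2"] \<rho> by simp
      obtain n0 where n0: "\<And>n. n \<ge> n0 \<Longrightarrow> \<bar>h n\<bar> < \<rho> / 2" using ev by (auto simp: eventually_sequentially)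
      define h' where "h' n = h (n + n0)" for n
      have h': "\<bar>h' n\<bar> < \<rho> / 2" "h' n \<noteq> 0" for n using n0[of "n + n0"] h by (auto simp: h'_def)
      have h'0: "h' \<longlonglongrightarrow> 0" unfolding h'_def using h0 by (rule LIMSEQ_ignore_initial_segment)
      have L1: "(\<lambda>n. LINT y|lborel. k y * ((kern x (\<rho> + h' n) y - kern x \<rho> y) / h' n)) \<longlonglongrightarrow> (LINT y|lborel. k y * (?c * lapl (bump x \<rho>) y))"
      proof (rule integral_dominated_convergence[where w="\<lambda>y. ?B * \<bar>k y\<bar>"])
        show "integrable lborel (\<lambda>y. ?B * \<bar>k y\<bar>)" using k by (intro integrable_mult_right integrable_abs)
        show "AE y in lborel. (\<lambda>n. k y * ((kern x (\<rho> + h' n) y - kern x \<rho> y) / h' n)) \<longlonglongrightarrow> k y * (?c * lapl (bump x \<rho>) y)"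
        proof (rule AE_I2)
          fix y
          have "((\<lambda>h. (kern x (\<rho> + h) y - kern x \<rho> y) / h) \<longlongrightarrow> ?c * lapl (bump x \<rho>) y) (at 0)"
            using kern_has_derivative[OF \<rho>(1), of x y] by (simp add: DERIV_def)
          moreover have "filterlim h' (at 0) sequentially"
            using h'0 h'(2) by (auto simp: filterlim_at)
          ultimately have "(\<lambda>n. (kern x (\<rho> + h' n) y - kern x \<rho> y) / h' n) \<longlonglongrightarrow> ?c * lapl (bump x \<rho>) y"
            by (rule filterlim_compose)
          then show "(\<lambda>n. k y * ((kern x (\<rho> + h' n) y - kern x \<rho> y) / h' n)) \<longlonglongrightarrow> k y * (?c * lapl (bump x \<rho>) y)"
            by (rule tendsto_mult_left)
        qed
        show "AE y in lborel. norm (k y * ((kern x (\<rho> + h' n) y - kern x \<rho> y) / h' n)) \<le> ?B * \<bar>k y\<bar>" for n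
        proof (rule AE_I2)
          fix y
          have "\<bar>kern x (\<rho> + h' n) y - kern x \<rho> y\<bar> \<le> ?B * \<bar>(\<rho> + h' n) - \<rho>\<bar>"
            by (rule kern_Lipschitz_scale) (use \<rho> h'(1)[of n] in \<open>auto simp: abs_if split: if_splits\<close>)
          then have "\<bar>kern x (\<rho> + h' n) y - kern x \<rho> y\<bar> \<le> ?B * \<bar>h' n\<bar>" by simp
          then have "\<bar>(kern x (\<rho> + h' n) y - kern x \<rho> y) / h' n\<bar> \<le> ?B"
            using h'(2)[of n] by (simp add: abs_divide pos_divide_le_eq)
          then have "\<bar>k y\<bar> * \<bar>(kern x (\<rho> + h' n) y - kern x \<rho> y) / h' n\<bar> \<le> \<bar>k y\<bar> * ?B" by (intro mult_left_mono) auto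
          then show "norm (k y * ((kern x (\<rho> + h' n) y - kern x \<rho> y) / h' n)) \<le> ?B * \<bar>k y\<bar>"
            by (simp add: abs_mult mult.commute)
        qed
      qed measurable
      have L2: "(LINT y|lborel. k y * (?c * lapl (bump x \<rho>) y)) = ?c * (LINT y|lborel. k y * lapl (bump x \<rho>) y)"
        by (simp add: mult.left_commute)
      have L3: "(LINT y|lborel. k y * ((kern x (\<rho> + h' n) y - kern x \<rho> y) / h' n)) = (m (\<rho> + h' n) - m \<rho>) / h' n" for n
      proof -
        have p: "\<rho> + h' n > 0" using \<rho> h'(1)[of n] by (simp add: abs_if split: if_splits)
        have "(LINT y|lborel. k y * ((kern x (\<rho> + h' n) y - kern x \<rho> y) / h' n))
            = (LINT y|lborel. (k y * kern x (\<rho> + h' n) y - k y * kern x \<rho> y) / h' n)"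
          by (simp add: right_diff_distrib)
        also have "\<dots> = (m (\<rho> + h' n) - m \<rho>) / h' n"
          unfolding m_def using kern_integrable[OF k p, of x] kern_integrable[OF k \<rho>(1), of x] by simp
        finally show ?thesis .
      qed
      from L1[unfolded L2 L3 harm[OF \<rho>] mult_zero_right] show "(\<lambda>n. (m (\<rho> + h n) - m \<rho>) / h n) \<longlonglongrightarrow> 0"
        unfolding h'_def by (rule LIMSEQ_offset)
    qed
    then show ?thesis by (simp add: DERIV_def)
  qed
  have "\<exists>z. a < z \<and> z < b \<and> m b - m a = (b - a) * 0"
    by (rule MVT2[OF a(2)]) (use a in \<open>auto intro!: der\<close>)
  then show ?thesis by (auto simp: m_def)
qed

lemma kern_integrable_self:
  assumes \<rho>: "\<rho> > 0"
  shows "integrable lborel (kern (x::'a::euclidean_space) \<rho>)"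
proof (rule Bochner_Integration.integrable_bound)
  show "integrable lborel (\<lambda>y. 24 / \<rho> ^ DIM('a) * indicator (cball x \<rho>) y :: real)"
    using emeasure_lborel_cball_finite[of x \<rho>] by (intro integrable_mult_right integrable_real_indicator) auto
  show "AE y in lborel. norm (kern x \<rho> y) \<le> norm (24 / \<rho> ^ DIM('a) * indicator (cball x \<rho>) y :: real)"
    using kern_le[OF \<rho>, of x] kern_outside[OF \<rho>, of _ x] kern_nonneg[OF \<rho>, of x] \<rho>
    by (intro AE_I2) (auto simp: indicator_def)
qed measurable

text \<open>The mollifier is not normalised; a lower bound for its integral that is independent of the scale
  does the same service.\<close>

lemma kern_integral_lower:
  fixes x :: "'a::euclidean_space"
  assumes \<rho>: "\<rho> > 0"
  shows "exp (-2) * unit_ball_vol DIM('a) / 2 ^ DIM('a) \<le> (LINT y|lborel. kern x \<rho> y)"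
proof -
  let ?D = "DIM('a)"
  have low: "exp (-2) \<le> expm 2 (bump_arg x \<rho> y)" if "y \<in> cball x (\<rho>/2)" for y
  proof -
    let ?t = "bump_arg x \<rho> y"
    have "(norm (y - x))\<^sup>2 \<le> (\<rho>/2)\<^sup>2" using that by (intro power_mono) (auto simp: dist_norm norm_minus_commute)
    then have "(norm (y - x))\<^sup>2 / \<rho>\<^sup>2 \<le> (\<rho>/2)\<^sup>2 / \<rho>\<^sup>2" by (intro divide_right_mono) auto
    moreover have "(\<rho>/2)\<^sup>2 / \<rho>\<^sup>2 = 1/4" using \<rho> by (simp add: power_divide)
    ultimately have t: "?t \<ge> 1/2" unfolding bump_arg_def by linarith
    then have i: "inverse ?t \<le> 2" using le_imp_inverse_le[of "1/2" ?t] by simp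
    have i1: "1 \<le> inverse ?t" using t bump_arg_le[of x \<rho> y] by (intro one_le_inverse) auto
    have "exp (-2) * 1 \<le> exp (- inverse ?t) * inverse ?t ^ 2"
      using i i1 by (intro mult_mono) (auto intro: one_le_power)
    then show ?thesis using t by (simp add: expm_def)
  qed
  note ik = kern_integrable_self[OF \<rho>, of x]
  have "exp (-2) / \<rho> ^ ?D * measure lborel (cball x (\<rho>/2)) = (LINT y|lborel. exp (-2) / \<rho> ^ ?D * indicator (cball x (\<rho>/2)) y)"
    by simp
  also have "\<dots> \<le> (LINT y|lborel. kern x \<rho> y)"
  proof (rule integral_mono[OF _ ik])
    show "integrable lborel (\<lambda>y. exp (-2) / \<rho> ^ ?D * indicator (cball x (\<rho>/2)) y :: real)"
      using emeasure_lborel_cball_finite[of x "\<rho>/2"] by (intro integrable_mult_right integrable_real_indicator) auto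
    show "exp (-2) / \<rho> ^ ?D * indicator (cball x (\<rho>/2)) y \<le> kern x \<rho> y" for y
      using low[of y] kern_nonneg[OF \<rho>, of x y] \<rho> by (auto simp: kern_def indicator_def intro!: divide_right_mono)
  qed
  finally show ?thesis using \<rho> by (simp add: content_cball power_divide)
qed

text \<open>At a Lebesgue point \<open>x\<close> the mollified values at small scales are close to \<open>k x\<close> times the integral of
  the mollifier. They equal the mollified value at scale \<open>R/2\<close>, and that one is bounded by the total
  integral of \<open>\<bar>k\<bar>\<close> because the mollifier is at most \<open>24 (2/R)\<^sup>d\<close>.\<close>

theorem weakly_harmonic_bound:
  fixes k :: "'a::euclidean_space \<Rightarrow> real"
  assumes k: "integrable lborel k" and R: "R > 0"
    and harm: "\<And>x \<rho>. x \<in> B \<Longrightarrow> 0 < \<rho> \<Longrightarrow> \<rho> < R \<Longrightarrow> (LINT y|lborel. k y * lapl (bump x \<rho>) y) = 0"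
  shows "AE x in lborel. x \<in> B \<longrightarrow>
    exp (-2) * unit_ball_vol DIM('a) / 2 ^ DIM('a) * \<bar>k x\<bar> \<le> 24 * 2 ^ DIM('a) / R ^ DIM('a) * (LINT y|lborel. \<bar>k y\<bar>)"
proof -
  let ?D = "DIM('a)" let ?v = "unit_ball_vol DIM('a)"
  define r where "r n = (1/2::real) ^ n" for n :: nat
  have r0: "r n > 0" for n by (simp add: r_def)
  have rl: "r \<longlonglongrightarrow> 0" unfolding r_def by (intro LIMSEQ_power_zero) simp
  have v0: "?v > 0" by simp
  have [measurable]: "k \<in> borel_measurable borel" using k by auto
  show ?thesis using AE_lebesgue_point[OF k r0 rl]
  proof (eventually_elim, intro impI)
    fix x assume L: "\<forall>e>0. \<forall>\<^sub>F n in sequentially. (LINT y:cball x (r n)|lborel. \<bar>k y - k x\<bar>) \<le> e * measure lborel (cball x (r n))"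
      and x: "x \<in> B"
    let ?I = "LINT y|lborel. \<bar>k y\<bar>"
    have I: "\<bar>LINT y|lborel. k y * kern x (R/2) y\<bar> \<le> 24 * 2 ^ ?D / R ^ ?D * ?I"
    proof -
      have R2: "R / 2 > 0" using R by simp
      have "\<bar>LINT y|lborel. k y * kern x (R/2) y\<bar> \<le> (LINT y|lborel. \<bar>k y * kern x (R/2) y\<bar>)" by (rule integral_abs_bound)
      also have "\<dots> \<le> (LINT y|lborel. 24 / (R/2) ^ ?D * \<bar>k y\<bar>)"
      proof (rule integral_mono)
        show "\<bar>k y * kern x (R/2) y\<bar> \<le> 24 / (R/2) ^ ?D * \<bar>k y\<bar>" for y
          using mult_left_mono[OF kern_le[OF R2, of x y], of "\<bar>k y\<bar>"] kern_nonneg[OF R2, of x y]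
          by (simp add: abs_mult mult.commute)
      qed (use kern_integrable[OF k R2, of x] k in auto)
      finally show ?thesis by (simp add: power_divide)
    qed
    have main: "exp (-2) * ?v / 2 ^ ?D * \<bar>k x\<bar> \<le> 24 * 2 ^ ?D / R ^ ?D * ?I + 24 * ?v * e" if e: "e > 0" for e
    proof -
      have "\<forall>\<^sub>F n in sequentially. r n < R / 2" using rl R by (intro order_tendstoD) auto
      then have "\<forall>\<^sub>F n in sequentially. r n < R / 2 \<and> (LINT y:cball x (r n)|lborel. \<bar>k y - k x\<bar>) \<le> e * measure lborel (cball x (r n))"
        using L e by (intro eventually_conj) auto
      then obtain n where n: "r n < R / 2" "(LINT y:cball x (r n)|lborel. \<bar>k y - k x\<bar>) \<le> e * measure lborel (cball x (r n))"
        by (auto simp: eventually_sequentially)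
      let ?\<rho> = "r n"
      have eqm: "(LINT y|lborel. k y * kern x ?\<rho> y) = (LINT y|lborel. k y * kern x (R/2) y)"
        by (rule mollified_value_constant[OF k harm[OF x]]) (use n r0 R in auto)
      let ?ind = "indicator (cball x ?\<rho>) :: 'a \<Rightarrow> real"
      have iind: "integrable lborel (\<lambda>y. ?ind y * c)" for c
        using emeasure_lborel_cball_finite[of x ?\<rho>] by (intro integrable_mult_left integrable_real_indicator) auto
      have ki: "integrable lborel (\<lambda>y. ?ind y * k y)"
        using integrable_mult_indicator[of "cball x ?\<rho>" lborel k] k by simp
      have idiff: "integrable lborel (\<lambda>y. ?ind y * \<bar>k y - k x\<bar>)"
      proof -
        have "integrable lborel (\<lambda>y. \<bar>?ind y * k y - ?ind y * k x\<bar>)"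
          by (intro integrable_abs Bochner_Integration.integrable_diff ki iind)
        moreover have "\<bar>?ind y * k y - ?ind y * k x\<bar> = ?ind y * \<bar>k y - k x\<bar>" for y by (simp add: indicator_def)
        ultimately show ?thesis by simp
      qed
      note kk = kern_integrable_self[OF r0[of n], of x]
      have "(LINT y|lborel. k x * kern x ?\<rho> y) = (LINT y|lborel. k y * kern x ?\<rho> y) - (LINT y|lborel. (k y - k x) * kern x ?\<rho> y)"
        using kern_integrable[OF k r0[of n], of x] kk by (simp add: left_diff_distrib)
      moreover have "\<bar>LINT y|lborel. (k y - k x) * kern x ?\<rho> y\<bar> \<le> 24 * ?v * e"
      proof -
        have id2: "integrable lborel (\<lambda>y. (k y - k x) * kern x ?\<rho> y)"
          using kern_integrable[OF k r0[of n], of x] kk by (simp add: left_diff_distrib)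
        have "\<bar>LINT y|lborel. (k y - k x) * kern x ?\<rho> y\<bar> \<le> (LINT y|lborel. \<bar>(k y - k x) * kern x ?\<rho> y\<bar>)"
          by (rule integral_abs_bound)
        also have "\<dots> \<le> (LINT y|lborel. 24 / ?\<rho> ^ ?D * (?ind y * \<bar>k y - k x\<bar>))"
        proof (rule integral_mono)
          show "\<bar>(k y - k x) * kern x ?\<rho> y\<bar> \<le> 24 / ?\<rho> ^ ?D * (?ind y * \<bar>k y - k x\<bar>)" for y
          proof (cases "y \<in> cball x ?\<rho>")
            case True
            then show ?thesis
              using mult_left_mono[OF kern_le[OF r0[of n], of x y], of "\<bar>k y - k x\<bar>"] kern_nonneg[OF r0[of n], of x y]
              by (simp add: abs_mult mult.commute)
          next
            case False
            then show ?thesis using kern_outside[OF r0[of n] False] by simp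
          qed
        qed (use id2 idiff in auto)
        also have "\<dots> = 24 / ?\<rho> ^ ?D * (LINT y:cball x ?\<rho>|lborel. \<bar>k y - k x\<bar>)"
          by (simp add: set_lebesgue_integral_def)
        also have "\<dots> \<le> 24 / ?\<rho> ^ ?D * (e * measure lborel (cball x ?\<rho>))"
          using n(2) r0[of n] by (intro mult_left_mono) auto
        also have "\<dots> = 24 * ?v * e" using r0[of n] by (simp add: content_cball less_imp_le)
        finally show ?thesis .
      qed
      ultimately have "\<bar>LINT y|lborel. k x * kern x ?\<rho> y\<bar> \<le> 24 * 2 ^ ?D / R ^ ?D * ?I + 24 * ?v * e"
        using I eqm by linarith
      moreover have "\<bar>LINT y|lborel. k x * kern x ?\<rho> y\<bar> = \<bar>k x\<bar> * (LINT y|lborel. kern x ?\<rho> y)"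
        using kern_nonneg[OF r0[of n], of x] by (simp add: abs_mult)
      moreover have "exp (-2) * ?v / 2 ^ ?D * \<bar>k x\<bar> \<le> \<bar>k x\<bar> * (LINT y|lborel. kern x ?\<rho> y)"
        using mult_left_mono[OF kern_integral_lower[OF r0[of n], of x], of "\<bar>k x\<bar>"] by (simp add: mult.commute)
      ultimately show ?thesis by linarith
    qed
    show "exp (-2) * ?v / 2 ^ ?D * \<bar>k x\<bar> \<le> 24 * 2 ^ ?D / R ^ ?D * ?I"
    proof (rule field_le_epsilon)
      fix e :: real assume "e > 0"
      then have "e / (24 * ?v) > 0" by simp
      from main[OF this] show "exp (-2) * ?v / 2 ^ ?D * \<bar>k x\<bar> \<le> 24 * 2 ^ ?D / R ^ ?D * ?I + e"
        using v0 by simp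
    qed
  qed
qed

section \<open>Self-improving integrability\<close>

abbreviation mass :: "('a::euclidean_space \<Rightarrow> real) \<Rightarrow> 'a set \<Rightarrow> real" where
  "mass f A \<equiv> (LINT y:A|lborel. f y)"

lemma set_integrable_borel:
  fixes f :: "'a::euclidean_space \<Rightarrow> real"
  assumes "integrable lborel f" "A \<in> sets borel"
  shows "set_integrable lborel A f"
  using integrable_mult_indicator[of A lborel f] assms by (simp add: set_integrable_def)

lemma mass_mono:
  assumes "integrable lborel f" "integrable lborel g" "A \<in> sets borel" "B \<in> sets borel" "A \<subseteq> B"
    "\<And>y. 0 \<le> g y" "AE y in lborel. y \<in> A \<longrightarrow> f y \<le> g y"
  shows "mass f A \<le> mass g B"
  unfolding set_lebesgue_integral_def
proof (rule integral_mono_AE)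
  show "integrable lborel (\<lambda>x. indicator A x *\<^sub>R f x)" "integrable lborel (\<lambda>x. indicator B x *\<^sub>R g x)"
    using set_integrable_borel assms by (auto simp: set_integrable_def)
  show "AE x in lborel. indicator A x *\<^sub>R f x \<le> indicator B x *\<^sub>R g x"
    using assms(7) by eventually_elim (use assms(5,6) in \<open>auto simp: indicator_def\<close>)
qed

lemma measure_cball_scale:
  "r \<ge> 0 \<Longrightarrow> measure lborel (cball (x::'a::euclidean_space) r) = unit_ball_vol DIM('a) * r ^ DIM('a)"
  by (simp add: content_cball)

text \<open>What comparing a gradient with a weakly harmonic field yields for \<open>P = \<bar>\<nabla>u\<bar>\<^sup>2\<close> and \<open>Q = \<bar>F\<bar>\<^sup>2\<close>: \<open>M\<close> stems
  from the harmonic field and \<open>W\<close> from the difference. The useful situation is a small \<open>\<eta>\<close> with a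
  fixed \<open>K\<close>.\<close>

definition half_ball_comparison ::
  "real \<Rightarrow> real \<Rightarrow> ('a::euclidean_space \<Rightarrow> real) \<Rightarrow> ('a \<Rightarrow> real) \<Rightarrow> 'a \<Rightarrow> real \<Rightarrow> bool" where
  "half_ball_comparison K \<eta> P Q x R \<longleftrightarrow> (\<exists>W M. integrable lborel W \<and> (\<forall>y. 0 \<le> W y) \<and> M \<ge> 0 \<and>
    (AE y in lborel. y \<in> ball x (R/2) \<longrightarrow> P y \<le> W y + M) \<and>
    M * R ^ DIM('a) \<le> K * mass P (cball x R) \<and>
    mass W (ball x (R/2)) \<le> K * (mass Q (cball x R) + \<eta> * mass P (cball x R)))"

text \<open>One stopped ball. On the ball of radius \<open>8 \<rho>\<close> the constant \<open>M\<close> is below half of \<open>P\<close> wherever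
  \<open>P\<close> is large, so there the remainder \<open>W\<close> controls \<open>P\<close>. The mass of \<open>W\<close> is a small multiple of \<open>\<tau>\<close>
  times the volume of the ball, which is less than the mass of \<open>P + N Q\<close> on the ball; and the set where
  \<open>P\<close> and \<open>N Q\<close> are both at most \<open>\<tau>/4\<close> contributes at most half of this.\<close>

lemma stopped_ball_estimate:
  fixes P Q d :: "'a::euclidean_space \<Rightarrow> real"
  assumes P: "integrable lborel P" "\<And>y. 0 \<le> P y" and Q: "integrable lborel Q" "\<And>y. 0 \<le> Q y"
    and dm: "d \<in> borel_measurable borel" and d0: "\<And>x. 0 \<le> d x"
    and lip: "\<And>x y. d x \<le> d y + dist x y"
    and K: "K > 0" and N: "N > 0" and \<eta>: "\<eta> > 0" and lev: "lev > 0"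
    and \<rho>: "\<rho> > 0" "32 * \<rho> \<le> d x" and L: "L \<ge> 2 * K * unit_ball_vol DIM('a) * 2 ^ DIM('a)"
    and \<tau>: "\<tau> = lev / d x ^ DIM('a)"
    and up: "mass P (cball x (16*\<rho>)) + N * mass Q (cball x (16*\<rho>)) \<le> \<tau> * (unit_ball_vol DIM('a) * (16*\<rho>) ^ DIM('a))"
    and lo: "\<tau> * (unit_ball_vol DIM('a) * \<rho> ^ DIM('a)) < mass P (cball x \<rho>) + N * mass Q (cball x \<rho>)"
    and W: "integrable lborel W" "\<And>y. 0 \<le> W y" "M \<ge> 0"
      "AE y in lborel. y \<in> ball x (8*\<rho>) \<longrightarrow> P y \<le> W y + M"
      "M * (16*\<rho>) ^ DIM('a) \<le> K * mass P (cball x (16*\<rho>))"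
      "mass W (ball x (8*\<rho>)) \<le> K * (mass Q (cball x (16*\<rho>)) + \<eta> * mass P (cball x (16*\<rho>)))"
  shows "mass P (cball x (5*\<rho>) \<inter> {y. P y * d y ^ DIM('a) > L * lev})
    \<le> mass (\<lambda>y. 4 * K * (1/N + \<eta>) * 16 ^ DIM('a) *
          (P y * indicator {y. P y * d y ^ DIM('a) > lev / (4 * 2 ^ DIM('a))} y
           + N * Q y * indicator {y. N * Q y * d y ^ DIM('a) > lev / (4 * 2 ^ DIM('a))} y)) (cball x \<rho>)"
proof -
  let ?D = "DIM('a)" let ?v = "unit_ball_vol DIM('a)"
  have [measurable]: "P \<in> borel_measurable borel" "Q \<in> borel_measurable borel" "d \<in> borel_measurable borel"
    "W \<in> borel_measurable borel"
    using P Q dm W by auto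
  define S where "S = {y. P y * d y ^ ?D > lev / (4 * 2 ^ ?D)}"
  define T where "T = {y. N * Q y * d y ^ ?D > lev / (4 * 2 ^ ?D)}"
  define A where "A = cball x (5*\<rho>) \<inter> {y. P y * d y ^ ?D > L * lev}"
  have [measurable]: "S \<in> sets borel" "T \<in> sets borel" "A \<in> sets borel" unfolding S_def T_def A_def by measurable
  have dx: "d x > 0" using \<rho> by linarith
  have \<tau>0: "\<tau> > 0" using \<tau> dx lev by simp
  have v0: "?v > 0" by simp
  have dy: "d x / 2 \<le> d y" "d y \<le> 2 * d x" if "dist x y \<le> 16 * \<rho>" for y
    using lip[of x y] lip[of y x] that \<rho> by (auto simp: dist_commute)
  have up0: "mass P (cball x (16*\<rho>)) \<ge> 0" "mass Q (cball x (16*\<rho>)) \<ge> 0"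
    using P Q by (auto simp: set_lebesgue_integral_def)
  define Y where "Y = \<tau> * (?v * (16*\<rho>) ^ ?D)"
  have mP: "mass P (cball x (16*\<rho>)) \<le> Y" using up up0 N mult_nonneg_nonneg[of N "mass Q (cball x (16*\<rho>))"] unfolding Y_def by linarith
  have mQ: "mass Q (cball x (16*\<rho>)) \<le> (1/N) * Y"
  proof -
    have "N * mass Q (cball x (16*\<rho>)) \<le> Y" using up up0 unfolding Y_def by linarith
    then show ?thesis using N by (simp add: field_simps)
  qed
  have M: "M \<le> K * ?v * \<tau>"
  proof -
    have "M * (16*\<rho>) ^ ?D \<le> K * Y" using W(5) mult_left_mono[OF mP, of K] K by linarith
    also have "K * Y = (K * ?v * \<tau>) * (16*\<rho>) ^ ?D" by (simp add: Y_def mult_ac)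
    finally show ?thesis using \<rho> by (simp add: mult_le_cancel_right)
  qed
  have big: "P y > 2 * M" if "y \<in> A" for y
  proof -
    have "dist x y \<le> 16 * \<rho>" using that \<rho> by (auto simp: A_def)
    note d = dy[OF this]
    have Py: "L * lev < P y * d y ^ ?D" using that by (auto simp: A_def)
    have "d y ^ ?D \<le> (2 * d x) ^ ?D" using d d0 by (intro power_mono) auto
    then have "P y * d y ^ ?D \<le> P y * (2 * d x) ^ ?D" using P(2) by (intro mult_left_mono) auto
    with Py have "L * lev < P y * (2 ^ ?D * d x ^ ?D)" by (simp add: power_mult_distrib)
    also have "\<dots> = (P y * 2 ^ ?D) * d x ^ ?D" by simp
    finally have "L * \<tau> < P y * 2 ^ ?D" using dx by (simp add: \<tau> divide_less_eq)
    moreover have "2 * K * ?v * 2 ^ ?D * \<tau> \<le> L * \<tau>" using L \<tau>0 by (intro mult_right_mono) auto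
    moreover have "(2 * K * ?v * \<tau>) * 2 ^ ?D = 2 * K * ?v * 2 ^ ?D * \<tau>" by (simp only: mult_ac)
    ultimately have "(2 * K * ?v * \<tau>) * 2 ^ ?D < P y * 2 ^ ?D" by linarith
    then have "2 * K * ?v * \<tau> < P y" by (rule mult_right_less_imp_less) simp
    then show ?thesis using M by simp
  qed
  have "mass P A \<le> mass (\<lambda>y. 2 * W y) (ball x (8*\<rho>))"
  proof (rule mass_mono)
    show "A \<subseteq> ball x (8*\<rho>)" using \<rho> by (auto simp: A_def)
    show "AE y in lborel. y \<in> A \<longrightarrow> P y \<le> 2 * W y" using W(4)
    proof eventually_elim
      case (elim y)
      show ?case
      proof
        assume yA: "y \<in> A"
        then have "P y \<le> W y + M" using elim \<rho> by (auto simp: A_def)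
        then show "P y \<le> 2 * W y" using big[OF yA] by linarith
      qed
    qed
  qed (use P W in auto)
  also have "\<dots> = 2 * mass W (ball x (8*\<rho>))" by simp
  also have "\<dots> \<le> 2 * (K * ((1/N) * Y + \<eta> * Y))"
    using W(6) mQ mult_left_mono[OF mP, of \<eta>] \<eta> K
    by (intro mult_left_mono order_trans[OF W(6)] add_mono) auto
  also have "\<dots> = 2 * K * (1/N + \<eta>) * 16 ^ ?D * (\<tau> * (?v * \<rho> ^ ?D))"
    by (simp add: Y_def power_mult_distrib algebra_simps)
  finally have first: "mass P A \<le> 2 * K * (1/N + \<eta>) * 16 ^ ?D * (\<tau> * (?v * \<rho> ^ ?D))" .
  have small: "u \<le> \<tau> / 4" if "dist x y \<le> \<rho>" "u \<ge> 0" "u * d y ^ ?D \<le> lev / (4 * 2 ^ ?D)" for y u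
  proof -
    have "d x / 2 \<le> d y" using dy[of y] that \<rho> by auto
    then have "(d x / 2) ^ ?D \<le> d y ^ ?D" using dx by (intro power_mono) auto
    then have "u * (d x / 2) ^ ?D \<le> u * d y ^ ?D" using that by (intro mult_left_mono) auto
    with that(3) have "u * (d x / 2) ^ ?D \<le> lev / (4 * 2 ^ ?D)" by linarith
    then show ?thesis using dx by (simp add: \<tau> power_divide field_simps)
  qed
  let ?B = "cball x \<rho>"
  have Bfin: "integrable lborel (\<lambda>y. indicator ?B y * (c::real))" for c
    using emeasure_lborel_cball_finite[of x \<rho>] by (intro integrable_mult_left integrable_real_indicator) auto
  have iS: "integrable lborel (\<lambda>y. P y * indicator S y)"
    by (rule integrable_real_mult_indicator) (use P in auto)
  have iT: "integrable lborel (\<lambda>y. N * Q y * indicator T y)"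
    by (rule integrable_real_mult_indicator) (use Q in auto)
  have si: "integrable lborel (\<lambda>y. indicator ?B y * f y)" if "integrable lborel f" for f :: "'a \<Rightarrow> real"
    using integrable_mult_indicator[of ?B lborel f] that by simp
  have split1: "mass P ?B \<le> mass (\<lambda>y. P y * indicator S y) ?B + \<tau> / 4 * (?v * \<rho> ^ ?D)"
  proof -
    have "mass P ?B \<le> (LINT y|lborel. indicator ?B y * (P y * indicator S y) + indicator ?B y * (\<tau> / 4))"
      unfolding set_lebesgue_integral_def real_scaleR_def
    proof (rule integral_mono)
      show "indicator ?B y * P y \<le> indicator ?B y * (P y * indicator S y) + indicator ?B y * (\<tau> / 4)" for y
        using small[of y "P y"] P(2)[of y] \<tau>0 by (auto simp: indicator_def S_def not_less)
    qed (intro Bochner_Integration.integrable_add si P iS Bfin)+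
    also have "\<dots> = mass (\<lambda>y. P y * indicator S y) ?B + \<tau> / 4 * (?v * \<rho> ^ ?D)"
      using \<rho> by (subst Bochner_Integration.integral_add[OF si[OF iS] Bfin])
        (simp add: set_lebesgue_integral_def measure_cball_scale)
    finally show ?thesis .
  qed
  have split2: "N * mass Q ?B \<le> mass (\<lambda>y. N * Q y * indicator T y) ?B + \<tau> / 4 * (?v * \<rho> ^ ?D)"
  proof -
    have "N * mass Q ?B = (LINT y|lborel. indicator ?B y * (N * Q y))"
      by (simp add: set_lebesgue_integral_def mult.left_commute)
    also have "\<dots> \<le> (LINT y|lborel. indicator ?B y * (N * Q y * indicator T y) + indicator ?B y * (\<tau> / 4))"
    proof (rule integral_mono)
      show "indicator ?B y * (N * Q y) \<le> indicator ?B y * (N * Q y * indicator T y) + indicator ?B y * (\<tau> / 4)" for y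
        using small[of y "N * Q y"] Q(2)[of y] N \<tau>0 by (auto simp: indicator_def T_def not_less)
    qed (intro Bochner_Integration.integrable_add si Q iT Bfin integrable_mult_right)+
    also have "\<dots> = mass (\<lambda>y. N * Q y * indicator T y) ?B + \<tau> / 4 * (?v * \<rho> ^ ?D)"
      using \<rho> by (subst Bochner_Integration.integral_add[OF si[OF iT] Bfin])
        (simp add: set_lebesgue_integral_def measure_cball_scale)
    finally show ?thesis .
  qed
  have half: "\<tau> * (?v * \<rho> ^ ?D) \<le> 2 * mass (\<lambda>y. P y * indicator S y + N * Q y * indicator T y) ?B"
  proof -
    have "mass (\<lambda>y. P y * indicator S y + N * Q y * indicator T y) ?B
      = mass (\<lambda>y. P y * indicator S y) ?B + mass (\<lambda>y. N * Q y * indicator T y) ?B"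
      by (intro set_integral_add(2) set_integrable_borel iS iT) auto
    then show ?thesis using lo split1 split2 by (simp add: field_simps)
  qed
  define c where "c = 2 * K * (1/N + \<eta>) * 16 ^ ?D"
  have c0: "c \<ge> 0" using K N \<eta> by (simp add: c_def)
  have "mass P A \<le> c * (2 * mass (\<lambda>y. P y * indicator S y + N * Q y * indicator T y) ?B)"
    using first mult_left_mono[OF half c0] unfolding c_def by linarith
  also have "\<dots> = mass (\<lambda>y. (2 * c) * (P y * indicator S y + N * Q y * indicator T y)) ?B"
    by (subst set_integral_mult_right) simp
  finally show ?thesis unfolding A_def S_def T_def by (simp add: c_def mult.assoc)
qed

text \<open>Among the dyadic radii up to \<open>dx / 2\<close> take the largest at which the mean of \<open>H\<close> exceeds \<open>\<tau>\<close>. From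
  \<open>dx / 32\<close> on the mean is at most \<open>\<tau>\<close>, because \<open>\<tau>\<close> is large compared with the total integral of \<open>H\<close>; this
  leaves room for four doublings.\<close>

lemma stopping_radius:
  fixes H :: "'a::euclidean_space \<Rightarrow> real"
  assumes H: "integrable lborel H" "\<And>y. 0 \<le> H y" and dx: "0 < dx" "dx \<le> 1"
    and big: "(LINT y|lborel. H y) \<le> \<tau> * (unit_ball_vol DIM('a) * (dx / 32) ^ DIM('a))"
    and ev: "\<forall>\<^sub>F k in sequentially. \<tau> * measure lborel (cball x ((1/2)^k)) < mass H (cball x ((1/2)^k))"
    and \<tau>: "\<tau> > 0"
  obtains \<rho> where "0 < \<rho>" "32 * \<rho> \<le> dx"
    "\<tau> * (unit_ball_vol DIM('a) * \<rho> ^ DIM('a)) < mass H (cball x \<rho>)"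
    "mass H (cball x (16 * \<rho>)) \<le> \<tau> * (unit_ball_vol DIM('a) * (16 * \<rho>) ^ DIM('a))"
proof -
  let ?v = "unit_ball_vol DIM('a)" let ?D = "DIM('a)"
  have v0: "?v > 0" by simp
  define r where "r k = (1/2 :: real) ^ k" for k
  have r0: "r k > 0" for k by (simp add: r_def)
  have rl: "r \<longlonglongrightarrow> 0" unfolding r_def by (intro LIMSEQ_power_zero) simp
  have "\<exists>k. r k \<le> dx / 2"
    using order_tendstoD(2)[OF rl, of "dx/2"] dx by (auto simp: eventually_sequentially intro: less_imp_le)
  define k1 where "k1 = (LEAST k. r k \<le> dx / 2)"
  have k1: "r k1 \<le> dx / 2" unfolding k1_def using \<open>\<exists>k. _\<close> by (rule LeastI_ex)
  have k1': "r k1 > dx / 4"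
  proof (cases k1)
    case 0
    then show ?thesis using k1 dx by (simp add: r_def)
  next
    case (Suc j)
    have "\<not> r j \<le> dx / 2" using not_less_Least[of j "\<lambda>k. r k \<le> dx/2"] Suc by (simp add: k1_def)
    then show ?thesis using Suc by (simp add: r_def)
  qed
  have noexc: "mass H (cball x s) \<le> \<tau> * (?v * s ^ ?D)" if "s \<ge> dx / 32" for s
  proof -
    have "mass H (cball x s) \<le> mass H UNIV" by (intro mass_mono H) auto
    also have "\<dots> = (LINT y|lborel. H y)" by (simp add: set_lebesgue_integral_def)
    also note big
    also have "\<tau> * (?v * (dx / 32) ^ ?D) \<le> \<tau> * (?v * s ^ ?D)"
      using that dx \<tau> by (intro mult_left_mono power_mono) auto
    finally show ?thesis .
  qed
  let ?exc = "\<lambda>k. k \<ge> k1 \<and> \<tau> * (?v * r k ^ ?D) < mass H (cball x (r k))"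
  have "\<forall>\<^sub>F k in sequentially. ?exc k"
    using ev eventually_ge_at_top[of k1]
    by eventually_elim (simp add: r_def[symmetric] measure_cball_scale less_imp_le[OF r0])
  then have ex: "\<exists>k. ?exc k" by (auto simp: eventually_sequentially)
  define k where "k = (LEAST k. ?exc k)"
  have k: "?exc k" unfolding k_def using ex by (rule LeastI_ex)
  have least: "\<not> ?exc j" if "j < k" for j using not_less_Least[of j ?exc] that by (simp add: k_def)
  have "k \<ge> k1 + 4"
  proof (rule ccontr)
    assume "\<not> k \<ge> k1 + 4"
    then have "k \<le> k1 + 3" by simp
    then have "r (k1 + 3) \<le> r k" unfolding r_def by (intro power_decreasing) auto
    moreover have "r (k1 + 3) = r k1 / 8" by (simp add: r_def power_add eval_nat_numeral)
    ultimately have "r k \<ge> dx / 32" using k1' by simp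
    then show False using noexc[of "r k"] k by simp
  qed
  then obtain j where j: "k = j + 4" "j \<ge> k1" by (intro that[of "k - 4"]) auto
  have rj: "16 * r k = r j" by (simp add: j r_def power_add eval_nat_numeral)
  have "r j \<le> r k1" unfolding r_def using j by (intro power_decreasing) auto
  then have "32 * r k \<le> dx" using rj k1 by linarith
  moreover have "mass H (cball x (16 * r k)) \<le> \<tau> * (?v * (16 * r k) ^ ?D)"
    using least[of j] j unfolding rj by simp
  ultimately show ?thesis using that[of "r k"] r0 k by blast
qed

text \<open>By Vitali's lemma disjoint stopped balls can be chosen so that their fivefold enlargements cover
  almost all of the superlevel set on the left. The single ball estimates compare masses on the
  enlargements with masses on the balls themselves, so they can be added.\<close>

lemma good_lambda_inequality:
  fixes P Q d :: "'a::euclidean_space \<Rightarrow> real"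
  assumes P: "integrable lborel P" "\<And>y. 0 \<le> P y" and Q: "integrable lborel Q" "\<And>y. 0 \<le> Q y"
    and dm: "d \<in> borel_measurable borel" and d0: "\<And>x. 0 \<le> d x" and d1: "\<And>x. d x \<le> 1"
    and lip: "\<And>x y. d x \<le> d y + dist x y"
    and K: "K > 0" and N: "N > 0" and \<eta>: "\<eta> > 0" and lev: "lev > 0"
    and L: "L \<ge> 2 * K * unit_ball_vol DIM('a) * 2 ^ DIM('a)" "L \<ge> 1"
    and high: "(LINT y|lborel. P y + N * Q y) * 32 ^ DIM('a) \<le> lev * unit_ball_vol DIM('a)"
    and comp: "\<And>x R. 0 < R \<Longrightarrow> R < d x \<Longrightarrow> half_ball_comparison K \<eta> P Q x R"
  shows "mass P {y. P y * d y ^ DIM('a) > L * lev}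
    \<le> 4 * K * (1/N + \<eta>) * 16 ^ DIM('a) *
       (mass P {y. P y * d y ^ DIM('a) > lev / (4 * 2 ^ DIM('a))}
        + N * mass Q {y. N * Q y * d y ^ DIM('a) > lev / (4 * 2 ^ DIM('a))})"
proof -
  let ?D = "DIM('a)" let ?v = "unit_ball_vol DIM('a)"
  have [measurable]: "P \<in> borel_measurable borel" "Q \<in> borel_measurable borel" "d \<in> borel_measurable borel"
    using P Q dm by auto
  have v0: "?v > 0" by simp
  define S where "S = {y. P y * d y ^ ?D > lev / (4 * 2 ^ ?D)}"
  define T where "T = {y. N * Q y * d y ^ ?D > lev / (4 * 2 ^ ?D)}"
  define E where "E = {y. P y * d y ^ ?D > L * lev}"
  define c where "c = 4 * K * (1/N + \<eta>) * 16 ^ ?D"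
  define Z where "Z y = c * (P y * indicator S y + N * Q y * indicator T y)" for y
  have [measurable]: "S \<in> sets borel" "T \<in> sets borel" "E \<in> sets borel" unfolding S_def T_def E_def by measurable
  have c0: "c \<ge> 0" using K N \<eta> by (simp add: c_def)
  have iS: "integrable lborel (\<lambda>y. P y * indicator S y)"
    by (rule integrable_real_mult_indicator) (use P in auto)
  have iT: "integrable lborel (\<lambda>y. N * Q y * indicator T y)"
    by (rule integrable_real_mult_indicator) (use Q in auto)
  have Zi: "integrable lborel Z" unfolding Z_def using iS iT by (intro integrable_mult_right Bochner_Integration.integrable_add)
  have Z0: "0 \<le> Z y" for y unfolding Z_def using c0 P Q N by (intro mult_nonneg_nonneg add_nonneg_nonneg) auto
  have [measurable]: "Z \<in> borel_measurable borel" using Zi by auto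
  define H where "H y = P y + N * Q y" for y
  have Hi: "integrable lborel H" unfolding H_def using P Q by (intro Bochner_Integration.integrable_add integrable_mult_right)
  have H0: "0 \<le> H y" for y using P Q N by (simp add: H_def)
  have Hm: "mass H B = mass P B + N * mass Q B" if "B \<in> sets borel" for B
  proof -
    have "mass H B = mass P B + mass (\<lambda>y. N * Q y) B"
      unfolding H_def using that P Q by (intro set_integral_add(2) set_integrable_borel integrable_mult_right) auto
    then show ?thesis by simp
  qed
  define X where "X = {x \<in> E. \<forall>t. t < P x \<longrightarrow>
    (\<forall>\<^sub>F k in sequentially. t * measure lborel (cball x ((1/2)^k)) < mass P (cball x ((1/2)^k)))}"
  have half: "(\<lambda>k. (1/2::real)^k) \<longlonglongrightarrow> 0" by (intro LIMSEQ_power_zero) simp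
  have EX: "AE x in lborel. x \<in> E \<longrightarrow> x \<in> X"
    using AE_average_ge[OF P _ half] by (auto simp: X_def elim!: eventually_mono)
  have "\<exists>\<rho>. 0 < \<rho> \<and> \<rho> \<le> 1 \<and> mass P (cball x (5*\<rho>) \<inter> E) \<le> mass Z (cball x \<rho>)" if x: "x \<in> X" for x
  proof -
    have xE: "P x * d x ^ ?D > L * lev" using x by (auto simp: X_def E_def)
    have "L * lev > 0" using L lev by simp
    have dx: "d x > 0" 
    proof (rule ccontr)
      assume "\<not> d x > 0"
      then have "d x = 0" using d0[of x] by simp
      then show False using xE \<open>L * lev > 0\<close> by (simp add: power_0_left)
    qed
    define \<tau> where "\<tau> = lev / d x ^ ?D"
    have \<tau>0: "\<tau> > 0" using dx lev by (simp add: \<tau>_def)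
    have "1 * lev \<le> L * lev" using L lev by (intro mult_right_mono) auto
    then have "lev < P x * d x ^ ?D" using xE by linarith
    then have "\<tau> < P x" using dx by (simp add: \<tau>_def divide_less_eq)
    then have evP: "\<forall>\<^sub>F k in sequentially. \<tau> * measure lborel (cball x ((1/2)^k)) < mass P (cball x ((1/2)^k))"
      using x by (auto simp: X_def)
    have ev: "\<forall>\<^sub>F k in sequentially. \<tau> * measure lborel (cball x ((1/2)^k)) < mass H (cball x ((1/2)^k))"
      using evP
    proof eventually_elim
      case (elim k)
      have "mass Q (cball x ((1/2)^k)) \<ge> 0" using Q by (simp add: set_lebesgue_integral_def)
      then have "N * mass Q (cball x ((1/2)^k)) \<ge> 0" using N by simp
      then show ?case using elim by (simp add: Hm)
    qed
    have big: "(LINT y|lborel. H y) \<le> \<tau> * (?v * (d x / 32) ^ ?D)"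
    proof -
      have "\<tau> * (?v * (d x / 32) ^ ?D) = lev * ?v / 32 ^ ?D"
        using dx by (simp add: \<tau>_def power_divide)
      then show ?thesis using high by (simp add: H_def[abs_def] pos_le_divide_eq)
    qed
    obtain \<rho> where \<rho>: "0 < \<rho>" "32 * \<rho> \<le> d x"
      "\<tau> * (?v * \<rho> ^ ?D) < mass H (cball x \<rho>)"
      "mass H (cball x (16 * \<rho>)) \<le> \<tau> * (?v * (16 * \<rho>) ^ ?D)"
      using stopping_radius[OF Hi H0 dx d1 big ev \<tau>0] by blast
    have "16 * \<rho> < d x" using \<rho> by linarith
    then obtain W M where W: "integrable lborel W" "\<And>y. 0 \<le> W y" "M \<ge> 0"
      "AE y in lborel. y \<in> ball x (16*\<rho>/2) \<longrightarrow> P y \<le> W y + M"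
      "M * (16*\<rho>) ^ ?D \<le> K * mass P (cball x (16*\<rho>))"
      "mass W (ball x (16*\<rho>/2)) \<le> K * (mass Q (cball x (16*\<rho>)) + \<eta> * mass P (cball x (16*\<rho>)))"
      using comp[of "16*\<rho>" x] \<rho>(1) unfolding half_ball_comparison_def by auto
    have e8: "16 * \<rho> / 2 = 8 * \<rho>" by simp
    have "mass P (cball x (5*\<rho>) \<inter> E) \<le> mass Z (cball x \<rho>)"
      unfolding E_def Z_def c_def S_def T_def
      by (rule stopped_ball_estimate[OF P Q dm d0 lip K N \<eta> lev \<rho>(1,2) L(1) \<tau>_def _ _ W[unfolded e8]])
        (use \<rho> in \<open>simp_all add: Hm\<close>)
    moreover have "\<rho> \<le> 1" using \<rho> d1[of x] by linarith
    ultimately show ?thesis using \<rho>(1) by blast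
  qed
  then have "\<forall>x\<in>X. \<exists>\<rho>. 0 < \<rho> \<and> \<rho> \<le> 1 \<and> mass P (cball x (5*\<rho>) \<inter> E) \<le> mass Z (cball x \<rho>)"
    by blast
  from bchoice[OF this] obtain \<rho> where
    \<rho>': "\<forall>x\<in>X. 0 < \<rho> x \<and> \<rho> x \<le> 1 \<and> mass P (cball x (5 * \<rho> x) \<inter> E) \<le> mass Z (cball x (\<rho> x))" ..
  then have \<rho>: "\<And>x. x \<in> X \<Longrightarrow> 0 < \<rho> x \<and> \<rho> x \<le> 1"
    "\<And>x. x \<in> X \<Longrightarrow> mass P (cball x (5 * \<rho> x) \<inter> E) \<le> mass Z (cball x (\<rho> x))" by simp_all
  obtain C where C: "countable C" "C \<subseteq> X"
     "pairwise (\<lambda>i j. disjnt (cball i (\<rho> i)) (cball j (\<rho> j))) C"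
     "X \<subseteq> (\<Union>i\<in>C. cball i (5 * \<rho> i))"
  proof -
    assume C': "\<And>C. \<lbrakk>countable C; C \<subseteq> X; pairwise (\<lambda>i j. disjnt (cball i (\<rho> i)) (cball j (\<rho> j))) C;
      X \<subseteq> (\<Union>i\<in>C. cball i (5 * \<rho> i))\<rbrakk> \<Longrightarrow> thesis"
    show thesis
  proof (rule Vitali_covering_lemma_cballs[where S=X and K=X and a="\<lambda>x. x" and r=\<rho> and B=1])
    show "X \<subseteq> (\<Union>i\<in>X. cball i (\<rho> i))"
    proof
      fix x assume "x \<in> X"
      then have "x \<in> cball x (\<rho> x)" using \<rho>(1)[of x] by simp
      then show "x \<in> (\<Union>i\<in>X. cball i (\<rho> i))" using \<open>x \<in> X\<close> by blast
    qed
    show "0 < \<rho> i \<and> \<rho> i \<le> 1" if "i \<in> X" for i using that by (rule \<rho>(1))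
    show thesis if "countable C" "C \<subseteq> X" "pairwise (\<lambda>i j. disjnt (cball i (\<rho> i)) (cball j (\<rho> j))) C"
      "X \<subseteq> (\<Union>i\<in>C. cball i (5 * \<rho> i))" for C
      by (rule C'[OF that])
  qed
  qed
  have U[measurable]: "(\<Union>i\<in>C. cball i (5 * \<rho> i) \<inter> E) \<in> sets borel"
    using C(1) by (intro sets.countable_UN') auto
  have emP: "emeasure (wmeas P) B = ennreal (mass P B)" if "B \<in> sets borel" for B
    using that P by (intro emeasure_wmeas_integral set_integrable_borel) auto
  have emZ: "emeasure (wmeas Z) B = ennreal (mass Z B)" if "B \<in> sets borel" for B
    using that Zi Z0 by (intro emeasure_wmeas_integral set_integrable_borel) auto
  have "emeasure (wmeas P) E \<le> emeasure (wmeas P) (\<Union>i\<in>C. cball i (5 * \<rho> i) \<inter> E)"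
  proof (rule emeasure_mono_AE)
    have "AE x in lborel. x \<in> E \<longrightarrow> x \<in> (\<Union>i\<in>C. cball i (5 * \<rho> i) \<inter> E)"
      using EX by eventually_elim (use C(4) in blast)
    then show "AE x in wmeas P. x \<in> E \<longrightarrow> x \<in> (\<Union>i\<in>C. cball i (5 * \<rho> i) \<inter> E)"
      unfolding wmeas_def by (subst AE_density) (auto elim: eventually_mono)
  qed (use U in simp)
  also have "\<dots> \<le> emeasure (wmeas Z) (\<Union>i\<in>C. cball i (\<rho> i))"
  proof (rule emeasure_UN_mono_disjoint[OF C(1)])
    show "disjoint_family_on (\<lambda>i. cball i (\<rho> i)) C"
      using C(3) by (auto simp: disjoint_family_on_def pairwise_def disjnt_def)
    fix i assume "i \<in> C"
    then have "i \<in> X" using C(2) by blast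
    then show "emeasure (wmeas P) (cball i (5 * \<rho> i) \<inter> E) \<le> emeasure (wmeas Z) (cball i (\<rho> i))"
      using \<rho>(2)[of i] by (simp add: emP emZ ennreal_leI)
  qed auto
  also have "\<dots> \<le> emeasure (wmeas Z) UNIV" by (intro emeasure_mono) auto
  finally have "ennreal (mass P E) \<le> ennreal (mass Z UNIV)" by (simp add: emP emZ)
  then have "mass P E \<le> mass Z UNIV" using Z0 by (simp add: set_lebesgue_integral_def)
  also have "\<dots> = c * ((LINT y|lborel. P y * indicator S y) + (LINT y|lborel. N * Q y * indicator T y))"
    unfolding Z_def by (simp only: set_lebesgue_integral_def indicator_UNIV scaleR_one integral_mult_right_zero)
      (subst Bochner_Integration.integral_add[OF iS iT], rule refl)
  also have "(LINT y|lborel. P y * indicator S y) = mass P S"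
    by (simp add: set_lebesgue_integral_def mult.commute)
  also have "(LINT y|lborel. N * Q y * indicator T y) = N * mass Q T"
    by (simp add: set_lebesgue_integral_def mult.assoc mult.commute[of "Q _"])
  finally show ?thesis unfolding E_def S_def T_def c_def .
qed

text \<open>A geometric sum that stops at the last level below \<open>s\<close> is at most a constant times its last term.\<close>

lemma layer_sum_le:
  fixes \<Lambda> p s l1 :: real
  assumes \<Lambda>: "\<Lambda> > 1" and p: "p > 0" and l1: "l1 \<ge> 1" and s: "s \<ge> 0"
  shows "(\<Sum>j<J. (\<Lambda> powr p) ^ j * (if s > l1 * \<Lambda> ^ j then 1 else 0))
    \<le> \<Lambda> powr p / (\<Lambda> powr p - 1) * s powr p"
proof (induction J)
  case 0
  have "\<Lambda> powr p > 1" using \<Lambda> p by simp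
  then show ?case by (simp add: divide_nonneg_nonneg)
next
  case (Suc J)
  let ?q = "\<Lambda> powr p"
  have q: "?q > 1" using \<Lambda> p by simp
  show ?case
  proof (cases "s > l1 * \<Lambda> ^ J")
    case False
    then show ?thesis using Suc by simp
  next
    case True
    have "(\<Sum>j<Suc J. ?q ^ j * (if s > l1 * \<Lambda> ^ j then 1 else 0)) \<le> (\<Sum>j<Suc J. ?q ^ j)"
      by (intro sum_mono) auto
    also have "\<dots> = (?q ^ Suc J - 1) / (?q - 1)"
      using q by (subst geometric_sum) auto
    also have "\<dots> \<le> ?q ^ Suc J / (?q - 1)" using q by (intro divide_right_mono) auto
    also have "\<dots> = ?q / (?q - 1) * ?q ^ J" by simp
    also have "\<dots> \<le> ?q / (?q - 1) * s powr p"
    proof (intro mult_left_mono)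
      have "1 * \<Lambda> ^ J \<le> l1 * \<Lambda> ^ J" using l1 \<Lambda> by (intro mult_right_mono) auto
      then have "\<Lambda> ^ J \<le> s" using True by linarith
      then have "(\<Lambda> ^ J) powr p \<le> s powr p" using \<Lambda> p by (intro powr_mono2) auto
      moreover have "(\<Lambda> ^ J) powr p = ?q ^ J"
        using \<Lambda> by (simp add: powr_realpow[symmetric] powr_powr mult.commute)
      ultimately show "?q ^ J \<le> s powr p" by simp
    qed (use q in auto)
    finally show ?thesis .
  qed
qed

text \<open>The second alternative picks the last level below \<open>s\<close>, so that \<open>s\<close> is at most the next one.\<close>

lemma powr_le_layer:
  fixes \<Lambda> p s l1 :: real
  assumes \<Lambda>: "\<Lambda> > 1" and p: "p > 0" and l1: "l1 \<ge> 1" and s: "s \<ge> 0"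
  shows "s powr p \<le> l1 powr p * \<Lambda> powr p \<or>
    (\<exists>j. s > l1 * \<Lambda> ^ j \<and> s powr p \<le> l1 powr p * \<Lambda> powr p * (\<Lambda> powr p) ^ j)"
proof -
  have ex: "\<exists>j. s \<le> l1 * \<Lambda> ^ j"
  proof -
    obtain n where "s < \<Lambda> ^ n" using real_arch_pow[OF \<Lambda>] by blast
    moreover have "1 * \<Lambda> ^ n \<le> l1 * \<Lambda> ^ n" using l1 \<Lambda> by (intro mult_right_mono) auto
    ultimately have "s \<le> l1 * \<Lambda> ^ n" by linarith
    then show ?thesis ..
  qed
  define n where "n = (LEAST j. s \<le> l1 * \<Lambda> ^ j)"
  have n: "s \<le> l1 * \<Lambda> ^ n" unfolding n_def using ex by (rule LeastI_ex)
  have pw: "s powr p \<le> l1 powr p * (\<Lambda> powr p) ^ n"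
  proof -
    have "s powr p \<le> (l1 * \<Lambda> ^ n) powr p" using n s p by (intro powr_mono2) auto
    also have "\<dots> = l1 powr p * (\<Lambda> powr p) ^ n"
      using \<Lambda> l1 by (simp add: powr_mult powr_realpow[symmetric] powr_powr mult.commute)
    finally show ?thesis .
  qed
  show ?thesis
  proof (cases n)
    case 0
    have "1 \<le> \<Lambda> powr p" using \<Lambda> p by (simp add: ge_one_powr_ge_zero)
    then have "l1 powr p * 1 \<le> l1 powr p * \<Lambda> powr p" by (intro mult_left_mono) auto
    then show ?thesis using pw 0 by simp
  next
    case (Suc j)
    have "\<not> s \<le> l1 * \<Lambda> ^ j" using not_less_Least[of j "\<lambda>j. s \<le> l1 * \<Lambda> ^ j"] Suc by (simp add: n_def)
    then show ?thesis using pw Suc by (auto simp: mult_ac intro!: exI[of _ j])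
  qed
qed

lemma mass_indicator:
  fixes f :: "'a::euclidean_space \<Rightarrow> real"
  assumes "integrable lborel f" "\<And>y. 0 \<le> f y" "A \<in> sets borel"
  shows "(\<integral>\<^sup>+y. ennreal (f y) * indicator A y \<partial>lborel) = ennreal (mass f A)"
  using emeasure_wmeas[of f A] emeasure_wmeas_integral[of f A] set_integrable_borel[of f A] assms by auto

text \<open>The decay inequality between consecutive levels, summed with weights \<open>\<Lambda>\<^sup>j\<^sup>p\<close>. The partial sums are
  finite, so the half of them that appears on the right can be absorbed.\<close>

lemma level_decay_integrability:
  fixes P Q s t :: "'a::euclidean_space \<Rightarrow> real"
  assumes P: "integrable lborel P" "\<And>y. 0 \<le> P y" and Q: "integrable lborel Q" "\<And>y. 0 \<le> Q y"
    and s[measurable]: "s \<in> borel_measurable borel" "\<And>y. 0 \<le> s y"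
    and t[measurable]: "t \<in> borel_measurable borel" "\<And>y. 0 \<le> t y"
    and \<Lambda>: "\<Lambda> > 1" and p: "p > 0" and \<delta>: "0 \<le> \<delta>" "\<delta> * \<Lambda> powr p \<le> 1/2" and N: "N \<ge> 0"
    and decay: "\<And>l. l \<ge> l0 \<Longrightarrow> mass P {y. s y > \<Lambda> * l} \<le> \<delta> * (mass P {y. s y > l} + N * mass Q {y. t y > l})"
    and Qt: "integrable lborel (\<lambda>y. Q y * t y powr p)"
  shows "integrable lborel (\<lambda>y. P y * s y powr p)"
proof -
  have [measurable]: "P \<in> borel_measurable borel" "Q \<in> borel_measurable borel" using P Q by auto
  define q where "q = \<Lambda> powr p"
  have q: "q > 1" using \<Lambda> p by (simp add: q_def)
  define l1 where "l1 = max 1 l0"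
  have l1: "l1 \<ge> 1" "l1 \<ge> l0" by (auto simp: l1_def)
  define a where "a j = mass P {y. s y > l1 * \<Lambda> ^ j}" for j
  define c where "c j = mass Q {y. t y > l1 * \<Lambda> ^ j}" for j
  have a0: "a j \<ge> 0" for j using P(2) by (simp add: a_def set_lebesgue_integral_def)
  have c0: "c j \<ge> 0" for j using Q(2) by (simp add: c_def set_lebesgue_integral_def)
  have step: "a (Suc j) \<le> \<delta> * (a j + N * c j)" for j
  proof -
    have "1 \<le> \<Lambda> ^ j" using \<Lambda> by (intro one_le_power) auto
    then have "l1 * 1 \<le> l1 * \<Lambda> ^ j" using l1 by (intro mult_left_mono) auto
    then have "l1 * \<Lambda> ^ j \<ge> l0" using l1 by linarith
    from decay[OF this] show ?thesis by (simp add: a_def c_def mult_ac)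
  qed
  define C where "C = q / (q - 1) * (LINT y|lborel. Q y * t y powr p)"
  have csum: "(\<Sum>j<J. q ^ j * c j) \<le> C" for J
  proof -
    have ii: "integrable lborel (\<lambda>y. Q y * (if t y > l1 * \<Lambda> ^ j then 1 else 0))" for j
    proof -
      have "integrable lborel (\<lambda>y. Q y * indicator {y. t y > l1 * \<Lambda> ^ j} y)"
        by (rule integrable_real_mult_indicator) (use Q in auto)
      then show ?thesis by (simp add: indicator_def of_bool_def)
    qed
    have "(\<Sum>j<J. q ^ j * c j) = (\<Sum>j<J. LINT y|lborel. q ^ j * (Q y * (if t y > l1 * \<Lambda> ^ j then 1 else 0)))"
      by (intro sum.cong refl) (simp add: c_def set_lebesgue_integral_def indicator_def of_bool_def mult.commute)
    also have "\<dots> = (LINT y|lborel. (\<Sum>j<J. q ^ j * (Q y * (if t y > l1 * \<Lambda> ^ j then 1 else 0))))"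
      using ii by (subst Bochner_Integration.integral_sum) auto
    also have "\<dots> \<le> (LINT y|lborel. q / (q - 1) * (Q y * t y powr p))"
    proof (rule integral_mono)
      fix y
      have "(\<Sum>j<J. q ^ j * (Q y * (if t y > l1 * \<Lambda> ^ j then 1 else 0)))
          = Q y * (\<Sum>j<J. q ^ j * (if t y > l1 * \<Lambda> ^ j then 1 else 0))"
        by (simp add: sum_distrib_left mult_ac)
      also have "\<dots> \<le> Q y * (q / (q - 1) * t y powr p)"
        unfolding q_def by (intro mult_left_mono layer_sum_le \<Lambda> p l1 t Q)
      finally show "(\<Sum>j<J. q ^ j * (Q y * (if t y > l1 * \<Lambda> ^ j then 1 else 0))) \<le> q / (q - 1) * (Q y * t y powr p)"
        by (simp add: mult_ac)
    qed (use ii Qt in auto)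
    finally show ?thesis by (simp add: C_def)
  qed
  have asum: "(\<Sum>j<J. q ^ j * a j) \<le> 2 * a 0 + N * C" for J
  proof -
    define \<Phi> where "\<Phi> = (\<Sum>j<Suc J. q ^ j * a j)"
    have "\<Phi> = a 0 + (\<Sum>j<J. q ^ Suc j * a (Suc j))"
      unfolding \<Phi>_def by (subst sum.lessThan_Suc_shift) simp
    also have "\<dots> \<le> a 0 + (\<Sum>j<J. q ^ Suc j * (\<delta> * (a j + N * c j)))"
      using q by (intro add_left_mono sum_mono mult_left_mono step) auto
    also have "(\<Sum>j<J. q ^ Suc j * (\<delta> * (a j + N * c j))) = (\<delta> * q) * ((\<Sum>j<J. q ^ j * a j) + N * (\<Sum>j<J. q ^ j * c j))"
      by (simp add: sum_distrib_left sum.distrib algebra_simps)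
    also have "\<dots> \<le> (1/2) * (\<Phi> + N * C)"
    proof (rule mult_mono)
      show "\<delta> * q \<le> 1/2" using \<delta> by (simp add: q_def)
      have "(\<Sum>j<J. q ^ j * a j) \<le> \<Phi>" using q a0 by (simp add: \<Phi>_def)
      then show "(\<Sum>j<J. q ^ j * a j) + N * (\<Sum>j<J. q ^ j * c j) \<le> \<Phi> + N * C"
        by (rule add_mono) (rule mult_left_mono[OF csum N])
      show "0 \<le> (\<Sum>j<J. q ^ j * a j) + N * (\<Sum>j<J. q ^ j * c j)"
        using q a0 c0 N by (intro add_nonneg_nonneg mult_nonneg_nonneg sum_nonneg) auto
    qed auto
    finally have "\<Phi> \<le> 2 * a 0 + N * C" by (simp add: field_simps)
    moreover have "(\<Sum>j<J. q ^ j * a j) \<le> \<Phi>" using q a0 by (simp add: \<Phi>_def)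
    ultimately show ?thesis by linarith
  qed
  have bnd: "(\<Sum>j. ennreal (q ^ j * a j)) \<le> ennreal (2 * a 0 + N * C)"
  proof -
    have "(\<Sum>j<J. ennreal (q ^ j * a j)) \<le> ennreal (2 * a 0 + N * C)" for J
      using asum[of J] q a0 by (subst sum_ennreal) (auto intro!: ennreal_leI)
    then show ?thesis unfolding suminf_eq_SUP by (intro SUP_least)
  qed
  define K1 where "K1 = l1 powr p * q"
  have K1: "K1 \<ge> 0" using q by (simp add: K1_def)
  have "(\<integral>\<^sup>+y. ennreal (P y * s y powr p) \<partial>lborel)
    \<le> (\<integral>\<^sup>+y. ennreal K1 * (ennreal (P y) + (\<Sum>j. ennreal (q ^ j) * (ennreal (P y) * indicator {y. s y > l1 * \<Lambda> ^ j} y))) \<partial>lborel)"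
  proof (rule nn_integral_mono)
    fix y
    let ?f = "\<lambda>j. ennreal (q ^ j) * (ennreal (P y) * indicator {y. s y > l1 * \<Lambda> ^ j} y)"
    consider "s y powr p \<le> K1" | j where "s y > l1 * \<Lambda> ^ j" "s y powr p \<le> K1 * q ^ j"
      using powr_le_layer[OF \<Lambda> p l1(1), of "s y"] s(2)[of y] by (auto simp: K1_def q_def)
    then show "ennreal (P y * s y powr p) \<le> ennreal K1 * (ennreal (P y) + (\<Sum>j. ?f j))"
    proof cases
      case 1
      then have "ennreal (P y * s y powr p) \<le> ennreal (K1 * P y)"
        using mult_left_mono[OF 1 P(2)[of y]] by (intro ennreal_leI) (simp add: mult.commute)
      also have "\<dots> = ennreal K1 * ennreal (P y)" using K1 by (simp add: ennreal_mult')
      also have "\<dots> \<le> ennreal K1 * (ennreal (P y) + (\<Sum>j. ?f j))" by (intro mult_left_mono) auto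
      finally show ?thesis .
    next
      case (2 j)
      have "P y * s y powr p \<le> P y * (K1 * q ^ j)" using 2 P(2) by (intro mult_left_mono)
      then have "ennreal (P y * s y powr p) \<le> ennreal (K1 * (q ^ j * P y))"
        by (intro ennreal_leI) (simp add: mult_ac)
      also have "\<dots> = ennreal K1 * ?f j" using K1 q 2 P(2) by (simp add: ennreal_mult)
      also have "\<dots> \<le> ennreal K1 * (\<Sum>j. ?f j)"
        using sum_le_suminf[of ?f "{j}"] by (intro mult_left_mono) auto
      also have "\<dots> \<le> ennreal K1 * (ennreal (P y) + (\<Sum>j. ?f j))" by (intro mult_left_mono) auto
      finally show ?thesis .
    qed
  qed
  also have "\<dots> = ennreal K1 * ((\<integral>\<^sup>+y. ennreal (P y) \<partial>lborel) +
      (\<integral>\<^sup>+y. (\<Sum>j. ennreal (q ^ j) * (ennreal (P y) * indicator {y. s y > l1 * \<Lambda> ^ j} y)) \<partial>lborel))"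
    by (subst nn_integral_cmult, measurable) (subst nn_integral_add, auto)
  also have "(\<integral>\<^sup>+y. (\<Sum>j. ennreal (q ^ j) * (ennreal (P y) * indicator {y. s y > l1 * \<Lambda> ^ j} y)) \<partial>lborel)
      = (\<Sum>j. \<integral>\<^sup>+y. ennreal (q ^ j) * (ennreal (P y) * indicator {y. s y > l1 * \<Lambda> ^ j} y) \<partial>lborel)"
    by (rule nn_integral_suminf) measurable
  also have "\<dots> = (\<Sum>j. ennreal (q ^ j * a j))"
  proof (intro arg_cong[where f=suminf] ext)
    fix j
    have "(\<integral>\<^sup>+y. ennreal (q ^ j) * (ennreal (P y) * indicator {y. s y > l1 * \<Lambda> ^ j} y) \<partial>lborel)
      = ennreal (q ^ j) * (\<integral>\<^sup>+y. ennreal (P y) * indicator {y. s y > l1 * \<Lambda> ^ j} y \<partial>lborel)"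
      by (rule nn_integral_cmult) measurable
    also have "(\<integral>\<^sup>+y. ennreal (P y) * indicator {y. s y > l1 * \<Lambda> ^ j} y \<partial>lborel) = ennreal (a j)"
      unfolding a_def by (rule mass_indicator[OF P]) measurable
    finally show "(\<integral>\<^sup>+y. ennreal (q ^ j) * (ennreal (P y) * indicator {y. s y > l1 * \<Lambda> ^ j} y) \<partial>lborel) = ennreal (q ^ j * a j)"
      using q by (simp add: ennreal_mult')
  qed
  also have "(\<integral>\<^sup>+y. ennreal (P y) \<partial>lborel) = ennreal (LINT y|lborel. P y)"
    by (rule nn_integral_eq_integral) (use P in auto)
  also have "ennreal K1 * (ennreal (LINT y|lborel. P y) + (\<Sum>j. ennreal (q ^ j * a j)))
      \<le> ennreal K1 * (ennreal (LINT y|lborel. P y) + ennreal (2 * a 0 + N * C))"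
    by (intro mult_left_mono add_left_mono bnd) auto
  also have "\<dots> < \<infinity>" by (simp add: ennreal_mult_less_top)
  finally show ?thesis using P(2) by (intro integrableI_nonneg) auto
qed

text \<open>The constant \<open>K\<close> of the comparison must not depend on \<open>\<eta>\<close>: the ratio \<open>\<Lambda>\<close> of consecutive levels
  is fixed by \<open>K\<close>, and \<open>\<eta>\<close> is chosen afterwards, small against \<open>\<Lambda>\<^sup>-\<^sup>p\<close>. Weighted by a power of
  the truncated distance to the complement, the means over balls of comparable radius are bounded by
  a single constant, which serves as the lowest level in all of \<open>\<Omega>\<close>.\<close>

theorem self_improving_integrability:
  fixes P Q :: "'a::euclidean_space \<Rightarrow> real"
  assumes P: "integrable lborel P" "\<And>y. 0 \<le> P y" and Q: "integrable lborel Q" "\<And>y. 0 \<le> Q y"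
    and \<Omega>: "\<Omega> \<noteq> UNIV" and p: "p > 0" and K: "K > 0"
    and Qp: "integrable lborel (\<lambda>y. Q y powr (1 + p))"
    and comp: "\<And>\<eta>. \<eta> > 0 \<Longrightarrow> \<exists>R0>0. \<forall>x R. 0 < R \<and> R < R0 \<and> cball x R \<subseteq> \<Omega> \<longrightarrow>
      half_ball_comparison K \<eta> P Q x R"
  obtains R0 where "R0 > 0" "integrable lborel (\<lambda>y. P y * (P y * (min R0 (infdist y (- \<Omega>))) ^ DIM('a)) powr p)"
proof -
  let ?D = "DIM('a)" let ?v = "unit_ball_vol DIM('a)"
  have v0: "?v > 0" by simp
  define L where "L = 1 + 2 * K * ?v * 2 ^ ?D"
  have L: "L \<ge> 2 * K * ?v * 2 ^ ?D" "L \<ge> 1" using K v0 by (auto simp: L_def)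
  define b where "b = 4 * (2::real) ^ ?D"
  have b: "b > 1"
  proof -
    have "1 \<le> (2::real) ^ ?D" by (rule one_le_power) simp
    then show ?thesis unfolding b_def by linarith
  qed
  define \<Lambda> where "\<Lambda> = L * b"
  have \<Lambda>: "\<Lambda> > 1"
  proof -
    have "1 * b \<le> L * b" using L b by (intro mult_right_mono) auto
    then show ?thesis using b unfolding \<Lambda>_def by linarith
  qed
  \<comment> \<open>Taking \<open>\<eta> = 1/N = \<kappa>\<close> makes the factor in the decay inequality times \<open>\<Lambda>\<^sup>p\<close> equal to one half.\<close>
  define \<kappa> where "\<kappa> = 1 / (16 * K * 16 ^ ?D * \<Lambda> powr p)"
  have \<kappa>: "\<kappa> > 0" using K \<Lambda> by (simp add: \<kappa>_def)
  define N where "N = 1 / \<kappa>"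
  have N: "N > 0" "1 / N = \<kappa>" using \<kappa> by (auto simp: N_def)
  define \<delta> where "\<delta> = 4 * K * (1/N + \<kappa>) * 16 ^ ?D"
  have \<delta>0: "\<delta> \<ge> 0" using K \<kappa> N by (simp add: \<delta>_def)
  have \<delta>: "\<delta> * \<Lambda> powr p \<le> 1/2"
    using K \<Lambda> unfolding \<delta>_def N(2) by (simp add: \<kappa>_def field_simps)
  obtain R1 where R1: "R1 > 0" and comp1: "\<And>x R. 0 < R \<Longrightarrow> R < R1 \<Longrightarrow> cball x R \<subseteq> \<Omega> \<Longrightarrow>
      half_ball_comparison K \<kappa> P Q x R"
    using comp[OF \<kappa>] by blast
  define R0 where "R0 = min R1 1"
  have R0: "R0 > 0" "R0 \<le> 1" "R0 \<le> R1" using R1 by (auto simp: R0_def)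
  define d where "d y = min R0 (infdist y (- \<Omega>))" for y
  have ne: "- \<Omega> \<noteq> {}" using \<Omega> by auto
  have d0: "0 \<le> d y" for y using R0 by (simp add: d_def infdist_nonneg)
  have d1: "d y \<le> 1" for y using R0 by (simp add: d_def)
  have lip: "d x \<le> d y + dist x y" for x y
    using infdist_triangle[of x "- \<Omega>" y] zero_le_dist[of x y] unfolding d_def by linarith
  have dm[measurable]: "d \<in> borel_measurable borel"
    unfolding d_def by (intro borel_measurable_continuous_onI continuous_intros)
  have Pm[measurable]: "P \<in> borel_measurable borel" and Qm[measurable]: "Q \<in> borel_measurable borel" using P Q by auto
  have cm: "half_ball_comparison K \<kappa> P Q x R"
    if R: "0 < R" "R < d x" for x R
  proof (rule comp1[OF R(1)])
    show "R < R1" using R R0 by (simp add: d_def)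
    show "cball x R \<subseteq> \<Omega>"
    proof
      fix y assume y: "y \<in> cball x R"
      show "y \<in> \<Omega>"
      proof (rule ccontr)
        assume "y \<notin> \<Omega>"
        then have "infdist x (- \<Omega>) \<le> dist x y" by (intro infdist_le) auto
        then show False using y R by (simp add: d_def)
      qed
    qed
  qed
  define l0 where "l0 = max 1 ((LINT y|lborel. P y + N * Q y) * 32 ^ ?D / ?v)"
  have decay: "mass P {y. P y * d y ^ ?D > \<Lambda> * l} \<le> \<delta> * (mass P {y. P y * d y ^ ?D > l} + N * mass Q {y. N * Q y * d y ^ ?D > l})"
    if l: "l \<ge> l0" for l
  proof -
    have l1: "l \<ge> 1" and l2: "(LINT y|lborel. P y + N * Q y) * 32 ^ ?D / ?v \<le> l"
      using l by (auto simp: l0_def)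
    have bl: "b * l > 0" using b l1 by simp
    have "1 * l \<le> b * l" using b l1 by (intro mult_right_mono) auto
    then have "(LINT y|lborel. P y + N * Q y) * 32 ^ ?D / ?v \<le> b * l" using l2 by linarith
    then have high: "(LINT y|lborel. P y + N * Q y) * 32 ^ ?D \<le> b * l * ?v"
      using v0 by (simp add: pos_divide_le_eq)
    have e: "b * l / (4 * 2 ^ ?D) = l" using b by (simp add: b_def)
    show ?thesis
      using good_lambda_inequality[OF P Q dm d0 d1 lip K N(1) \<kappa> bl L high cm]
      unfolding e by (simp add: \<Lambda>_def \<delta>_def mult.assoc)
  qed
  have "integrable lborel (\<lambda>y. P y * (P y * d y ^ ?D) powr p)"
  proof (rule level_decay_integrability[OF P Q _ _ _ _ \<Lambda> p \<delta>0 \<delta> less_imp_le[OF N(1)] decay])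
    show "integrable lborel (\<lambda>y. Q y * (N * Q y * d y ^ ?D) powr p)"
    proof (rule Bochner_Integration.integrable_bound)
      show "integrable lborel (\<lambda>y. N powr p * Q y powr (1 + p))" using Qp by simp
      show "AE y in lborel. norm (Q y * (N * Q y * d y ^ ?D) powr p) \<le> norm (N powr p * Q y powr (1 + p))"
      proof (rule AE_I2)
        fix y
        have "d y ^ ?D \<le> 1" using d0 d1 by (intro power_le_one) auto
        then have "N * Q y * d y ^ ?D \<le> N * Q y * 1" using N Q(2) by (intro mult_left_mono) auto
        then have "(N * Q y * d y ^ ?D) powr p \<le> (N * Q y) powr p"
          using N Q(2) d0 p by (intro powr_mono2) auto
        also have "\<dots> = N powr p * Q y powr p" using N Q(2) by (simp add: powr_mult)
        finally have "Q y * (N * Q y * d y ^ ?D) powr p \<le> Q y * (N powr p * Q y powr p)"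
          using Q(2) by (intro mult_left_mono) auto
        also have "\<dots> = N powr p * Q y powr (1 + p)"
        proof (cases "Q y = 0")
          case False
          then have "Q y > 0" using Q(2)[of y] by simp
          then show ?thesis by (simp add: powr_add mult_ac)
        qed simp
        finally show "norm (Q y * (N * Q y * d y ^ ?D) powr p) \<le> norm (N powr p * Q y powr (1 + p))"
          using Q(2)[of y] by simp
      qed
    qed measurable
  qed (use P Q N d0 in \<open>auto intro!: borel_measurable_times borel_measurable_power\<close>)
  then show ?thesis using that[OF R0(1)] by (simp add: d_def)
qed

section \<open>Comparison with a weakly harmonic field on a ball\<close>

lemma grad_add:
  assumes "smooth \<phi>" "smooth \<psi>"
  shows "grad (\<lambda>x. \<phi> x + \<psi> x) = (\<lambda>x. grad \<phi> x + grad \<psi> x)"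
  unfolding grad_eq[abs_def] pd_add[OF smooth_differentiable[OF assms(1)] smooth_differentiable[OF assms(2)]]
  by (simp add: scaleR_left_distrib sum.distrib)

lemma grad_cmult:
  assumes "smooth \<phi>"
  shows "grad (\<lambda>x. c * \<phi> x) = (\<lambda>x. c *\<^sub>R grad \<phi> x)"
  unfolding grad_eq[abs_def] pd_mult[OF smooth_differentiable[OF smooth_const] smooth_differentiable[OF assms]]
  by (simp add: pd_const scaleR_sum_right)

lemma sqi_test_function:
  assumes "\<phi> \<in> test_functions U"
  shows "sqi lborel \<phi>"
proof -
  have s: "smooth \<phi>" using test_functionsD(1)[OF assms] .
  have "integrable lborel (\<lambda>x. \<phi> x * \<phi> x)"
    by (rule test_functions_integrable[OF test_functions_mult[OF assms s]])
  then show ?thesis using smooth_borel[OF s] by (simp add: sqi_def power2_eq_square)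
qed

lemma sqi_grad:
  assumes "\<phi> \<in> test_functions U"
  shows "sqi lborel (grad \<phi>)"
proof -
  have p: "sqi lborel (pd i \<phi>)" if "i \<in> Basis" for i
    by (rule sqi_test_function[OF test_functions_pd[OF assms that]])
  have m: "pd i \<phi> \<in> borel_measurable borel" if "i \<in> Basis" for i using p[OF that] by (simp add: sqi_def)
  have "(norm (grad \<phi> x))\<^sup>2 = (\<Sum>i\<in>Basis. (norm (pd i \<phi> x))\<^sup>2)" for x
    by (subst power2_norm_eq_inner, subst euclidean_inner) (simp add: grad_inner power2_eq_square)
  moreover have "integrable lborel (\<lambda>x. \<Sum>i\<in>Basis. (norm (pd i \<phi> x))\<^sup>2)"
    using p by (intro Bochner_Integration.integrable_sum) (simp add: sqi_def)
  moreover have "grad \<phi> \<in> borel_measurable borel"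
    unfolding grad_eq[abs_def] by (intro borel_measurable_sum borel_measurable_scaleR m borel_measurable_const)
  ultimately show ?thesis by (simp add: sqi_def)
qed

lemma sqi_test_function_scaleR:
  fixes v :: "'b::euclidean_space"
  assumes "\<phi> \<in> test_functions U"
  shows "sqi lborel (\<lambda>x. \<phi> x *\<^sub>R v)"
  by (rule sqi_bound[OF sqi_test_function[OF assms], where C="norm v"])
    (use smooth_borel[OF test_functionsD(1)[OF assms]] in \<open>auto simp: mult.commute\<close>)

lemma grad_outside:
  assumes "\<phi> \<in> test_functions U" "y \<notin> U"
  shows "grad \<phi> y = 0"
  using test_functions_outside[OF test_functions_pd[OF assms(1)] assms(2)] by (simp add: grad_eq)

lemma test_functions_lapl:
  assumes "\<phi> \<in> test_functions U"
  shows "lapl \<phi> \<in> test_functions U"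
  unfolding lapl_def[abs_def]
  by (intro test_functions_sum test_functions_pd assms finite_Basis)

lemma pd_sum:
  assumes "finite I" "\<And>j. j \<in> I \<Longrightarrow> smooth (f j)"
  shows "pd i (\<lambda>x. \<Sum>j\<in>I. f j x) = (\<lambda>x. \<Sum>j\<in>I. pd i (f j) x)"
  using assms
proof (induction I rule: finite_induct)
  case empty
  then show ?case by (simp add: pd_const)
next
  case (insert j I)
  have s: "smooth (\<lambda>x. \<Sum>j\<in>I. f j x)" using insert by (intro smooth_sum) auto
  show ?case
    using insert pd_add[OF smooth_differentiable smooth_differentiable[OF s], of "f j" i] by simp
qed

lemma pd_lapl:
  assumes s: "smooth \<phi>" and i: "i \<in> Basis"
  shows "pd i (lapl \<phi>) x = (\<Sum>j\<in>Basis. pd j (pd j (pd i \<phi>)) x)"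
proof -
  have "pd i (lapl \<phi>) x = (\<Sum>j\<in>Basis. pd i (pd j (pd j \<phi>)) x)"
    unfolding lapl_def[abs_def] by (subst pd_sum) (auto intro!: smooth_pd s)
  also have "\<dots> = (\<Sum>j\<in>Basis. pd j (pd j (pd i \<phi>)) x)"
  proof (rule sum.cong[OF refl])
    fix j :: 'a assume j: "j \<in> Basis"
    have "pd i (pd j (pd j \<phi>)) = pd j (pd i (pd j \<phi>))" by (rule pd_commute[OF smooth_pd[OF s j] i j])
    also have "pd i (pd j \<phi>) = pd j (pd i \<phi>)" by (rule pd_commute[OF s i j])
    finally show "pd i (pd j (pd j \<phi>)) x = pd j (pd j (pd i \<phi>)) x" by simp
  qed
  finally show ?thesis .
qed

text \<open>That a field is curl free, expressed without derivatives of it: the test field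
  \<open>(\<Delta>\<phi>) e\<^sub>i - \<nabla>\<partial>\<^sub>i\<phi>\<close> is divergence free because partial derivatives commute, so integrating by
  parts against a weak gradient leaves nothing. The identity passes to limits in mean square.\<close>

lemma weak_gradient_identity:
  fixes u :: "'a::euclidean_space \<Rightarrow> real" and Du :: "'a \<Rightarrow> 'a"
  assumes u: "sqi lborel u" and Du: "sqi lborel Du"
    and weak: "\<And>\<phi> i. \<phi> \<in> test_functions U \<Longrightarrow> i \<in> Basis \<Longrightarrow>
      (LINT x|lborel. u x * pd i \<phi> x) = - (LINT x|lborel. (Du x \<bullet> i) * \<phi> x)"
    and \<phi>: "\<phi> \<in> test_functions U" and i: "i \<in> Basis"
  shows "(LINT x|lborel. Du x \<bullet> (lapl \<phi> x *\<^sub>R i - grad (pd i \<phi>) x)) = 0"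
proof -
  have s: "smooth \<phi>" using test_functionsD(1)[OF \<phi>] .
  have t: "pd j (pd i \<phi>) \<in> test_functions U" if "j \<in> Basis" for j
    by (intro test_functions_pd \<phi> i that)
  have up: "integrable lborel (\<lambda>x. u x * \<psi> x)" if "\<psi> \<in> test_functions U" for \<psi>
    using sqi_inner_integrable[OF u sqi_test_function[OF that]] by simp
  have Dup: "integrable lborel (\<lambda>x. (Du x \<bullet> j) * \<psi> x)" if "\<psi> \<in> test_functions U" "j \<in> Basis" for \<psi> j
    using sqi_inner_integrable[OF Du sqi_test_function_scaleR[OF that(1), of j]] by (simp add: mult.commute)
  have "(LINT x|lborel. (Du x \<bullet> i) * lapl \<phi> x) = - (LINT x|lborel. u x * pd i (lapl \<phi>) x)"
    using weak[OF test_functions_lapl[OF \<phi>] i] by simp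
  also have "(LINT x|lborel. u x * pd i (lapl \<phi>) x) = (LINT x|lborel. (\<Sum>j\<in>Basis. u x * pd j (pd j (pd i \<phi>)) x))"
    by (simp only: pd_lapl[OF s i] sum_distrib_left)
  also have "\<dots> = (\<Sum>j\<in>Basis. (LINT x|lborel. u x * pd j (pd j (pd i \<phi>)) x))"
    by (intro Bochner_Integration.integral_sum up test_functions_pd t)
  also have "\<dots> = (\<Sum>j\<in>Basis. - (LINT x|lborel. (Du x \<bullet> j) * pd j (pd i \<phi>) x))"
    by (intro sum.cong refl weak t)
  also have "\<dots> = - (\<Sum>j\<in>Basis. (LINT x|lborel. (Du x \<bullet> j) * pd j (pd i \<phi>) x))" by (rule sum_negf)
  also have "(\<Sum>j\<in>Basis. (LINT x|lborel. (Du x \<bullet> j) * pd j (pd i \<phi>) x))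
      = (LINT x|lborel. (\<Sum>j\<in>Basis. (Du x \<bullet> j) * pd j (pd i \<phi>) x))"
    by (intro Bochner_Integration.integral_sum[symmetric] Dup t)
  also have "\<dots> = (LINT x|lborel. Du x \<bullet> grad (pd i \<phi>) x)"
    by (intro Bochner_Integration.integral_cong refl) (subst euclidean_inner, simp add: grad_inner)
  finally have "(LINT x|lborel. (Du x \<bullet> i) * lapl \<phi> x) = (LINT x|lborel. Du x \<bullet> grad (pd i \<phi>) x)" by simp
  moreover have "Du x \<bullet> (lapl \<phi> x *\<^sub>R i - grad (pd i \<phi>) x) = (Du x \<bullet> i) * lapl \<phi> x - Du x \<bullet> grad (pd i \<phi>) x" for x
    by (simp add: inner_diff_right mult.commute)
  ultimately show ?thesis
    using Dup[OF test_functions_lapl[OF \<phi>] i] sqi_inner_integrable[OF Du sqi_grad[OF test_functions_pd[OF \<phi> i]]]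
    by simp
qed

text \<open>Adding the two hypotheses gives \<open>\<integral> h\<^sub>i \<Delta>\<phi> = 0\<close>, so the components of \<open>h\<close> are weakly harmonic and obey the
  interior estimate at scale \<open>R/2\<close>. The Cauchy-Schwarz inequality on the ball replaces the integral of
  \<open>\<bar>h\<^sub>i\<bar>\<close> in it by that of \<open>\<bar>h\<bar>\<^sup>2\<close>; this is where the explicit constant comes from.\<close>

lemma orthogonal_part_bound:
  fixes h :: "'a::euclidean_space \<Rightarrow> 'a"
  assumes h: "sqi lborel h" and R: "R > 0"
    and orth: "\<And>\<phi> i. \<phi> \<in> test_functions (ball x0 R) \<Longrightarrow> i \<in> Basis \<Longrightarrow> (LINT x|lborel. h x \<bullet> grad (pd i \<phi>) x) = 0"
    and curl: "\<And>\<phi> i. \<phi> \<in> test_functions (ball x0 R) \<Longrightarrow> i \<in> Basis \<Longrightarrow>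
      (LINT x|lborel. h x \<bullet> (lapl \<phi> x *\<^sub>R i - grad (pd i \<phi>) x)) = 0"
  shows "AE y in lborel. y \<in> ball x0 (R/2) \<longrightarrow> (norm (h y))\<^sup>2 * R ^ DIM('a) \<le>
    DIM('a) * ((24 * 8 ^ DIM('a) * exp 2 / unit_ball_vol DIM('a))\<^sup>2 * unit_ball_vol DIM('a)) * (LINT x|lborel. (norm (h x))\<^sup>2)"
proof -
  let ?D = "DIM('a)" let ?v = "unit_ball_vol DIM('a)" let ?B = "ball x0 R"
  define S where "S = (LINT x|lborel. (norm (h x))\<^sup>2)"
  have S0: "S \<ge> 0" by (simp add: S_def)
  have v0: "?v > 0" by simp
  define c where "c = 24 * 8 ^ ?D * exp 2 / ?v"
  have hm[measurable]: "h \<in> borel_measurable borel" using h by (simp add: sqi_def)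
  define k where "k i y = indicator ?B y * (h y \<bullet> i)" for i y
  have ind2: "(norm (indicator ?B y :: real))\<^sup>2 = indicator ?B y" for y by (simp add: indicator_def)
  have i1: "sqi lborel (indicator ?B :: 'a \<Rightarrow> real)"
    using emeasure_lborel_ball_finite[of x0 R] unfolding sqi_def ind2
    by (intro conjI integrable_real_indicator borel_measurable_indicator) auto
  have hi: "sqi lborel (\<lambda>y. \<bar>h y \<bullet> i\<bar>)" if "i \<in> Basis" for i
    by (rule sqi_bound[OF h, where C=1]) (use Basis_le_norm[OF that] in auto)
  have kabs: "\<bar>k i y\<bar> = indicator ?B y \<bullet> \<bar>h y \<bullet> i\<bar>" for i y by (simp add: k_def indicator_def)
  have km[measurable]: "k i \<in> borel_measurable borel" for i
    unfolding k_def[abs_def] by (intro borel_measurable_times borel_measurable_indicator borel_measurable_inner hm borel_measurable_const) auto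
  have ki: "integrable lborel (k i)" if "i \<in> Basis" for i
  proof -
    have "integrable lborel (\<lambda>y. \<bar>k i y\<bar>)" unfolding kabs by (rule sqi_inner_integrable[OF i1 hi[OF that]])
    then show ?thesis by (subst (asm) integrable_abs_iff) auto
  qed
  have kint: "(LINT y|lborel. \<bar>k i y\<bar>)\<^sup>2 \<le> ?v * R ^ ?D * S" if i: "i \<in> Basis" for i
  proof -
    have "(LINT y|lborel. \<bar>k i y\<bar>)\<^sup>2 \<le> (LINT y|lborel. (norm (indicator ?B y :: real))\<^sup>2) * (LINT y|lborel. (norm \<bar>h y \<bullet> i\<bar>)\<^sup>2)"
      unfolding kabs by (rule L2_Cauchy_Schwarz[OF i1 hi[OF i]])
    also have "(LINT y|lborel. (norm (indicator ?B y :: real))\<^sup>2) = measure lborel ?B"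
      unfolding ind2 by simp
    also have "measure lborel ?B = ?v * R ^ ?D" using R by (simp add: content_ball)
    also have "(LINT y|lborel. (norm \<bar>h y \<bullet> i\<bar>)\<^sup>2) \<le> S"
      unfolding S_def
    proof (rule integral_mono)
      show "(norm \<bar>h y \<bullet> i\<bar>)\<^sup>2 \<le> (norm (h y))\<^sup>2" for y using Basis_le_norm[OF i, of "h y"] by (intro power_mono) auto
    qed (use sqi_integrable[OF hi[OF i]] sqi_integrable[OF h] in auto)
    finally show ?thesis using v0 R by (simp add: mult_left_mono)
  qed
  have harm: "(LINT y|lborel. k i y * lapl (bump x \<rho>) y) = 0"
    if x: "x \<in> ball x0 (R/2)" and \<rho>: "0 < \<rho>" "\<rho> < R / 2" and i: "i \<in> Basis" for x \<rho> i
  proof -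
    have sub: "cball x \<rho> \<subseteq> ?B"
    proof
      fix y assume "y \<in> cball x \<rho>"
      then show "y \<in> ?B" using x \<rho> dist_triangle[of x0 y x] by auto
    qed
    have t: "bump x \<rho> \<in> test_functions ?B" by (rule bump_test_function[OF \<rho>(1) sub])
    let ?\<phi> = "bump x \<rho>"
    have tl: "lapl ?\<phi> \<in> test_functions ?B" by (rule test_functions_lapl[OF t])
    have X: "sqi lborel (grad (pd i ?\<phi>))" by (rule sqi_grad[OF test_functions_pd[OF t i]])
    note L = sqi_test_function_scaleR[OF tl, of i]
    have "(LINT y|lborel. k i y * lapl ?\<phi> y) = (LINT y|lborel. h y \<bullet> (lapl ?\<phi> y *\<^sub>R i))"
    proof (intro Bochner_Integration.integral_cong refl)
      fix y show "k i y * lapl ?\<phi> y = h y \<bullet> (lapl ?\<phi> y *\<^sub>R i)"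
      proof (cases "y \<in> ?B")
        case True
        then show ?thesis by (simp add: k_def)
      next
        case False
        then show ?thesis using test_functions_outside[OF tl] by simp
      qed
    qed
    also have "\<dots> = (LINT y|lborel. h y \<bullet> (lapl ?\<phi> y *\<^sub>R i - grad (pd i ?\<phi>) y)) + (LINT y|lborel. h y \<bullet> grad (pd i ?\<phi>) y)"
      using sqi_inner_integrable[OF h L] sqi_inner_integrable[OF h X] by (simp add: inner_diff_right)
    also have "\<dots> = 0" using curl[OF t i] orth[OF t i] by simp
    finally show ?thesis .
  qed
  have R2: "R / 2 > 0" using R by simp
  have "AE y in lborel. \<forall>i\<in>Basis. y \<in> ball x0 (R/2) \<longrightarrow>
    exp (-2) * ?v / 2 ^ ?D * \<bar>k i y\<bar> \<le> 24 * 2 ^ ?D / (R/2) ^ ?D * (LINT y|lborel. \<bar>k i y\<bar>)"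
    by (intro AE_finite_allI finite_Basis weakly_harmonic_bound[OF ki R2] harm)
  then show ?thesis
  proof eventually_elim
    case (elim y)
    show ?case
    proof
      assume y: "y \<in> ball x0 (R/2)"
      then have yB: "y \<in> ?B" using R by auto
      have ci: "(h y \<bullet> i)\<^sup>2 * R ^ ?D \<le> c\<^sup>2 * ?v * S" if i: "i \<in> Basis" for i
      proof -
        let ?I = "LINT y|lborel. \<bar>k i y\<bar>"
        have "exp (-2) * ?v / 2 ^ ?D * \<bar>k i y\<bar> \<le> 24 * 2 ^ ?D / (R/2) ^ ?D * ?I" using elim i y by blast
        then have "(exp 2 * 2 ^ ?D / ?v) * (exp (-2) * ?v / 2 ^ ?D * \<bar>k i y\<bar>) \<le> (exp 2 * 2 ^ ?D / ?v) * (24 * 2 ^ ?D / (R/2) ^ ?D * ?I)"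
          using v0 by (intro mult_left_mono) auto
        moreover have "(exp 2 * 2 ^ ?D / ?v) * (exp (-2) * ?v / 2 ^ ?D * \<bar>k i y\<bar>) = \<bar>k i y\<bar>"
        proof -
          have cancel: "(p * q / r) * (s * r / q * t) = (p * s) * t" if "r > 0" "q > 0" for p q r s t :: real
            using that by simp
          have "exp 2 * exp (-2) = (1::real)" by (simp add: exp_minus)
          then show ?thesis by (subst cancel[OF v0]) simp_all
        qed
        moreover have "(exp 2 * 2 ^ ?D / ?v) * (24 * 2 ^ ?D / (R/2) ^ ?D * ?I) = c / R ^ ?D * ?I"
        proof -
          have "(8::real) ^ ?D = 2 ^ ?D * 2 ^ ?D * 2 ^ ?D" by (simp add: power_mult_distrib[symmetric])
          then show ?thesis by (simp add: c_def power_divide)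
        qed
        ultimately have "\<bar>k i y\<bar> \<le> c / R ^ ?D * ?I" by simp
        moreover have "\<bar>k i y\<bar> = \<bar>h y \<bullet> i\<bar>" using yB by (simp add: k_def)
        ultimately have "\<bar>h y \<bullet> i\<bar> \<le> c / R ^ ?D * ?I" by simp
        then have "\<bar>h y \<bullet> i\<bar>\<^sup>2 \<le> (c / R ^ ?D * ?I)\<^sup>2" by (rule power_mono) simp
        also have "\<dots> = (c / R ^ ?D)\<^sup>2 * ?I\<^sup>2" by (rule power_mult_distrib)
        also have "\<dots> \<le> (c / R ^ ?D)\<^sup>2 * (?v * R ^ ?D * S)" by (intro mult_left_mono kint i) auto
        finally have "(h y \<bullet> i)\<^sup>2 * R ^ ?D \<le> (c / R ^ ?D)\<^sup>2 * (?v * R ^ ?D * S) * R ^ ?D"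
          using R by (simp add: mult_right_mono)
        also have "\<dots> = c\<^sup>2 * ?v * S"
        proof -
          have "R ^ ?D \<noteq> 0" using R by simp
          then show ?thesis by (simp add: power_divide power2_eq_square)
        qed
        finally show ?thesis .
      qed
      have "(norm (h y))\<^sup>2 * R ^ ?D = (\<Sum>i\<in>Basis. (h y \<bullet> i)\<^sup>2 * R ^ ?D)"
        unfolding power2_norm_eq_inner by (subst euclidean_inner) (simp add: power2_eq_square sum_distrib_right)
      also have "\<dots> \<le> (\<Sum>i\<in>(Basis::'a set). c\<^sup>2 * ?v * S)" by (intro sum_mono ci)
      also have "\<dots> = ?D * (c\<^sup>2 * ?v) * S" by simp
      finally show "(norm (h y))\<^sup>2 * R ^ ?D \<le> ?D * ((24 * 8 ^ ?D * exp 2 / ?v)\<^sup>2 * ?v) * (LINT x|lborel. (norm (h x))\<^sup>2)"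
        by (simp add: c_def S_def)
    qed
  qed
qed

lemma L2_inner_lower_bound:
  assumes f: "sqi M f" and w: "sqi M w" and V: "sqi M V" and c: "c > 0"
    and fV: "AE x in M. norm (f x) \<le> \<omega> * norm (V x)"
  shows "- (LINT x|M. f x \<bullet> w x) \<le> c / 4 * (LINT x|M. (norm (w x))\<^sup>2) + \<omega>\<^sup>2 / c * (LINT x|M. (norm (V x))\<^sup>2)"
proof -
  have "(LINT x|M. - (f x \<bullet> w x)) \<le> (LINT x|M. c / 4 * (norm (w x))\<^sup>2 + \<omega>\<^sup>2 / c * (norm (V x))\<^sup>2)"
  proof (rule integral_mono_AE)
    show "integrable M (\<lambda>x. - (f x \<bullet> w x))" using sqi_inner_integrable[OF f w] by simp
    show "AE x in M. - (f x \<bullet> w x) \<le> c / 4 * (norm (w x))\<^sup>2 + \<omega>\<^sup>2 / c * (norm (V x))\<^sup>2"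
      using fV
    proof eventually_elim
      case (elim x)
      have "- (f x \<bullet> w x) \<le> norm (f x) * norm (w x)" using Cauchy_Schwarz_ineq2[of "f x" "w x"] by linarith
      also have "\<dots> \<le> (\<omega> * norm (V x)) * norm (w x)" using elim by (intro mult_right_mono) auto
      also have "\<dots> \<le> c / 4 * (norm (w x))\<^sup>2 + \<omega>\<^sup>2 / c * (norm (V x))\<^sup>2"
      proof -
        have "0 \<le> (c / 2 * norm (w x) - \<omega> * norm (V x))\<^sup>2 / c" using c by simp
        also have "\<dots> = c / 4 * (norm (w x))\<^sup>2 + \<omega>\<^sup>2 / c * (norm (V x))\<^sup>2 - (\<omega> * norm (V x)) * norm (w x)"
          using c by (simp add: field_simps power2_eq_square)
        finally show ?thesis by simp
      qed
      finally show ?case .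
    qed
  qed (use sqi_integrable[OF w] sqi_integrable[OF V] in auto)
  then show ?thesis using sqi_integrable[OF w] sqi_integrable[OF V] by simp
qed

text \<open>Testing with \<open>w\<close> itself. The coefficient \<open>c/4\<close> in the two bounds leaves half of \<open>c \<integral> \<bar>w\<bar>\<^sup>2\<close> on the
  left-hand side.\<close>

lemma frozen_energy_estimate:
  assumes w: "sqi M w" and h: "sqi M h" and V: "sqi M V" and E: "sqi M E" and F: "sqi M F" and c: "c > 0"
    and split: "\<And>x. V x = h x + w x" and hw: "(LINT x|M. h x \<bullet> w x) = 0"
    and test: "(LINT x|M. (c *\<^sub>R V x + (E x + F x)) \<bullet> w x) = 0"
    and EV: "AE x in M. norm (E x) \<le> \<omega> * norm (V x)"
  shows "(LINT x|M. (norm (w x))\<^sup>2) \<le> 2 / c\<^sup>2 * ((LINT x|M. (norm (F x))\<^sup>2) + \<omega>\<^sup>2 * (LINT x|M. (norm (V x))\<^sup>2))"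
proof -
  define Iw where "Iw = (LINT x|M. (norm (w x))\<^sup>2)"
  define IV where "IV = (LINT x|M. (norm (V x))\<^sup>2)"
  define IF where "IF = (LINT x|M. (norm (F x))\<^sup>2)"
  have "(c *\<^sub>R V x + (E x + F x)) \<bullet> w x = c * (h x \<bullet> w x) + c * (norm (w x))\<^sup>2 + (E x \<bullet> w x + F x \<bullet> w x)" for x
    by (simp add: split power2_norm_eq_inner algebra_simps)
  then have "0 = c * (LINT x|M. h x \<bullet> w x) + c * Iw + ((LINT x|M. E x \<bullet> w x) + (LINT x|M. F x \<bullet> w x))"
    using test sqi_inner_integrable[OF h w] sqi_inner_integrable[OF E w] sqi_inner_integrable[OF F w] sqi_integrable[OF w]
    by (simp add: Iw_def)
  then have "c * Iw = - (LINT x|M. E x \<bullet> w x) - (LINT x|M. F x \<bullet> w x)" using hw by simp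
  moreover have "- (LINT x|M. E x \<bullet> w x) \<le> c / 4 * Iw + \<omega>\<^sup>2 / c * IV"
    unfolding Iw_def IV_def by (rule L2_inner_lower_bound[OF E w V c EV])
  moreover have "- (LINT x|M. F x \<bullet> w x) \<le> c / 4 * Iw + 1\<^sup>2 / c * IF"
    unfolding Iw_def IF_def by (rule L2_inner_lower_bound[OF F w F c]) simp
  moreover have "(IF + \<omega>\<^sup>2 * IV) / c = 1\<^sup>2 / c * IF + \<omega>\<^sup>2 / c * IV" by (simp add: add_divide_distrib)
  moreover have "c / 4 * Iw + c / 4 * Iw = c * Iw - c / 2 * Iw" by simp
  ultimately have "c / 2 * Iw \<le> (IF + \<omega>\<^sup>2 * IV) / c" by linarith
  then have "(2 / c) * (c / 2 * Iw) \<le> (2 / c) * ((IF + \<omega>\<^sup>2 * IV) / c)" using c by (intro mult_left_mono) auto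
  moreover have "(2 / c) * (c / 2 * Iw) = Iw" using c by simp
  moreover have "(2 / c) * ((IF + \<omega>\<^sup>2 * IV) / c) = 2 / c\<^sup>2 * (IF + \<omega>\<^sup>2 * IV)"
    by (simp add: power2_eq_square)
  ultimately have "Iw \<le> 2 / c\<^sup>2 * (IF + \<omega>\<^sup>2 * IV)" by linarith
  then show ?thesis by (simp only: Iw_def IV_def IF_def)
qed

text \<open>The coefficient is frozen at \<open>c\<close>. The projection \<open>w\<close> of \<open>\<nabla>u\<close> is an admissible test field, being a limit
  of gradients of test functions. As \<open>\<nabla>u - w\<close> is orthogonal to \<open>w\<close>, testing gives \<open>c \<integral> \<bar>w\<bar>\<^sup>2\<close> on one side and
  only the datum and \<open>(a - c) \<nabla>u\<close> on the other. Only \<open>4 / a_low\<^sup>2\<close> and a dimensional constant enter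
  \<open>K\<close>; the oscillation enters the second parameter alone.\<close>

theorem local_comparison:
  fixes u a :: "'a::euclidean_space \<Rightarrow> real" and Du F :: "'a \<Rightarrow> 'a"
  assumes u: "sqi lborel u" and Du: "sqi lborel Du" and F: "sqi lborel F"
    and am[measurable]: "a \<in> borel_measurable borel" and R: "R > 0"
    and weak: "\<And>\<phi> i. \<phi> \<in> test_functions (ball x0 R) \<Longrightarrow> i \<in> Basis \<Longrightarrow>
      (LINT x|lborel. u x * pd i \<phi> x) = - (LINT x|lborel. (Du x \<bullet> i) * \<phi> x)"
    and eqn: "\<And>\<phi>. \<phi> \<in> test_functions (ball x0 R) \<Longrightarrow>
      (LINT x|lborel. a x * (Du x \<bullet> grad \<phi> x)) = - (LINT x|lborel. F x \<bullet> grad \<phi> x)"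
    and c: "a_low > 0" "c \<ge> a_low"
    and osc: "AE y in lborel. y \<in> ball x0 R \<longrightarrow> \<bar>a y - c\<bar> \<le> \<omega>"
    and K: "K \<ge> 4 / a_low\<^sup>2"
      "K \<ge> 2 * DIM('a) * ((24 * 8 ^ DIM('a) * exp 2 / unit_ball_vol DIM('a))\<^sup>2 * unit_ball_vol DIM('a))"
  shows "half_ball_comparison K (\<omega>\<^sup>2) (\<lambda>y. (norm (Du y))\<^sup>2) (\<lambda>y. (norm (F y))\<^sup>2) x0 R"
proof -
  let ?D = "DIM('a)" let ?v = "unit_ball_vol DIM('a)" let ?B = "ball x0 R"
  have c0: "c > 0" using c by linarith
  have Dum[measurable]: "Du \<in> borel_measurable borel" and Fm[measurable]: "F \<in> borel_measurable borel"
    using Du F by (auto simp: sqi_def)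
  define V where "V y = indicator ?B y *\<^sub>R Du y" for y
  define FB where "FB y = indicator ?B y *\<^sub>R F y" for y
  define E where "E y = indicator ?B y *\<^sub>R ((a y - c) *\<^sub>R Du y)" for y
  have V: "sqi lborel V" by (rule sqi_bound[OF Du, where C=1]) (auto simp: V_def[abs_def] indicator_def)
  have FB: "sqi lborel FB" by (rule sqi_bound[OF F, where C=1]) (auto simp: FB_def[abs_def] indicator_def)
  have EV: "AE y in lborel. norm (E y) \<le> \<omega> * norm (V y)"
    using osc by eventually_elim (auto simp: E_def V_def indicator_def mult_right_mono)
  have Em: "E \<in> borel_measurable lborel" unfolding E_def[abs_def] measurable_lborel1
    by (intro borel_measurable_scaleR borel_measurable_indicator borel_measurable_diff am Dum borel_measurable_const) auto
  have E: "sqi lborel E" by (rule sqi_bound[OF V _ EV]) (rule Em)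
  define G where "G = grad ` test_functions ?B"
  have Gs: "sqi lborel g" if "g \<in> G" for g using that by (auto simp: G_def intro: sqi_grad)
  have Gne: "G \<noteq> {}" using test_functions_zero by (auto simp: G_def)
  have Gadd: "(\<lambda>x. \<phi> x + \<psi> x) \<in> G" if "\<phi> \<in> G" "\<psi> \<in> G" for \<phi> \<psi>
    proof -
      obtain p q where pq: "p \<in> test_functions ?B" "q \<in> test_functions ?B" "\<phi> = grad p" "\<psi> = grad q"
        using \<open>\<phi> \<in> G\<close> \<open>\<psi> \<in> G\<close> by (auto simp: G_def)
      then show ?thesis unfolding G_def
        by (intro image_eqI[of _ grad "\<lambda>x. p x + q x"]) (simp_all add: grad_add test_functionsD(1) test_functions_add)
    qed
  have Gscale: "(\<lambda>x. r *\<^sub>R \<psi> x) \<in> G" if "\<psi> \<in> G" for r \<psi>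
    proof -
      obtain q where q: "q \<in> test_functions ?B" "\<psi> = grad q" using \<open>\<psi> \<in> G\<close> by (auto simp: G_def)
      then show ?thesis unfolding G_def
        by (intro image_eqI[of _ grad "\<lambda>x. r * q x"])
          (simp_all add: grad_cmult test_functionsD(1) test_functions_mult smooth_const)
    qed
  have "\<exists>w g. sqi lborel w \<and> (\<forall>n::nat. g n \<in> G) \<and>
    (\<lambda>n. LINT x|lborel. (norm (w x - g n x))\<^sup>2) \<longlonglongrightarrow> 0 \<and> (\<forall>\<psi>\<in>G. (LINT x|lborel. (V x - w x) \<bullet> \<psi> x) = 0)"
    by (rule L2_projection[OF V]) (fact Gs Gne Gadd Gscale)+
  then obtain w g where wg: "sqi lborel w \<and> (\<forall>n::nat. g n \<in> G) \<and>
    (\<lambda>n. LINT x|lborel. (norm (w x - g n x))\<^sup>2) \<longlonglongrightarrow> 0 \<and> (\<forall>\<psi>\<in>G. (LINT x|lborel. (V x - w x) \<bullet> \<psi> x) = 0)"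
    by (elim exE)
  then have w: "sqi lborel w" and gG: "\<And>n. g n \<in> G"
    and lim: "(\<lambda>n. LINT x|lborel. (norm (w x - g n x))\<^sup>2) \<longlonglongrightarrow> 0"
    and orth: "\<And>\<psi>. \<psi> \<in> G \<Longrightarrow> (LINT x|lborel. (V x - w x) \<bullet> \<psi> x) = 0"
    by blast+
  have gs: "sqi lborel (g n)" for n by (rule Gs[OF gG])
  have wlim: "(LINT x|lborel. v x \<bullet> w x) = 0" if "sqi lborel v" "\<And>\<psi>. \<psi> \<in> G \<Longrightarrow> (LINT x|lborel. v x \<bullet> \<psi> x) = 0" for v
    using L2_tendsto_inner[OF that(1) w gs lim] that(2)[OF gG] by (simp add: LIMSEQ_const_iff)
  define h where "h x = V x - w x" for x
  have h: "sqi lborel h" unfolding h_def[abs_def] by (rule sqi_diff[OF V w])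
  have hw: "(LINT x|lborel. h x \<bullet> w x) = 0" by (rule wlim[OF h]) (simp add: h_def orth)
  \<comment> \<open>\<open>T\<close> is \<open>a \<nabla>u + F\<close> on the ball, split so that every part is square integrable by the oscillation bound.\<close>
  define T where "T y = c *\<^sub>R V y + (E y + FB y)" for y
  have T: "sqi lborel T" unfolding T_def[abs_def] by (intro sqi_add sqi_scaleR V E FB)
  have Tw: "(LINT x|lborel. T x \<bullet> w x) = 0"
  proof (rule wlim[OF T])
    fix \<psi> assume "\<psi> \<in> G"
    then obtain \<phi> where \<phi>: "\<phi> \<in> test_functions ?B" "\<psi> = grad \<phi>" by (auto simp: G_def)
    have gi: "sqi lborel (grad \<phi>)" by (rule sqi_grad[OF \<phi>(1)])
    have e1: "a y * (Du y \<bullet> grad \<phi> y) = (c *\<^sub>R V y + E y) \<bullet> grad \<phi> y" for y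
      using grad_outside[OF \<phi>(1), of y] by (cases "y \<in> ?B") (auto simp: V_def E_def algebra_simps)
    have e2: "F y \<bullet> grad \<phi> y = FB y \<bullet> grad \<phi> y" for y
      using grad_outside[OF \<phi>(1), of y] by (cases "y \<in> ?B") (auto simp: FB_def)
    have "(LINT x|lborel. (c *\<^sub>R V x + E x) \<bullet> grad \<phi> x) + (LINT x|lborel. FB x \<bullet> grad \<phi> x) = 0"
      using eqn[OF \<phi>(1)] unfolding e1 e2 by simp
    moreover have "T x \<bullet> grad \<phi> x = (c *\<^sub>R V x + E x) \<bullet> grad \<phi> x + FB x \<bullet> grad \<phi> x" for x
      by (simp add: T_def inner_add_left)
    ultimately show "(LINT x|lborel. T x \<bullet> \<psi> x) = 0"
      unfolding \<phi>(2)
      using sqi_inner_integrable[OF sqi_add[OF sqi_scaleR[OF V, of c] E] gi] sqi_inner_integrable[OF FB gi]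
      by simp
  qed
  define Iw where "Iw = (LINT x|lborel. (norm (w x))\<^sup>2)"
  define IV where "IV = (LINT x|lborel. (norm (V x))\<^sup>2)"
  define IF where "IF = (LINT x|lborel. (norm (FB x))\<^sup>2)"
  have sqI: "integrable lborel (\<lambda>x. (norm (w x))\<^sup>2)" "integrable lborel (\<lambda>x. (norm (V x))\<^sup>2)"
    "integrable lborel (\<lambda>x. (norm (FB x))\<^sup>2)"
    by (intro sqi_integrable w V FB)+
  have energy: "Iw \<le> 2 / c\<^sup>2 * (IF + \<omega>\<^sup>2 * IV)"
    unfolding Iw_def IF_def IV_def
    by (rule frozen_energy_estimate[OF w h V E FB c0 _ hw Tw[unfolded T_def] EV]) (simp add: h_def)
  have hV: "(LINT x|lborel. (norm (h x))\<^sup>2) \<le> IV"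
  proof -
    have "IV = (LINT x|lborel. (norm (h x + 1 *\<^sub>R w x))\<^sup>2)" by (simp add: IV_def h_def)
    also have "\<dots> = (LINT x|lborel. (norm (h x))\<^sup>2) + 2 * 1 * (LINT x|lborel. h x \<bullet> w x) + 1\<^sup>2 * (LINT x|lborel. (norm (w x))\<^sup>2)"
      by (rule integral_norm_add_scaled[OF h w])
    finally show ?thesis using hw by simp
  qed
  have curlG: "(LINT x|lborel. (lapl \<phi> x *\<^sub>R i - grad (pd i \<phi>) x) \<bullet> \<psi> x) = 0"
    if \<phi>: "\<phi> \<in> test_functions ?B" and i: "i \<in> Basis" and \<psi>: "\<psi> \<in> G" for \<phi> i \<psi>
  proof -
    obtain q where q: "q \<in> test_functions ?B" "\<psi> = grad q" using \<psi> by (auto simp: G_def)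
    have "(LINT x|lborel. grad q x \<bullet> (lapl \<phi> x *\<^sub>R i - grad (pd i \<phi>) x)) = 0"
    proof (rule weak_gradient_identity[OF sqi_test_function[OF q(1)] sqi_grad[OF q(1)] _ \<phi> i])
      fix \<eta> j assume "\<eta> \<in> test_functions ?B" "(j::'a) \<in> Basis"
      then show "(LINT x|lborel. q x * pd j \<eta> x) = - (LINT x|lborel. (grad q x \<bullet> j) * \<eta> x)"
        using integration_by_parts[OF _ test_functionsD(1)[OF q(1)]] by (simp add: grad_inner)
    qed
    then show ?thesis by (simp add: q(2) inner_commute)
  qed
  have Xs: "sqi lborel (\<lambda>x. lapl \<phi> x *\<^sub>R i - grad (pd i \<phi>) x)" if \<phi>: "\<phi> \<in> test_functions ?B" and i: "i \<in> Basis" for \<phi> i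
  proof (rule sqi_diff)
    show "sqi lborel (\<lambda>x. lapl \<phi> x *\<^sub>R i)" by (rule sqi_test_function_scaleR[OF test_functions_lapl[OF \<phi>]])
    show "sqi lborel (grad (pd i \<phi>))" by (rule sqi_grad[OF test_functions_pd[OF \<phi> i]])
  qed
  have curlh: "(LINT x|lborel. h x \<bullet> (lapl \<phi> x *\<^sub>R i - grad (pd i \<phi>) x)) = 0"
    if \<phi>: "\<phi> \<in> test_functions ?B" and i: "i \<in> Basis" for \<phi> i
  proof -
    let ?X = "\<lambda>x. lapl \<phi> x *\<^sub>R i - grad (pd i \<phi>) x"
    have X0: "?X y = 0" if "y \<notin> ?B" for y
      using test_functions_outside[OF test_functions_lapl[OF \<phi>] that] grad_outside[OF test_functions_pd[OF \<phi> i] that] by simp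
    have "(LINT x|lborel. V x \<bullet> ?X x) = (LINT x|lborel. Du x \<bullet> ?X x)"
    proof (intro Bochner_Integration.integral_cong refl)
      fix y show "V y \<bullet> ?X y = Du y \<bullet> ?X y" using X0[of y] by (cases "y \<in> ?B") (auto simp: V_def)
    qed
    also have "\<dots> = 0" by (rule weak_gradient_identity[OF u Du weak \<phi> i])
    finally have 1: "(LINT x|lborel. V x \<bullet> ?X x) = 0" .
    have 2: "(LINT x|lborel. ?X x \<bullet> w x) = 0" by (rule wlim[OF Xs[OF \<phi> i]]) (rule curlG[OF \<phi> i])
    have "h x \<bullet> ?X x = V x \<bullet> ?X x - ?X x \<bullet> w x" for x unfolding h_def by (simp only: inner_diff_left inner_commute[of "w x"])
    then show ?thesis
      using 1 2 sqi_inner_integrable[OF V Xs[OF \<phi> i]] sqi_inner_integrable[OF Xs[OF \<phi> i] w] by simp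
  qed
  define C1 where "C1 = DIM('a) * ((24 * 8 ^ ?D * exp 2 / ?v)\<^sup>2 * ?v)"
  have C1: "C1 \<ge> 0" by (simp add: C1_def)
  have hb: "AE y in lborel. y \<in> ball x0 (R/2) \<longrightarrow> (norm (h y))\<^sup>2 * R ^ ?D \<le> C1 * (LINT x|lborel. (norm (h x))\<^sup>2)"
    unfolding C1_def
  proof (rule orthogonal_part_bound[OF h R _ curlh])
    fix \<phi> and i :: 'a assume "\<phi> \<in> test_functions ?B" "i \<in> Basis"
    then have "grad (pd i \<phi>) \<in> G" unfolding G_def by (intro imageI test_functions_pd)
    then show "(LINT x|lborel. h x \<bullet> grad (pd i \<phi>) x) = 0" unfolding h_def by (rule orth)
  qed
  let ?P = "\<lambda>y. (norm (Du y))\<^sup>2" let ?Q = "\<lambda>y. (norm (F y))\<^sup>2"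
  have IVP: "IV \<le> mass ?P (cball x0 R)"
  proof -
    have "IV = mass ?P ?B" unfolding IV_def V_def set_lebesgue_integral_def
      by (intro Bochner_Integration.integral_cong refl) (simp add: indicator_def)
    also have "\<dots> \<le> mass ?P (cball x0 R)" by (rule mass_mono) (use sqi_integrable[OF Du] in auto)
    finally show ?thesis .
  qed
  have IFQ: "IF \<le> mass ?Q (cball x0 R)"
  proof -
    have "IF = mass ?Q ?B" unfolding IF_def FB_def set_lebesgue_integral_def
      by (intro Bochner_Integration.integral_cong refl) (simp add: indicator_def)
    also have "\<dots> \<le> mass ?Q (cball x0 R)" by (rule mass_mono) (use sqi_integrable[OF F] in auto)
    finally show ?thesis .
  qed
  have K0: "K \<ge> 0" by (rule order_trans[OF _ K(1)]) simp
  define M where "M = 2 * C1 * IV / R ^ ?D"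
  have IV0: "IV \<ge> 0" "IF \<ge> 0" by (auto simp: IV_def IF_def)
  show ?thesis
    unfolding half_ball_comparison_def
  proof (intro exI[of _ "\<lambda>y. 2 * (norm (w y))\<^sup>2"] exI[of _ M] conjI allI)
    show "integrable lborel (\<lambda>y. 2 * (norm (w y))\<^sup>2)" using sqI(1) by simp
    show "0 \<le> M" using C1 IV0 R by (simp add: M_def)
    show "AE y in lborel. y \<in> ball x0 (R/2) \<longrightarrow> ?P y \<le> 2 * (norm (w y))\<^sup>2 + M"
      using hb
    proof eventually_elim
      case (elim y)
      show ?case
      proof
        assume y: "y \<in> ball x0 (R/2)"
        then have yB: "y \<in> ?B" using R by auto
        have "C1 * (LINT x|lborel. (norm (h x))\<^sup>2) \<le> C1 * IV" using hV C1 by (intro mult_left_mono)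
        then have "(norm (h y))\<^sup>2 * R ^ ?D \<le> C1 * IV" using elim y by linarith
        then have "2 * (norm (h y))\<^sup>2 \<le> M" using R by (simp add: M_def pos_le_divide_eq)
        moreover have "Du y = w y + h y" using yB by (simp add: h_def V_def)
        ultimately show "?P y \<le> 2 * (norm (w y))\<^sup>2 + M" using norm_add_square_le[of "w y" "h y"] by simp
      qed
    qed
    show "M * R ^ ?D \<le> K * mass ?P (cball x0 R)"
    proof -
      have "M * R ^ ?D = (2 * C1) * IV" using R by (simp add: M_def)
      also have "\<dots> \<le> K * mass ?P (cball x0 R)"
        using K(2) IVP IV0 K0 by (intro mult_mono) (auto simp: C1_def mult.assoc)
      finally show ?thesis .
    qed
    show "mass (\<lambda>y. 2 * (norm (w y))\<^sup>2) (ball x0 (R/2)) \<le> K * (mass ?Q (cball x0 R) + \<omega>\<^sup>2 * mass ?P (cball x0 R))"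
    proof -
      have "mass (\<lambda>y. 2 * (norm (w y))\<^sup>2) (ball x0 (R/2)) \<le> mass (\<lambda>y. 2 * (norm (w y))\<^sup>2) UNIV"
        by (rule mass_mono) (use sqI(1) in auto)
      also have "\<dots> = 2 * Iw" by (simp add: set_lebesgue_integral_def Iw_def)
      also have "\<dots> \<le> 4 / c\<^sup>2 * (IF + \<omega>\<^sup>2 * IV)"
      proof -
        have "2 * Iw \<le> 2 * (2 / c\<^sup>2 * (IF + \<omega>\<^sup>2 * IV))" by (rule mult_left_mono[OF energy]) simp
        then show ?thesis by simp
      qed
      also have "\<dots> \<le> K * (mass ?Q (cball x0 R) + \<omega>\<^sup>2 * mass ?P (cball x0 R))"
      proof (rule mult_mono)
        have "4 / c\<^sup>2 \<le> 4 / a_low\<^sup>2" using c by (intro divide_left_mono power_mono mult_pos_pos) auto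
        then show "4 / c\<^sup>2 \<le> K" using K(1) by linarith
        show "IF + \<omega>\<^sup>2 * IV \<le> mass ?Q (cball x0 R) + \<omega>\<^sup>2 * mass ?P (cball x0 R)"
          using IVP IFQ by (intro add_mono mult_left_mono) auto
        show "0 \<le> IF + \<omega>\<^sup>2 * IV" using IV0 by simp
      qed (rule K0)
      finally show ?thesis .
    qed
  qed simp
qed

section \<open>Oscillation of the coefficient\<close>

text \<open>A ball of radius \<open>R\<close> contains a point \<open>z\<close> where \<open>\<bar>g z\<bar>\<^sup>q\<close> is at most about its mean value, which is
  of order \<open>R\<^sup>-\<^sup>d\<close>. As the bound on \<open>a\<close> involves \<open>g\<close> at one of the two points only, the value at
  \<open>z\<close> is a good constant for the whole ball, with error of order \<open>R\<close> to the positive power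
  \<open>\<alpha> - d/q\<close>.\<close>

lemma coefficient_oscillation:
  fixes a g :: "'a::euclidean_space \<Rightarrow> real"
  assumes g: "integrable lborel (\<lambda>x. indicator \<Omega> x * \<bar>g x\<bar> powr q)" and q: "q > 0" and \<alpha>: "\<alpha> > 0" "\<alpha> * q > DIM('a)"
    and low: "AE x in lborel. x \<in> \<Omega> \<longrightarrow> a_low \<le> a x"
    and pair: "AE x in lborel. AE y in lborel. x \<in> \<Omega> \<longrightarrow> y \<in> \<Omega> \<longrightarrow> \<bar>a x - a y\<bar> \<le> g x * norm (x - y) powr \<alpha>"
    and \<omega>: "\<omega> > 0"
  shows "\<exists>R0>0. \<forall>x R. 0 < R \<and> R < R0 \<and> ball x R \<subseteq> \<Omega> \<longrightarrow>
    (\<exists>c\<ge>a_low. AE y in lborel. y \<in> ball x R \<longrightarrow> \<bar>a y - c\<bar> \<le> \<omega>)"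
proof -
  let ?D = "DIM('a)" let ?v = "unit_ball_vol DIM('a)"
  have v0: "?v > 0" by simp
  define I where "I = (LINT x|lborel. indicator \<Omega> x * \<bar>g x\<bar> powr q)"
  have I0: "I \<ge> 0" unfolding I_def by (intro integral_nonneg_AE AE_I2) simp
  define \<gamma> where "\<gamma> = \<alpha> - ?D / q"
  have \<gamma>: "\<gamma> > 0" using \<alpha> q by (simp add: \<gamma>_def pos_divide_less_eq)
  define C where "C = ((I + 1) / ?v) powr (1/q) * 2 powr \<alpha>"
  have "(I + 1) / ?v > 0" using I0 v0 by (intro divide_pos_pos) auto
  then have "((I + 1) / ?v) powr (1/q) > 0" unfolding powr_gt_zero by linarith
  then have C: "C > 0" unfolding C_def by (intro mult_pos_pos) auto
  define R0 where "R0 = (\<omega> / C) powr (1 / \<gamma>)"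
  have R0: "R0 > 0" using \<omega> C by (simp add: R0_def)
  have "\<exists>c\<ge>a_low. AE y in lborel. y \<in> ball x R \<longrightarrow> \<bar>a y - c\<bar> \<le> \<omega>"
    if R: "0 < R" "R < R0" and sub: "ball x R \<subseteq> \<Omega>" for x R
  proof -
    define t where "t = (I + 1) / (?v * R ^ ?D)"
    have t: "t > 0" using I0 v0 R by (simp add: t_def)
    have "\<exists>z\<in>ball x R. a_low \<le> a z \<and> \<bar>g z\<bar> powr q \<le> t \<and>
      (AE y in lborel. z \<in> \<Omega> \<longrightarrow> y \<in> \<Omega> \<longrightarrow> \<bar>a z - a y\<bar> \<le> g z * norm (z - y) powr \<alpha>)"
    proof (rule ccontr)
      assume no: "\<not> ?thesis"
      have ae: "AE z in lborel. indicator (ball x R) z * t \<le> indicator \<Omega> z * \<bar>g z\<bar> powr q"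
        using low pair
      proof eventually_elim
        case (elim z)
        show ?case
        proof (cases "z \<in> ball x R")
          case True
          then have "z \<in> \<Omega>" using sub by blast
          then have "\<not> \<bar>g z\<bar> powr q \<le> t" using no True elim by blast
          then show ?thesis using True \<open>z \<in> \<Omega>\<close> by simp
        qed simp
      qed
      have "(LINT z|lborel. indicator (ball x R) z * t) \<le> I"
        unfolding I_def
      proof (rule integral_mono_AE[OF _ g ae])
        show "integrable lborel (\<lambda>z. indicator (ball x R) z * t)"
          using emeasure_lborel_ball_finite[of x R] by (intro integrable_mult_left integrable_real_indicator) auto
      qed
      then have "?v * R ^ ?D * t \<le> I" using R by (simp add: content_ball)
      moreover have "?v * R ^ ?D * t = I + 1"
      proof -
        have cancel: "x * (y / x) = y" if "x > 0" for x y :: real using that by simp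
        show ?thesis unfolding t_def by (rule cancel) (use v0 R in \<open>intro mult_pos_pos, auto\<close>)
      qed
      ultimately show False by simp
    qed
    then obtain z where z: "z \<in> ball x R" "a_low \<le> a z" "\<bar>g z\<bar> powr q \<le> t"
      and az: "AE y in lborel. z \<in> \<Omega> \<longrightarrow> y \<in> \<Omega> \<longrightarrow> \<bar>a z - a y\<bar> \<le> g z * norm (z - y) powr \<alpha>" by blast
    have gz: "\<bar>g z\<bar> \<le> t powr (1/q)"
    proof -
      have "(\<bar>g z\<bar> powr q) powr (1/q) \<le> t powr (1/q)" using z(3) q by (intro powr_mono2) auto
      then show ?thesis using q by (simp add: powr_powr)
    qed
    have small: "t powr (1/q) * (2 * R) powr \<alpha> \<le> \<omega>"
    proof -
      have "t powr (1/q) = ((I + 1) / ?v) powr (1/q) * (1 / R ^ ?D) powr (1/q)"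
        using I0 v0 R unfolding t_def by (subst powr_mult[symmetric]) auto
      also have "(1 / R ^ ?D) powr (1/q) = R powr (- (?D / q))"
        using R by (simp add: powr_realpow[symmetric] powr_divide powr_powr powr_minus_divide)
      finally have "t powr (1/q) * (2 * R) powr \<alpha> = ((I + 1) / ?v) powr (1/q) * R powr (- (?D / q)) * (2 powr \<alpha> * R powr \<alpha>)"
        using R by (simp add: powr_mult)
      also have "\<dots> = C * (R powr (- (?D / q)) * R powr \<alpha>)" by (simp only: C_def mult_ac)
      also have "R powr (- (?D / q)) * R powr \<alpha> = R powr \<gamma>"
        unfolding powr_add[symmetric] by (simp add: \<gamma>_def)
      also have "C * R powr \<gamma> \<le> C * R0 powr \<gamma>" using R \<gamma> C by (intro mult_left_mono powr_mono2) auto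
      also have "R0 powr \<gamma> = \<omega> / C" using \<gamma> \<omega> C by (simp add: R0_def powr_powr)
      also have "C * (\<omega> / C) = \<omega>" using C by simp
      finally show ?thesis .
    qed
    have "AE y in lborel. y \<in> ball x R \<longrightarrow> \<bar>a y - a z\<bar> \<le> \<omega>"
      using az
    proof eventually_elim
      case (elim y)
      show ?case
      proof
        assume y: "y \<in> ball x R"
        then have "\<bar>a z - a y\<bar> \<le> g z * norm (z - y) powr \<alpha>" using elim z sub by blast
        also have "\<dots> \<le> \<bar>g z\<bar> * norm (z - y) powr \<alpha>" by (intro mult_right_mono) auto
        also have "\<dots> \<le> t powr (1/q) * (2 * R) powr \<alpha>"
        proof (intro mult_mono gz powr_mono2)
          have "dist z y < 2 * R" using y z(1) dist_triangle[of z y x] by (simp add: dist_commute)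
          then show "norm (z - y) \<le> 2 * R" by (simp add: dist_norm)
        qed (use \<alpha> in auto)
        also note small
        finally show "\<bar>a y - a z\<bar> \<le> \<omega>" by (simp add: abs_minus_commute)
      qed
    qed
    then show ?thesis using z(2) by blast
  qed
  then show ?thesis using R0 by blast
qed

section \<open>Borel representatives\<close>

text \<open>The measurability hypotheses of the theorem are Lebesgue measurability on \<open>\<Omega>\<close>, while product measures
  and averages over moving balls are handled with Borel functions on the whole space. Representatives
  that vanish outside \<open>\<Omega>\<close> translate one into the other.\<close>

lemma borel_representative:
  fixes f :: "'a::euclidean_space \<Rightarrow> 'b::euclidean_space"
  assumes f: "f \<in> borel_measurable (lebesgue_on \<Omega>)" and \<Omega>: "\<Omega> \<in> sets borel"
  shows "\<exists>f'. f' \<in> borel_measurable borel \<and> (AE x in lborel. x \<in> \<Omega> \<longrightarrow> f' x = f x) \<and> (\<forall>x. x \<notin> \<Omega> \<longrightarrow> f' x = 0)"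
proof -
  have \<Omega>': "\<Omega> \<in> sets lebesgue" using \<Omega> by simp
  have "\<exists>k\<in>borel_measurable lborel. AE x in lborel. indicator \<Omega> x * (f x \<bullet> i) = k x" for i
  proof (rule completion_ex_borel_measurable_real)
    have "(\<lambda>x. f x \<bullet> i) \<in> borel_measurable (lebesgue_on \<Omega>)"
      using f by (intro borel_measurable_inner) auto
    then show "(\<lambda>x. indicator \<Omega> x * (f x \<bullet> i)) \<in> borel_measurable lebesgue"
      using \<Omega>' by (subst (asm) borel_measurable_restrict_space_iff) auto
  qed
  then have "\<forall>i. \<exists>k. k \<in> borel_measurable lborel \<and> (AE x in lborel. indicator \<Omega> x * (f x \<bullet> i) = k x)" by blast
  from choice[OF this] obtain k where
    k: "\<And>i. k i \<in> borel_measurable lborel" "\<And>i. AE x in lborel. indicator \<Omega> x * (f x \<bullet> i) = k i x"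
    by blast
  define f' where "f' x = indicator \<Omega> x *\<^sub>R (\<Sum>i\<in>Basis. k i x *\<^sub>R i)" for x
  have "f' \<in> borel_measurable borel"
    unfolding f'_def[abs_def]
    by (intro borel_measurable_scaleR borel_measurable_indicator borel_measurable_sum borel_measurable_const \<Omega>)
      (use k(1) in simp)
  moreover have "AE x in lborel. \<forall>i\<in>Basis. indicator \<Omega> x * (f x \<bullet> i) = k i x"
    by (intro AE_finite_allI finite_Basis k(2))
  then have "AE x in lborel. x \<in> \<Omega> \<longrightarrow> f' x = f x"
  proof eventually_elim
    case (elim x)
    show ?case
    proof
      assume x: "x \<in> \<Omega>"
      then have "f' x = (\<Sum>i\<in>Basis. (f x \<bullet> i) *\<^sub>R i)" using elim by (simp add: f'_def)
      then show "f' x = f x" by (simp add: euclidean_representation)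
    qed
  qed
  ultimately show ?thesis by (auto simp: f'_def intro!: exI[of _ f'])
qed

lemma lebesgue_on_transfer:
  fixes H H' :: "'a::euclidean_space \<Rightarrow> real"
  assumes \<Omega>: "\<Omega> \<in> sets borel" and H: "H \<in> borel_measurable (lebesgue_on \<Omega>)"
    and H': "H' \<in> borel_measurable borel" "\<And>x. x \<notin> \<Omega> \<Longrightarrow> H' x = 0"
    and eq: "AE x in lborel. x \<in> \<Omega> \<longrightarrow> H' x = H x"
  shows "integrable (lebesgue_on \<Omega>) H \<longleftrightarrow> integrable lborel H'"
    and "(LINT x|lebesgue_on \<Omega>. H x) = (LINT x|lborel. H' x)"
proof -
  have \<Omega>': "\<Omega> \<in> sets lebesgue" "\<Omega> \<inter> space lebesgue \<in> sets lebesgue" using \<Omega> by auto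
  have Hl: "H' \<in> borel_measurable lebesgue" using H'(1) by (simp add: measurable_completion)
  have Hr: "H' \<in> borel_measurable (lebesgue_on \<Omega>)" using Hl by (rule measurable_restrict_space1)
  have ae: "AE x in lebesgue_on \<Omega>. H x = H' x"
    using AE_completion[OF eq] \<Omega>' by (subst AE_restrict_space_iff) auto
  have ind: "indicator \<Omega> x *\<^sub>R H' x = H' x" for x by (cases "x \<in> \<Omega>") (simp_all add: H'(2))
  have "integrable (lebesgue_on \<Omega>) H \<longleftrightarrow> integrable (lebesgue_on \<Omega>) H'"
    by (rule integrable_cong_AE[OF H Hr ae])
  also have "\<dots> \<longleftrightarrow> integrable lebesgue H'"
    by (subst integrable_restrict_space[OF \<Omega>'(2)]) (simp only: ind)
  also have "\<dots> \<longleftrightarrow> integrable lborel H'"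
    using H'(1) by (intro integrable_completion) simp
  finally show "integrable (lebesgue_on \<Omega>) H \<longleftrightarrow> integrable lborel H'" .
  have "(LINT x|lebesgue_on \<Omega>. H x) = (LINT x|lebesgue_on \<Omega>. H' x)"
    by (rule integral_cong_AE[OF H Hr ae])
  also have "\<dots> = (LINT x|lebesgue. H' x)"
    by (subst integral_restrict_space[OF \<Omega>'(2)]) (simp only: ind)
  also have "\<dots> = (LINT x|lborel. H' x)"
    using H'(1) by (intro integral_completion) simp
  finally show "(LINT x|lebesgue_on \<Omega>. H x) = (LINT x|lborel. H' x)" .
qed

lemma AE_lebesgue_on_iff:
  assumes "\<Omega> \<in> sets borel"
  shows "(AE x in lebesgue_on \<Omega>. P x) \<longleftrightarrow> (AE x in lborel. x \<in> \<Omega> \<longrightarrow> P x)"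
  using assms by (subst AE_restrict_space_iff) (auto simp: AE_completion_iff)

lemma borel_measurable_norm_powr:
  fixes f :: "'x \<Rightarrow> 'b::euclidean_space"
  assumes [measurable]: "f \<in> borel_measurable M"
  shows "(\<lambda>x. norm (f x) powr r) \<in> borel_measurable M"
  by measurable

lemma memLp_real_integrable:
  fixes f f' :: "'a::euclidean_space \<Rightarrow> 'b::euclidean_space"
  assumes "memLp (ennreal r) \<Omega> f" and r: "r > 0" and \<Omega>: "\<Omega> \<in> sets borel"
    and f': "f' \<in> borel_measurable borel" "\<And>x. x \<notin> \<Omega> \<Longrightarrow> f' x = 0" "AE x in lborel. x \<in> \<Omega> \<longrightarrow> f' x = f x"
  shows "integrable lborel (\<lambda>x. norm (f' x) powr r)"
proof -
  have f: "f \<in> borel_measurable (lebesgue_on \<Omega>)" and i: "integrable (lebesgue_on \<Omega>) (\<lambda>x. norm (f x) powr r)"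
    using assms(1) r by (auto simp: memLp_def)
  have "integrable (lebesgue_on \<Omega>) (\<lambda>x. norm (f x) powr r) \<longleftrightarrow> integrable lborel (\<lambda>x. norm (f' x) powr r)"
  proof (rule lebesgue_on_transfer(1)[OF \<Omega>])
    show "(\<lambda>x. norm (f x) powr r) \<in> borel_measurable (lebesgue_on \<Omega>)"
      using f by (rule borel_measurable_norm_powr)
    show "(\<lambda>x. norm (f' x) powr r) \<in> borel_measurable borel"
      using f'(1) by (rule borel_measurable_norm_powr)
    show "AE x in lborel. x \<in> \<Omega> \<longrightarrow> norm (f' x) powr r = norm (f x) powr r"
      using f'(3) by eventually_elim simp
  qed (simp add: f'(2))
  then show ?thesis using i by simp
qed

lemma memLp_2_sqi:
  fixes f f' :: "'a::euclidean_space \<Rightarrow> 'b::euclidean_space"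
  assumes "memLp 2 \<Omega> f" and \<Omega>: "\<Omega> \<in> sets borel"
    and f': "f' \<in> borel_measurable borel" "\<And>x. x \<notin> \<Omega> \<Longrightarrow> f' x = 0" "AE x in lborel. x \<in> \<Omega> \<longrightarrow> f' x = f x"
  shows "sqi lborel f'"
proof -
  have "integrable lborel (\<lambda>x. norm (f' x) powr 2)"
    by (rule memLp_real_integrable[OF _ _ \<Omega> f', where r=2]) (use assms(1) in auto)
  then show ?thesis using f'(1) by (simp add: sqi_def)
qed

section \<open>Interior integrability of the gradient\<close>

text \<open>A segment from a point of \<open>\<Omega>\<close> to a point outside meets the frontier.\<close>

lemma setdist_frontier_le_infdist:
  fixes y :: "'a::euclidean_space"
  assumes "y \<in> A" "A \<subseteq> \<Omega>" "\<Omega> \<noteq> UNIV"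
  shows "setdist A (frontier \<Omega>) \<le> infdist y (- \<Omega>)"
proof -
  have ne: "- \<Omega> \<noteq> {}" using assms(3) by auto
  show ?thesis
    unfolding infdist_notempty[OF ne]
  proof (rule cINF_greatest[OF ne])
    fix z assume z: "z \<in> - \<Omega>"
    have "closed_segment y z \<inter> frontier \<Omega> \<noteq> {}"
    proof (rule connected_Int_frontier)
      show "closed_segment y z \<inter> \<Omega> \<noteq> {}" using assms by auto
      show "closed_segment y z - \<Omega> \<noteq> {}" using z by auto
    qed (rule connected_segment)
    then obtain w where w: "w \<in> closed_segment y z" "w \<in> frontier \<Omega>" by auto
    have "setdist A (frontier \<Omega>) \<le> dist y w" by (rule setdist_le_dist[OF assms(1) w(2)])
    also have "\<dots> \<le> dist y z" using dist_in_closed_segment[OF w(1)] by (simp add: dist_commute)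
    finally show "setdist A (frontier \<Omega>) \<le> dist y z" .
  qed
qed

text \<open>If \<open>q\<close> is infinite, \<open>g\<close> is essentially bounded on a bounded set, and the finite exponent \<open>2 d / \<alpha>\<close> still
  satisfies the strict inequality.\<close>

lemma memLp_finite_exponent:
  fixes g :: "'a::euclidean_space \<Rightarrow> real"
  assumes \<Omega>: "open \<Omega>" "bounded \<Omega>" and q: "1 \<le> q" and \<alpha>: "0 < \<alpha>" and \<alpha>q: "ennreal \<alpha> * q > of_nat DIM('a)"
    and g: "memLp q \<Omega> g"
    and g': "g' \<in> borel_measurable borel" "\<And>x. x \<notin> \<Omega> \<Longrightarrow> g' x = 0" "AE x in lborel. x \<in> \<Omega> \<longrightarrow> g' x = g x"
  shows "\<exists>s>0. \<alpha> * s > DIM('a) \<and> integrable lborel (\<lambda>x. indicator \<Omega> x * \<bar>g' x\<bar> powr s)"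
proof (cases q)
  case (real s)
  have s: "s \<ge> 1" using q real by simp
  have "ennreal (real DIM('a)) < ennreal (\<alpha> * s)"
    using \<alpha>q real \<alpha> by (simp add: ennreal_mult' ennreal_of_nat_eq_real_of_nat)
  then have as: "DIM('a) < \<alpha> * s" by (simp add: ennreal_less_iff)
  have i: "integrable lborel (\<lambda>x. norm (g' x) powr s)"
    by (rule memLp_real_integrable[OF _ _ _ g', where r=s]) (use g real s \<Omega> in auto)
  have e: "indicator \<Omega> x * \<bar>g' x\<bar> powr s = norm (g' x) powr s" for x
    by (cases "x \<in> \<Omega>") (simp_all add: g'(2))
  have "integrable lborel (\<lambda>x. indicator \<Omega> x * \<bar>g' x\<bar> powr s)" unfolding e by (rule i)
  moreover have "s > 0" using s by linarith
  ultimately show ?thesis using as by blast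
next
  case top
  have \<Omega>b: "\<Omega> \<in> sets borel" using \<Omega> by simp
  define s where "s = 2 * DIM('a) / \<alpha>"
  have s: "s > 0" "\<alpha> * s > DIM('a)" using \<alpha> by (auto simp: s_def)
  obtain C where "AE x in lebesgue_on \<Omega>. norm (g x) \<le> C" using g top by (auto simp: memLp_def)
  then have "AE x in lborel. x \<in> \<Omega> \<longrightarrow> \<bar>g x\<bar> \<le> C" by (simp add: AE_lebesgue_on_iff[OF \<Omega>b])
  with g'(3) have b: "AE x in lborel. norm (indicator \<Omega> x * \<bar>g' x\<bar> powr s) \<le> norm (indicator \<Omega> x * (\<bar>C\<bar> powr s))"
  proof eventually_elim
    case (elim x)
    show ?case
    proof (cases "x \<in> \<Omega>")
      case True
      then have "\<bar>g' x\<bar> powr s \<le> \<bar>C\<bar> powr s" using elim s by (intro powr_mono2) auto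
      then show ?thesis using True by simp
    qed simp
  qed
  have "integrable lborel (\<lambda>x. indicator \<Omega> x * \<bar>g' x\<bar> powr s)"
  proof (rule Bochner_Integration.integrable_bound[OF _ _ b])
    show "integrable lborel (\<lambda>x. indicator \<Omega> x * (\<bar>C\<bar> powr s))"
      using emeasure_bounded_finite[OF \<Omega>(2)] \<Omega>b by (intro integrable_mult_left integrable_real_indicator) auto
    show "(\<lambda>x. indicator \<Omega> x * \<bar>g' x\<bar> powr s) \<in> borel_measurable lborel"
      by (intro borel_measurable_times borel_measurable_indicator powr_real_measurable borel_measurable_abs borel_measurable_const)
        (simp_all add: g'(1) \<Omega>b)
  qed
  then show ?thesis using s by blast
qed

theorem corollary5p2:
  fixes \<Omega> \<Omega>' :: "'a::euclidean_space set"
    and a g u :: "'a \<Rightarrow> real"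
    and F Du :: "'a \<Rightarrow> 'a"
    and q :: ennreal
    and a_low \<alpha> \<theta> :: real
  assumes "open \<Omega>" and "bounded \<Omega>"
    and "memLp \<infinity> \<Omega> a"
    and "a_low > 0" and "AE x in lebesgue_on \<Omega>. a x \<ge> a_low"
    and "1 \<le> q" and "0 < \<alpha>" and "\<alpha> \<le> 1"
    and "ennreal \<alpha> * q > of_nat DIM('a)"
    and "memLp q \<Omega> g"
    and "AE (x, y) in lebesgue_on (\<Omega> \<times> \<Omega>). \<bar>a x - a y\<bar> \<le> g x * norm (x - y) powr \<alpha>"
    and "weak_solution \<Omega> a F u Du"
    and "compactly_inside \<Omega>' \<Omega>"
    and "\<theta> > 0" and "theta_smooth \<theta> \<Omega>'"
  shows "\<forall>r::real. r > 2 \<longrightarrow> memLp (ennreal r) \<Omega> F \<longrightarrow> memLp (ennreal r) \<Omega>' Du"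
proof (intro allI impI)
  fix r :: real assume r: "r > 2" and Fr: "memLp (ennreal r) \<Omega> F"
  let ?D = "DIM('a)" let ?v = "unit_ball_vol DIM('a)"
  have \<Omega>b: "\<Omega> \<in> sets borel" using assms(1) by simp
  have nU: "\<Omega> \<noteq> UNIV" using assms(2) not_bounded_UNIV by metis
  have H1: "memLp 2 \<Omega> u" "memLp 2 \<Omega> Du" "memLp 2 \<Omega> F"
    and weak: "\<And>\<phi> i. \<phi> \<in> test_functions \<Omega> \<Longrightarrow> i \<in> Basis \<Longrightarrow>
        (LINT x|lebesgue_on \<Omega>. u x * (grad \<phi> x \<bullet> i)) = - (LINT x|lebesgue_on \<Omega>. (Du x \<bullet> i) * \<phi> x)"
    and eqn: "\<And>\<phi>. \<phi> \<in> test_functions \<Omega> \<Longrightarrow>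
        (LINT x|lebesgue_on \<Omega>. a x * (Du x \<bullet> grad \<phi> x)) = - (LINT x|lebesgue_on \<Omega>. F x \<bullet> grad \<phi> x)"
    using assms(12) by (auto simp: weak_solution_def H1_with_gradient_def)
  have meas: "u \<in> borel_measurable (lebesgue_on \<Omega>)" "Du \<in> borel_measurable (lebesgue_on \<Omega>)"
    "F \<in> borel_measurable (lebesgue_on \<Omega>)" "a \<in> borel_measurable (lebesgue_on \<Omega>)" "g \<in> borel_measurable (lebesgue_on \<Omega>)"
    using H1 assms(3,10) by (auto simp: memLp_def)
  obtain u' where u': "u' \<in> borel_measurable borel" "AE x in lborel. x \<in> \<Omega> \<longrightarrow> u' x = u x" "\<And>x. x \<notin> \<Omega> \<Longrightarrow> u' x = 0"
    using borel_representative[OF meas(1) \<Omega>b] by blast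
  obtain Du' where Du': "Du' \<in> borel_measurable borel" "AE x in lborel. x \<in> \<Omega> \<longrightarrow> Du' x = Du x" "\<And>x. x \<notin> \<Omega> \<Longrightarrow> Du' x = 0"
    using borel_representative[OF meas(2) \<Omega>b] by blast
  obtain F' where F': "F' \<in> borel_measurable borel" "AE x in lborel. x \<in> \<Omega> \<longrightarrow> F' x = F x" "\<And>x. x \<notin> \<Omega> \<Longrightarrow> F' x = 0"
    using borel_representative[OF meas(3) \<Omega>b] by blast
  obtain a' where a': "a' \<in> borel_measurable borel" "AE x in lborel. x \<in> \<Omega> \<longrightarrow> a' x = a x" "\<And>x. x \<notin> \<Omega> \<Longrightarrow> a' x = 0"
    using borel_representative[OF meas(4) \<Omega>b] by blast
  obtain g' where g': "g' \<in> borel_measurable borel" "AE x in lborel. x \<in> \<Omega> \<longrightarrow> g' x = g x" "\<And>x. x \<notin> \<Omega> \<Longrightarrow> g' x = 0"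
    using borel_representative[OF meas(5) \<Omega>b] by blast
  have su: "sqi lborel u'" by (rule memLp_2_sqi[OF H1(1) \<Omega>b u'(1,3,2)])
  have sDu: "sqi lborel Du'" by (rule memLp_2_sqi[OF H1(2) \<Omega>b Du'(1,3,2)])
  have sF: "sqi lborel F'" by (rule memLp_2_sqi[OF H1(3) \<Omega>b F'(1,3,2)])
  have gm: "grad \<phi> \<in> borel_measurable borel" if "\<phi> \<in> test_functions \<Omega>" for \<phi>
    using sqi_grad[OF that] by (simp add: sqi_def)
  have res: "f \<in> borel_measurable (lebesgue_on \<Omega>)" if "f \<in> borel_measurable borel" for f :: "'a \<Rightarrow> 'c::euclidean_space"
    using that by (intro measurable_restrict_space1) (simp add: measurable_completion)
  have weak': "(LINT x|lborel. u' x * pd i \<phi> x) = - (LINT x|lborel. (Du' x \<bullet> i) * \<phi> x)"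
    if \<phi>: "\<phi> \<in> test_functions \<Omega>" and i: "i \<in> Basis" for \<phi> i
  proof -
    have \<phi>m: "\<phi> \<in> borel_measurable borel" by (rule smooth_borel[OF test_functionsD(1)[OF \<phi>]])
    have pm: "pd i \<phi> \<in> borel_measurable borel" by (rule smooth_borel[OF test_functionsD(1)[OF test_functions_pd[OF \<phi> i]]])
    have "(LINT x|lebesgue_on \<Omega>. u x * (grad \<phi> x \<bullet> i)) = (LINT x|lborel. u' x * pd i \<phi> x)"
    proof (rule lebesgue_on_transfer(2)[OF \<Omega>b])
      show "(\<lambda>x. u x * (grad \<phi> x \<bullet> i)) \<in> borel_measurable (lebesgue_on \<Omega>)"
        by (intro borel_measurable_times borel_measurable_inner res gm \<phi> meas borel_measurable_const)
      show "(\<lambda>x. u' x * pd i \<phi> x) \<in> borel_measurable borel" by (intro borel_measurable_times u' pm)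
      show "AE x in lborel. x \<in> \<Omega> \<longrightarrow> u' x * pd i \<phi> x = u x * (grad \<phi> x \<bullet> i)"
        using u'(2) by eventually_elim (simp add: grad_inner i)
    qed (simp add: u'(3))
    moreover have "(LINT x|lebesgue_on \<Omega>. (Du x \<bullet> i) * \<phi> x) = (LINT x|lborel. (Du' x \<bullet> i) * \<phi> x)"
    proof (rule lebesgue_on_transfer(2)[OF \<Omega>b])
      show "(\<lambda>x. (Du x \<bullet> i) * \<phi> x) \<in> borel_measurable (lebesgue_on \<Omega>)"
        by (intro borel_measurable_times borel_measurable_inner res \<phi>m meas borel_measurable_const)
      show "(\<lambda>x. (Du' x \<bullet> i) * \<phi> x) \<in> borel_measurable borel"
        by (intro borel_measurable_times borel_measurable_inner Du' \<phi>m borel_measurable_const)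
      show "AE x in lborel. x \<in> \<Omega> \<longrightarrow> (Du' x \<bullet> i) * \<phi> x = (Du x \<bullet> i) * \<phi> x"
        using Du'(2) by eventually_elim simp
    qed (simp add: Du'(3))
    ultimately show ?thesis using weak[OF \<phi> i] by simp
  qed
  have eqn': "(LINT x|lborel. a' x * (Du' x \<bullet> grad \<phi> x)) = - (LINT x|lborel. F' x \<bullet> grad \<phi> x)"
    if \<phi>: "\<phi> \<in> test_functions \<Omega>" for \<phi>
  proof -
    have "(LINT x|lebesgue_on \<Omega>. a x * (Du x \<bullet> grad \<phi> x)) = (LINT x|lborel. a' x * (Du' x \<bullet> grad \<phi> x))"
    proof (rule lebesgue_on_transfer(2)[OF \<Omega>b])
      show "(\<lambda>x. a x * (Du x \<bullet> grad \<phi> x)) \<in> borel_measurable (lebesgue_on \<Omega>)"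
        by (intro borel_measurable_times borel_measurable_inner res gm \<phi> meas)
      show "(\<lambda>x. a' x * (Du' x \<bullet> grad \<phi> x)) \<in> borel_measurable borel"
        by (intro borel_measurable_times borel_measurable_inner gm \<phi> a' Du')
      show "AE x in lborel. x \<in> \<Omega> \<longrightarrow> a' x * (Du' x \<bullet> grad \<phi> x) = a x * (Du x \<bullet> grad \<phi> x)"
        using a'(2) Du'(2) by eventually_elim simp
    qed (simp add: a'(3))
    moreover have "(LINT x|lebesgue_on \<Omega>. F x \<bullet> grad \<phi> x) = (LINT x|lborel. F' x \<bullet> grad \<phi> x)"
    proof (rule lebesgue_on_transfer(2)[OF \<Omega>b])
      show "(\<lambda>x. F x \<bullet> grad \<phi> x) \<in> borel_measurable (lebesgue_on \<Omega>)"
        by (intro borel_measurable_inner res gm \<phi> meas)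
      show "(\<lambda>x. F' x \<bullet> grad \<phi> x) \<in> borel_measurable borel"
        by (intro borel_measurable_inner gm \<phi> F')
      show "AE x in lborel. x \<in> \<Omega> \<longrightarrow> F' x \<bullet> grad \<phi> x = F x \<bullet> grad \<phi> x"
        using F'(2) by eventually_elim simp
    qed (simp add: F'(3))
    ultimately show ?thesis using eqn[OF \<phi>] by simp
  qed
  obtain s where s: "s > 0" "\<alpha> * s > ?D" "integrable lborel (\<lambda>x. indicator \<Omega> x * \<bar>g' x\<bar> powr s)"
    using memLp_finite_exponent[OF assms(1,2,6,7,9,10) g'(1,3,2)] by blast
  have low: "AE x in lborel. x \<in> \<Omega> \<longrightarrow> a_low \<le> a' x"
    using assms(5)[unfolded AE_lebesgue_on_iff[OF \<Omega>b]] a'(2) by eventually_elim simp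
  have pair: "AE x in lborel. AE y in lborel. x \<in> \<Omega> \<longrightarrow> y \<in> \<Omega> \<longrightarrow> \<bar>a' x - a' y\<bar> \<le> g' x * norm (x - y) powr \<alpha>"
  proof -
    have \<Omega>2: "\<Omega> \<times> \<Omega> \<in> sets borel" using assms(1) by (intro borel_open open_Times)
    have "AE p in lborel. p \<in> \<Omega> \<times> \<Omega> \<longrightarrow> (case p of (x, y) \<Rightarrow> \<bar>a x - a y\<bar> \<le> g x * norm (x - y) powr \<alpha>)"
      using assms(11) unfolding AE_lebesgue_on_iff[OF \<Omega>2] .
    then have "AE p in lborel \<Otimes>\<^sub>M lborel. p \<in> \<Omega> \<times> \<Omega> \<longrightarrow> (case p of (x, y) \<Rightarrow> \<bar>a x - a y\<bar> \<le> g x * norm (x - y) powr \<alpha>)"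
      by (simp only: lborel_prod)
    from lborel_pair.AE_pair[OF this]
    have "AE x in lborel. AE y in lborel. x \<in> \<Omega> \<longrightarrow> y \<in> \<Omega> \<longrightarrow> \<bar>a x - a y\<bar> \<le> g x * norm (x - y) powr \<alpha>"
      by (auto elim!: eventually_mono)
    with a'(2) g'(2) show ?thesis
    proof eventually_elim
      case (elim x)
      from elim(3) a'(2) show ?case
        by eventually_elim (use elim(1,2) in auto)
    qed
  qed
  define K where "K = max (4 / a_low\<^sup>2) (2 * DIM('a) * ((24 * 8 ^ ?D * exp 2 / ?v)\<^sup>2 * ?v))"
  have K0: "K > 0" using assms(4) by (auto simp: K_def less_max_iff_disj)
  let ?P = "\<lambda>y. (norm (Du' y))\<^sup>2" let ?Q = "\<lambda>y. (norm (F' y))\<^sup>2"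
  have comp: "\<exists>R0>0. \<forall>x R. 0 < R \<and> R < R0 \<and> cball x R \<subseteq> \<Omega> \<longrightarrow>
      half_ball_comparison K \<eta> ?P ?Q x R"
    if \<eta>: "\<eta> > 0" for \<eta>
  proof -
    have "sqrt \<eta> > 0" using \<eta> by simp
    from coefficient_oscillation[OF s(3,1) assms(7) s(2) low pair this]
    obtain R0 where R0: "R0 > 0" and osc: "\<And>x R. 0 < R \<Longrightarrow> R < R0 \<Longrightarrow> ball x R \<subseteq> \<Omega> \<Longrightarrow>
      \<exists>c\<ge>a_low. AE y in lborel. y \<in> ball x R \<longrightarrow> \<bar>a' y - c\<bar> \<le> sqrt \<eta>" by blast
    have "half_ball_comparison K \<eta> ?P ?Q x R"
      if R: "0 < R" "R < R0" and sub: "cball x R \<subseteq> \<Omega>" for x R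
    proof -
      have sub': "ball x R \<subseteq> \<Omega>" using sub ball_subset_cball by blast
      obtain c where c: "c \<ge> a_low" "AE y in lborel. y \<in> ball x R \<longrightarrow> \<bar>a' y - c\<bar> \<le> sqrt \<eta>"
        using osc[OF R sub'] by blast
      have e: "(sqrt \<eta>)\<^sup>2 = \<eta>" using \<eta> by simp
      show ?thesis
        using local_comparison[OF su sDu sF a'(1) R(1) weak'[OF test_functions_mono[OF _ sub']]
            eqn'[OF test_functions_mono[OF _ sub']] assms(4) c, of K]
        unfolding e by (simp add: K_def)
    qed
    then show ?thesis using R0 by blast
  qed
  \<comment> \<open>\<open>Q\<close> to the power \<open>1 + p\<close> is \<open>\<bar>F\<bar>\<^sup>r\<close>.\<close>
  define p where "p = r / 2 - 1"
  have p: "p > 0" using r by (simp add: p_def)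
  have pw: "(t\<^sup>2) powr (1 + p) = t powr r" if "t \<ge> 0" for t :: real
  proof (cases "t = 0")
    case False
    then have "t powr 2 = t\<^sup>2" using that by simp
    then have "(t\<^sup>2) powr (1 + p) = t powr (2 * (1 + p))" by (simp only: powr_powr[symmetric])
    also have "2 * (1 + p) = r" by (simp add: p_def)
    finally show ?thesis .
  qed simp
  have Qp: "integrable lborel (\<lambda>y. ?Q y powr (1 + p))"
    using memLp_real_integrable[OF Fr _ \<Omega>b F'(1,3,2)] r by (simp add: pw)
  have Pi: "integrable lborel ?P" and Qi: "integrable lborel ?Q" by (intro sqi_integrable sDu sF)+
  obtain R0 where R0: "R0 > 0" and fin: "integrable lborel (\<lambda>y. ?P y * (?P y * (min R0 (infdist y (- \<Omega>))) ^ ?D) powr p)"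
    by (rule self_improving_integrability[OF Pi _ Qi _ nU p K0 Qp comp]) auto
  have sub: "open \<Omega>'" "\<Omega>' \<subseteq> \<Omega>" and sd: "setdist \<Omega>' (frontier \<Omega>) > 0"
    using assms(13) by (auto simp: compactly_inside_def)
  have \<Omega>'b: "\<Omega>' \<in> sets borel" using sub by simp
  define \<delta> where "\<delta> = min R0 (setdist \<Omega>' (frontier \<Omega>))"
  have \<delta>: "\<delta> > 0" using R0 sd by (simp add: \<delta>_def)
  have Dum: "Du \<in> borel_measurable (lebesgue_on \<Omega>')"
    using meas(2) sub(2) by (rule measurable_restrict_mono)
  have int: "integrable lborel (\<lambda>y. indicator \<Omega>' y * norm (Du' y) powr r)"
  proof (rule Bochner_Integration.integrable_bound)
    show "integrable lborel (\<lambda>y. 1 / (\<delta> ^ ?D) powr p * (?P y * (?P y * (min R0 (infdist y (- \<Omega>))) ^ ?D) powr p))"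
      using fin by (rule integrable_mult_right)
    show "(\<lambda>y. indicator \<Omega>' y * norm (Du' y) powr r) \<in> borel_measurable lborel"
      by (intro borel_measurable_times borel_measurable_indicator borel_measurable_norm_powr)
        (simp_all add: Du'(1) \<Omega>'b)
    show "AE y in lborel. norm (indicator \<Omega>' y * norm (Du' y) powr r)
      \<le> norm (1 / (\<delta> ^ ?D) powr p * (?P y * (?P y * (min R0 (infdist y (- \<Omega>))) ^ ?D) powr p))"
    proof (rule AE_I2)
      fix y
      show "norm (indicator \<Omega>' y * norm (Du' y) powr r)
        \<le> norm (1 / (\<delta> ^ ?D) powr p * (?P y * (?P y * (min R0 (infdist y (- \<Omega>))) ^ ?D) powr p))"
      proof (cases "y \<in> \<Omega>'")
        case True
        let ?d = "min R0 (infdist y (- \<Omega>))"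
        have "\<delta> \<le> ?d" using setdist_frontier_le_infdist[OF True sub(2) nU] by (auto simp: \<delta>_def)
        then have "\<delta> ^ ?D \<le> ?d ^ ?D" using \<delta> by (intro power_mono) auto
        then have "?P y * \<delta> ^ ?D \<le> ?P y * ?d ^ ?D" by (intro mult_left_mono) auto
        then have "(?P y * \<delta> ^ ?D) powr p \<le> (?P y * ?d ^ ?D) powr p" using \<delta> p by (intro powr_mono2) auto
        then have "?P y powr p * (\<delta> ^ ?D) powr p \<le> (?P y * ?d ^ ?D) powr p" using \<delta> by (simp add: powr_mult)
        then have "?P y powr p \<le> 1 / (\<delta> ^ ?D) powr p * (?P y * ?d ^ ?D) powr p"
          using \<delta> by (simp add: pos_le_divide_eq)
        then have "?P y * ?P y powr p \<le> ?P y * (1 / (\<delta> ^ ?D) powr p * (?P y * ?d ^ ?D) powr p)"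
          by (intro mult_left_mono) auto
        moreover have "?P y * ?P y powr p = norm (Du' y) powr r"
        proof (cases "Du' y = 0")
          case False
          then show ?thesis using pw[of "norm (Du' y)"] by (simp add: powr_add)
        qed simp
        ultimately show ?thesis using True by (simp add: abs_mult mult_ac)
      qed simp
    qed
  qed
  have "integrable (lebesgue_on \<Omega>') (\<lambda>x. norm (Du x) powr r)"
  proof (subst lebesgue_on_transfer(1)[OF \<Omega>'b])
    show "(\<lambda>x. norm (Du x) powr r) \<in> borel_measurable (lebesgue_on \<Omega>')"
      using Dum by (rule borel_measurable_norm_powr)
    show "(\<lambda>y. indicator \<Omega>' y * norm (Du' y) powr r) \<in> borel_measurable borel"
      by (intro borel_measurable_times borel_measurable_indicator borel_measurable_norm_powr Du'(1) \<Omega>'b)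
    show "AE x in lborel. x \<in> \<Omega>' \<longrightarrow> indicator \<Omega>' x * norm (Du' x) powr r = norm (Du x) powr r"
      using Du'(2) by eventually_elim (use sub(2) in auto)
  qed (use int in auto)
  then show "memLp (ennreal r) \<Omega>' Du" using Dum r by (simp add: memLp_def)
qed

end
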